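(* Assume the diffusive-scaling assumption (a)--(d) and the limit-stability assumption (e)--(f) stated in the context, with $p_\xi\ge3$ and $p_{\bar X}\ge3$. Let $\gamma\in(0,1)$ and assume that there exist $\gamma_\circ\in(0,\gamma]$ and $(\delta\gamma,\delta C)\in(0,1)\times\mathbb R$ such that, for each $\varepsilon\in(0,1)$, there are $\delta\bar\rho^*_\varepsilon\in\mathbb R$ and $\delta\bar{\mathrm w}_\varepsilon\in C^0_{\rm lin}(\mathbb R^d)$ satisfying $\|\delta\bar{\mathrm w}_\varepsilon\|_{C^{2,\delta\gamma}_b(B_1(x))}\le\delta C(1+|x|)$ for all $x\in\mathbb R^d$ and $$\delta\bar\rho^*_\varepsilon=\sup_{\bar a\in\mathbb A}\Big[\bar{\mathcal L}^{\bar a}\delta\bar{\mathrm w}_\varepsilon+\varepsilon^{-\frac{\gamma_\circ}2}[\delta r_\varepsilon+f](\cdot,\bar a)\Big]\ \text{on }\mathbb R^d,\qquad f(\cdot,\bar a):=\bar{\mathcal L}^{\bar a}\bar{\mathrm w}+r(\cdot,\bar a)-\bar\rho^*.$$ Then $$\limsup_{\varepsilon\downarrow0}|\delta\bar\rho^*_\varepsilon|<\infty,$$ and $\bar\rho^{*(1)}_\varepsilon:=\bar\rho^*+\varepsilon^{\frac{\gamma_\circ}2}\delta\bar\rho^*_\varepsilon$, $\varepsilon\in(0,1)$, satisfies $$\limsup_{\varepsilon\downarrow0}\varepsilon^{-\frac{\gamma_\circ+\delta\gamma}2}|\rho^*_\varepsilon-\bar\rho^{*(1)}_\varepsilon|<\infty.$$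 Moreover, for each $\varepsilon\in(0,1)$ there exists a measurable map $\hat{\mathrm a}_\varepsilon:\mathbb R^d\to\mathbb A$ such that $$\bar{\mathcal L}^{\hat{\mathrm a}_\varepsilon}\delta\bar{\mathrm w}_\varepsilon+\varepsilon^{-\frac{\gamma_\circ}2}[\delta r_\varepsilon+f](\cdot,\hat{\mathrm a}_\varepsilon)=\sup_{\bar a\in\mathbb A}\Big[\bar{\mathcal L}^{\bar a}\delta\bar{\mathrm w}_\varepsilon+\varepsilon^{-\frac{\gamma_\circ}2}[\delta r_\varepsilon+f](\cdot,\bar a)\Big]\ \text{on }\mathbb R^d,$$ and $$\limsup_{\varepsilon\downarrow0}\varepsilon^{-\frac{\gamma_\circ+\delta\gamma}2}|\rho^*_\varepsilon-\rho_\varepsilon(0,\hat{\mathrm a}_\varepsilon(X^{\hat{\mathrm a}_\varepsilon}_{\cdot-}))|<\infty,$$ in which $X^{\hat{\mathrm a}_\varepsilon}$ solves $X^{\hat{\mathrm a}_\varepsilon}=\int_0^\cdot\int_{\mathbb R^{d'}}b_\varepsilon(X^{\hat{\mathrm a}_\varepsilon}_{s-},\hat{\mathrm a}_\varepsilon(X^{\hat{\mathrm a}_\varepsilon}_{s-}),e)N(\mathrm de,\mathrm ds)$.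
   Context: **Pure jump problem.** Let $d,d',m\in\mathbb N^*$, $\mathbb A\subset\mathbb R^m$ compact, $\nu$ a probability measure on $\mathbb R^{d'}$. For $\varepsilon\in(0,1)$ put $\eta_\varepsilon:=\varepsilon^{-1}$ and let $N(\mathrm de,\mathrm dt)$ (dependence on $\varepsilon$ omitted) be an $\mathbb R^{d'}$-marked point process on a probability space with compensator $\eta_\varepsilon\nu(\mathrm de)\mathrm dt$; $N_t:=N(\mathbb R^{d'},[0,t])$. $\mathbb F$ is the augmented filtration generated by $(\int_0^t\int e\,N(\mathrm de,\mathrm ds))_{t\ge0}$ and $\mathcal A$ is the set of $\mathbb F$-predictable $\mathbb A$-valued processes. For $(x,\alpha)\in\mathbb R^d\times\mathcal A$, $X^{x,\alpha}$ solves $X^{x,\alpha}_\cdot=x+\int_0^\cdot\int_{\mathbb R^{d'}}b_\varepsilon(X^{x,\alpha}_{s-},\alpha_s,e)N(\mathrm de,\mathrm ds)$, and $$\rho_\varepsilon(x,\alpha):=\liminf_{T\to\infty}\frac1{\eta_\varepsilon T}\mathbb E\Big[\int_0^Tr(X^{x,\alpha}_{t-},\alpha_t)\mathrm dN_t\Big],\qquad \rho^*_\varepsilon:=\sup_{\alpha\in\mathcal A}\rho_\varepsilon(0,\alpha).$$ **Diffusive-scaling assumption.** $b_\varepsilon=\varepsilon b_1+\sqrt\varepsilon\, b_2$ with $b_1:\mathbb R^d\times\mathbb A\times\mathbb R^{d'}\to\mathbb R^d$ and $b_2:\mathbb R^d\times\mathbb R^{d'}\to\mathbb R^d$ continuous,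 and: (a) There is $L_{b_1,b_2}>0$ with $\sup_x\frac{|b_1(x,a,e)|}{1+|x|}+\sup_x|b_2(x,e)|\le L_{b_1,b_2}$ for all $(a,e)\in\mathbb A\times\mathbb R^{d'}$. (b) $\int b_2(\cdot,e)\nu(\mathrm de)=0$ and $\int b_2b_2^\top(\cdot,e)\nu(\mathrm de)\ge\varsigma I_d$ for some $\varsigma>0$. (c) $\mu(x,a):=\int b_1(x,a,e)\nu(\mathrm de)$ is Lipschitz in $x$ uniformly in $a$, and there is a Lipschitz $\sigma:\mathbb R^d\to\mathbb R^{d\times d}$ with $\sigma\sigma^\top=\int b_2b_2^\top(\cdot,e)\nu(\mathrm de)$. (d) The following hold for every $\varepsilon\in(0,1)$, with functions $\zeta,\xi$ and constants not depending on $\varepsilon$: - $r:\mathbb R^d\times\mathbb A\to\mathbb R$ is continuous, and there is $L_{b,r}>0$ such that for all $(a,e)$: $\sup_x\frac{|b_\varepsilon(x,a,e)|}{1+|x|}+\sup_x|r(x,a)|+\mathrm{Lip}(r(\cdot,a))\le L_{b,r}$. - There is a continuous $\zeta:\mathbb R^d\times\mathbb R^d\to\mathbb R_+$, $\ell_\zeta,L_\zeta,C_\zeta>0$, $p_\zeta\ge1$ with $\ell_\zeta|x-x'|^{p_\zeta}\le\zeta(x,x')\le L_\zeta|x-x'|^{p_\zeta}$ and $\eta_\varepsilon\int\{\zeta(x+b_\varepsilon(x,a,e),x'+b_\varepsilon(x',a,e))-\zeta(x,x')\}\nu(\mathrm de)\le-C_\zeta\zeta(x,x')$ for all $x,x'\in\mathbb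 R^d$, $a\in\mathbb A$. - There is a continuous $\xi:\mathbb R^d\to\mathbb R_+$, $\ell_\xi,L_\xi,C^1_\xi>0$, $C^2_\xi\in\mathbb R$, $p_\xi\ge1$ with $\ell_\xi|x|^{p_\xi}\le\xi(x)\le L_\xi|x|^{p_\xi}$ and $\eta_\varepsilon\int\{\xi(x+b_\varepsilon(x,a,e))-\xi(x)\}\nu(\mathrm de)\le-C^1_\xi\xi(x)+C^2_\xi$ for all $x\in\mathbb R^d$, $a\in\mathbb A$. **Limit diffusion problem.** $W$ is a $d$-dimensional Brownian motion, $\bar{\mathcal A}$ the set of $\mathbb A$-valued processes predictable for its augmented filtration, and $\bar X^{x,\bar\alpha}$ is the strong solution of $\mathrm d\bar X_s=\mu(\bar X_s,\bar\alpha_s)\mathrm ds+\sigma(\bar X_s)\mathrm dW_s$, $\bar X_0=x$. Put $\bar\rho^*(x):=\sup_{\bar\alpha\in\bar{\mathcal A}}\liminf_{T\to\infty}\frac1T\mathbb E[\int_0^Tr(\bar X^{x,\bar\alpha}_t,\bar\alpha_t)\mathrm dt]$ and $\bar V_\lambda(x):=\sup_{\bar\alpha\in\bar{\mathcal A}}\mathbb E[\int_0^\infty e^{-\lambda s}r(\bar X^{x,\bar\alpha}_s,\bar\alpha_s)\mathrm ds]$, $\lambda>0$. For smooth $\varphi$, $\bar{\mathcal L}^{\bar a}\varphi:=\mathrm D\varphi\,\mu(\cdot,\bar a)+\frac12\mathrm{Tr}[\sigma\sigma^\top\mathrm D^2\varphi]$ ($\mathrm D\varphi$ is a row vector). **Limit-stability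 assumption.** There are $L_{\bar V},C_{\bar X}>0$, $p_{\bar X}\ge1$ such that: (e) $|\bar V_\lambda(x)-\bar V_\lambda(x')|\le L_{\bar V}|x-x'|$ for all $x,x'$ and $\lambda\in(0,1)$; (f) $\mathbb E[|\bar X^{x,\bar\alpha}_t|^{p_{\bar X}}]\le C_{\bar X}\{e^{-t/C_{\bar X}}|x|^{p_{\bar X}}+1\}$ for all $x,\bar\alpha$, $t\ge0$. **The function $\bar{\mathrm w}$ and the residual $\delta r_\varepsilon$.** Under these assumptions $\bar\rho^*$ is constant on $\mathbb R^d$, and $\bar{\mathrm w}$ denotes a fixed locally uniform limit of $\bar V_{\lambda_n}-\bar V_{\lambda_n}(0)$ along some $\lambda_n\to0$ such that: $\bar{\mathrm w}\in C^2(\mathbb R^d)$, $\bar{\mathrm w}$ is globally Lipschitz, $\bar\rho^*=\sup_{\bar a\in\mathbb A}\{\bar{\mathcal L}^{\bar a}\bar{\mathrm w}+r(\cdot,\bar a)\}$ on $\mathbb R^d$, and for every $\gamma\in(0,1)$ there is $L^\gamma_{\bar{\mathrm w}}$ with $\|\bar{\mathrm w}\|_{C^{2,\gamma}_b(B_1(x))}\le L^\gamma_{\bar{\mathrm w}}(1+|x|)$ for all $x$ (such a limit exists). For $(x,a)\in\mathbb R^d\times\mathbb A$, $$\delta r_\varepsilon(x,a):=\frac1\varepsilon\int_{\mathbb R^{d'}}[\bar{\mathrm w}(x+b_\varepsilon(x,a,e))-\bar{\mathrm w}(x)]\nu(\mathrm de)-\mathrm D\bar{\mathrm w}(x)\mu(x,a)-\tfrac12\mathrm{Tr}[\sigma\sigma^\top(x)\mathrm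 D^2\bar{\mathrm w}(x)].$$ **Function spaces.** $C^0_{\rm lin}(\mathbb R^d)$ is the set of continuous $u$ with $\sup_x|u(x)|/(1+|x|)<\infty$. $\|u\|_{C^{2,\gamma}_b(O)}=\sum_{j=0}^2\sup_O|\mathrm D^ju|+\sup_{x\ne x'\in O}\frac{|\mathrm D^2u(x)-\mathrm D^2u(x')|}{|x-x'|^\gamma}$. $B_1(x)$ is the open unit ball centred at $x$. *)

theory Defs
  imports "HOL-Probability.Probability"
begin

text \<open>Processes are functions of a real time of which only the values on \<open>[0,\<infinity>)\<close> matter.
  The augmentation adds the null sets of \<open>M\<close>; when \<open>M\<close> is complete this is the usual completed
  filtration. Passing to right limits in time would not change the predictable processes.\<close>

definition augmented_filtration ::
  "'w measure \<Rightarrow> (real \<Rightarrow> 'w \<Rightarrow> 'b::topological_space) \<Rightarrow> real \<Rightarrow> 'w measure" where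
  "augmented_filtration M Y t = sigma (space M)
     ({Y s -` B \<inter> space M | s B. 0 \<le> s \<and> s \<le> t \<and> B \<in> sets borel} \<union> null_sets M)"

definition adapted ::
  "(real \<Rightarrow> 'w measure) \<Rightarrow> (real \<Rightarrow> 'w \<Rightarrow> 'b::topological_space) \<Rightarrow> bool" where
  "adapted F X \<longleftrightarrow> (\<forall>t\<ge>0. X t \<in> borel_measurable (F t))"

definition predictable_sigma :: "'w measure \<Rightarrow> (real \<Rightarrow> 'w measure) \<Rightarrow> (real \<times> 'w) measure" where
  "predictable_sigma M F = sigma ({0..} \<times> space M)
     ({{0} \<times> B | B. B \<in> sets (F 0)} \<union>
      {{s<..t} \<times> B | s t B. 0 \<le> s \<and> s < t \<and> B \<in> sets (F s)})"

definition predictable_controls ::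
  "'w measure \<Rightarrow> (real \<Rightarrow> 'w measure) \<Rightarrow> 'a::topological_space set \<Rightarrow> (real \<Rightarrow> 'w \<Rightarrow> 'a) set" where
  "predictable_controls M F A =
     {\<alpha>. (\<lambda>(t, \<omega>). \<alpha> t \<omega>) \<in> borel_measurable (predictable_sigma M F) \<and>
         (\<forall>t\<ge>0. \<forall>\<omega>\<in>space M. \<alpha> t \<omega> \<in> A)}"

text \<open>\<open>X\<^sub>t\<^sub>-\<close>, with the convention \<open>X\<^sub>0\<^sub>- = X\<^sub>0\<close>.\<close>

definition left_lim :: "(real \<Rightarrow> 'w \<Rightarrow> 'b::t2_space) \<Rightarrow> real \<Rightarrow> 'w \<Rightarrow> 'b" where
  "left_lim X t \<omega> = (if t \<le> 0 then X 0 \<omega> else Lim (at_left t) (\<lambda>s. X s \<omega>))"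

definition cadlag_paths :: "'w measure \<Rightarrow> (real \<Rightarrow> 'w \<Rightarrow> 'b::topological_space) \<Rightarrow> bool" where
  "cadlag_paths M X \<longleftrightarrow> (\<forall>\<omega>\<in>space M.
     (\<forall>t\<ge>0. ((\<lambda>s. X s \<omega>) \<longlongrightarrow> X t \<omega>) (at_right t)) \<and>
     (\<forall>t>0. \<exists>l. ((\<lambda>s. X s \<omega>) \<longlongrightarrow> l) (at_left t)))"

text \<open>\<open>N \<omega>\<close> is the counting measure \<open>\<Sum>\<^sub>n \<delta>\<^bsub>(E\<^sub>n, T\<^sub>n)\<^esub>\<close> on marks and times, over the \<open>n\<close> with
  \<open>T\<^sub>n < \<infinity>\<close>.\<close>

definition marked_point_process ::
  "'w measure \<Rightarrow> ('w \<Rightarrow> ('e::euclidean_space \<times> real) measure) \<Rightarrow> bool" where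
  "marked_point_process M N \<longleftrightarrow> (\<exists>(T :: nat \<Rightarrow> 'w \<Rightarrow> ereal) (E :: nat \<Rightarrow> 'w \<Rightarrow> 'e).
     (\<forall>n. T n \<in> borel_measurable M \<and> E n \<in> borel_measurable M) \<and>
     (\<forall>\<omega>\<in>space M. 0 < T 0 \<omega> \<and>
        (\<forall>n. T n \<omega> \<le> T (Suc n) \<omega> \<and> (T n \<omega> < \<infinity> \<longrightarrow> T n \<omega> < T (Suc n) \<omega>))) \<and>
     (AE \<omega> in M. (\<lambda>n. T n \<omega>) \<longlonglongrightarrow> \<infinity>) \<and>
     (\<forall>\<omega>\<in>space M. N \<omega> =
        distr (count_space {n. T n \<omega> < \<infinity>}) borel (\<lambda>n. (E n \<omega>, real_of_ereal (T n \<omega>)))))"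

text \<open>The augmented filtration generated by \<open>t \<mapsto> \<integral>\<^sub>0\<^sup>t \<integral> e N(de, ds)\<close>.\<close>

definition mark_filtration ::
  "'w measure \<Rightarrow> ('w \<Rightarrow> ('e::euclidean_space \<times> real) measure) \<Rightarrow> real \<Rightarrow> 'w measure" where
  "mark_filtration M N =
     augmented_filtration M (\<lambda>t \<omega>. LINT z:UNIV \<times> {0..t}|N \<omega>. fst z)"

text \<open>\<open>K\<close> is the (here deterministic) \<open>F\<close>-compensator of \<open>N\<close>. As usual, the notion presupposes that
  \<open>N\<close> is adapted to \<open>F\<close>. For \<open>F = mark_filtration M N\<close> this means that jumps with mark \<open>0\<close>, which
  the generating process does not see, almost surely do not occur.\<close>

definition has_compensator ::
  "'w measure \<Rightarrow> (real \<Rightarrow> 'w measure) \<Rightarrow> ('w \<Rightarrow> ('e::euclidean_space \<times> real) measure) \<Rightarrow>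
   ('e \<times> real) measure \<Rightarrow> bool" where
  "has_compensator M F N K \<longleftrightarrow>
     (\<forall>B\<in>sets borel. adapted F (\<lambda>t \<omega>. emeasure (N \<omega>) (B \<times> {0..t}))) \<and>
     (\<forall>H\<in>borel_measurable (predictable_sigma M F \<Otimes>\<^sub>M borel).
        (\<integral>\<^sup>+\<omega>. (\<integral>\<^sup>+z\<in>UNIV \<times> {0..}. H ((snd z, \<omega>), fst z) \<partial>N \<omega>) \<partial>M) =
        (\<integral>\<^sup>+\<omega>. (\<integral>\<^sup>+z\<in>UNIV \<times> {0..}. H ((snd z, \<omega>), fst z) \<partial>K) \<partial>M))"

definition jump_solution ::
  "'w measure \<Rightarrow> ('w \<Rightarrow> ('e::euclidean_space \<times> real) measure) \<Rightarrow> ('x \<Rightarrow> 'a \<Rightarrow> 'e \<Rightarrow> 'x) \<Rightarrow>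
   'x::euclidean_space \<Rightarrow> (real \<Rightarrow> 'w \<Rightarrow> 'a) \<Rightarrow> (real \<Rightarrow> 'w \<Rightarrow> 'x) \<Rightarrow> bool" where
  "jump_solution M N b x \<alpha> X \<longleftrightarrow>
     adapted (mark_filtration M N) X \<and> cadlag_paths M X \<and>
     (AE \<omega> in M. \<forall>t\<ge>0. X t \<omega> =
        x + (LINT z:UNIV \<times> {0..t}|N \<omega>. b (left_lim X (snd z) \<omega>) (\<alpha> (snd z) \<omega>) (fst z)))"

text \<open>The solution is unique up to indistinguishability, so the choice below is immaterial for the
  rewards.\<close>

definition jump_state ::
  "'w measure \<Rightarrow> ('w \<Rightarrow> ('e::euclidean_space \<times> real) measure) \<Rightarrow> ('x \<Rightarrow> 'a \<Rightarrow> 'e \<Rightarrow> 'x) \<Rightarrow>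
   'x::euclidean_space \<Rightarrow> (real \<Rightarrow> 'w \<Rightarrow> 'a) \<Rightarrow> real \<Rightarrow> 'w \<Rightarrow> 'x" where
  "jump_state M N b x \<alpha> = (SOME X. jump_solution M N b x \<alpha> X)"

text \<open>\<open>distr (N \<omega>) borel snd\<close> is the measure \<open>dN\<^sub>t\<close> on the time axis; \<open>\<eta>\<close> is the jump intensity.
  Rewards are extended reals, so that suprema and limits are always meaningful.\<close>

definition jump_reward ::
  "'w measure \<Rightarrow> ('w \<Rightarrow> ('e::euclidean_space \<times> real) measure) \<Rightarrow> ('x \<Rightarrow> 'a \<Rightarrow> 'e \<Rightarrow> 'x) \<Rightarrow>
   ('x \<Rightarrow> 'a \<Rightarrow> real) \<Rightarrow> real \<Rightarrow> 'x::euclidean_space \<Rightarrow> (real \<Rightarrow> 'w \<Rightarrow> 'a) \<Rightarrow> ereal" where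
  "jump_reward M N b r \<eta> x \<alpha> = Liminf at_top (\<lambda>T. ereal (1 / (\<eta> * T) *
     (\<integral>\<omega>. (LINT t:{0..T}|distr (N \<omega>) borel snd.
        r (left_lim (jump_state M N b x \<alpha>) t \<omega>) (\<alpha> t \<omega>)) \<partial>M)))"

definition jump_value ::
  "'w measure \<Rightarrow> ('w \<Rightarrow> ('e::euclidean_space \<times> real) measure) \<Rightarrow> ('x \<Rightarrow> 'a \<Rightarrow> 'e \<Rightarrow> 'x) \<Rightarrow>
   ('x::euclidean_space \<Rightarrow> 'a \<Rightarrow> real) \<Rightarrow> real \<Rightarrow> 'a::topological_space set \<Rightarrow> ereal" where
  "jump_value M N b r \<eta> A =
     (SUP \<alpha>\<in>predictable_controls M (mark_filtration M N) A. jump_reward M N b r \<eta> 0 \<alpha>)"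

definition brownian_motion :: "'v measure \<Rightarrow> (real \<Rightarrow> 'v \<Rightarrow> real ^ 'd) \<Rightarrow> bool" where
  "brownian_motion P W \<longleftrightarrow>
     prob_space P \<and>
     (\<forall>t\<ge>0. W t \<in> borel_measurable P) \<and>
     (AE \<omega> in P. W 0 \<omega> = 0) \<and>
     (\<forall>\<omega>\<in>space P. continuous_on {0..} (\<lambda>t. W t \<omega>)) \<and>
     (\<forall>s\<ge>0. \<forall>t>s.
        distributed P lborel (\<lambda>\<omega>. W t \<omega> - W s \<omega>)
          (\<lambda>z. ennreal (\<Prod>i\<in>UNIV. normal_density 0 (sqrt (t - s)) (z $ i))) \<and>
        prob_space.indep_set P
          (sigma_sets (space P) {W u -` B \<inter> space P | u B. 0 \<le> u \<and> u \<le> s \<and> B \<in> sets borel})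
          {(\<lambda>\<omega>. W t \<omega> - W s \<omega>) -` B \<inter> space P | B. B \<in> sets borel})"

text \<open>Bounded simple predictable integrands \<open>\<Sum>\<^sub>k \<xi>\<^sub>k 1\<^bsub>(\<tau>\<^sub>k, \<tau>\<^sub>k\<^sub>+\<^sub>1]\<^esub>\<close> with values in the matrices, and
  their stochastic integrals.\<close>

definition simple_integrand ::
  "'v measure \<Rightarrow> (real \<Rightarrow> 'v measure) \<Rightarrow> nat \<Rightarrow> (nat \<Rightarrow> real) \<Rightarrow> (nat \<Rightarrow> 'v \<Rightarrow> real ^ 'd ^ 'd) \<Rightarrow> bool"
  where
  "simple_integrand P F K \<tau> \<xi> \<longleftrightarrow>
     0 \<le> \<tau> 0 \<and> (\<forall>k<K. \<tau> k \<le> \<tau> (Suc k)) \<and>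
     (\<forall>k<K. \<xi> k \<in> borel_measurable (F (\<tau> k)) \<and> (\<exists>C. \<forall>\<omega>\<in>space P. norm (\<xi> k \<omega>) \<le> C))"

definition simple_process ::
  "nat \<Rightarrow> (nat \<Rightarrow> real) \<Rightarrow> (nat \<Rightarrow> 'v \<Rightarrow> real ^ 'd ^ 'd) \<Rightarrow> real \<Rightarrow> 'v \<Rightarrow> real ^ 'd ^ 'd" where
  "simple_process K \<tau> \<xi> s \<omega> = (\<Sum>k<K. indicator {\<tau> k<..\<tau> (Suc k)} s *\<^sub>R \<xi> k \<omega>)"

definition simple_ito ::
  "(real \<Rightarrow> 'v \<Rightarrow> real ^ 'd) \<Rightarrow> nat \<Rightarrow> (nat \<Rightarrow> real) \<Rightarrow> (nat \<Rightarrow> 'v \<Rightarrow> real ^ 'd ^ 'd) \<Rightarrow>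
   real \<Rightarrow> 'v \<Rightarrow> real ^ 'd" where
  "simple_ito W K \<tau> \<xi> t \<omega> =
     (\<Sum>k<K. \<xi> k \<omega> *v (W (min t (\<tau> (Suc k))) \<omega> - W (min t (\<tau> k)) \<omega>))"

text \<open>\<open>I = \<integral>\<^sub>0 H dW\<close> for locally square integrable \<open>H\<close>: the limit, locally uniformly in time in
  probability, of the integrals of simple processes approximating \<open>H\<close> in \<open>L\<^sup>2(0,T)\<close> in probability
  for all \<open>T\<close>.\<close>

definition ito_integral ::
  "'v measure \<Rightarrow> (real \<Rightarrow> 'v measure) \<Rightarrow> (real \<Rightarrow> 'v \<Rightarrow> real ^ 'd) \<Rightarrow>
   (real \<Rightarrow> 'v \<Rightarrow> real ^ 'd ^ 'd) \<Rightarrow> (real \<Rightarrow> 'v \<Rightarrow> real ^ 'd) \<Rightarrow> bool" where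
  "ito_integral P F W H I \<longleftrightarrow>
     adapted F H \<and>
     (\<lambda>(s, \<omega>). H s \<omega>) \<in> borel_measurable (restrict_space borel {0..} \<Otimes>\<^sub>M P) \<and>
     adapted F I \<and> (\<forall>\<omega>\<in>space P. continuous_on {0..} (\<lambda>t. I t \<omega>)) \<and>
     (\<exists>K \<tau> \<xi>. (\<forall>n. simple_integrand P F (K n) (\<tau> n) (\<xi> n)) \<and>
        (\<forall>T\<ge>0. \<forall>\<delta>>0.
           (\<lambda>n. measure P {\<omega>\<in>space P. ennreal \<delta> <
              (\<integral>\<^sup>+s\<in>{0..T}. ennreal ((norm (simple_process (K n) (\<tau> n) (\<xi> n) s \<omega> - H s \<omega>))\<^sup>2) \<partial>lborel)})
             \<longlonglongrightarrow> 0 \<and>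
           (\<lambda>n. measure P {\<omega>\<in>space P. \<exists>t\<in>{0..T}.
              \<delta> < norm (simple_ito W (K n) (\<tau> n) (\<xi> n) t \<omega> - I t \<omega>)})
             \<longlonglongrightarrow> 0))"

definition strong_solution ::
  "'v measure \<Rightarrow> (real \<Rightarrow> 'v \<Rightarrow> real ^ 'd) \<Rightarrow> (real ^ 'd \<Rightarrow> 'a \<Rightarrow> real ^ 'd) \<Rightarrow>
   (real ^ 'd \<Rightarrow> real ^ 'd ^ 'd) \<Rightarrow> real ^ 'd \<Rightarrow> (real \<Rightarrow> 'v \<Rightarrow> 'a) \<Rightarrow> (real \<Rightarrow> 'v \<Rightarrow> real ^ 'd) \<Rightarrow> bool"
  where
  "strong_solution P W \<mu> \<sigma> x \<alpha> X \<longleftrightarrow>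
     adapted (augmented_filtration P W) X \<and>
     (\<forall>\<omega>\<in>space P. continuous_on {0..} (\<lambda>t. X t \<omega>)) \<and>
     (\<exists>I. ito_integral P (augmented_filtration P W) W (\<lambda>s \<omega>. \<sigma> (X s \<omega>)) I \<and>
        (AE \<omega> in P. \<forall>t\<ge>0. X t \<omega> =
           x + (LINT s:{0..t}|lborel. \<mu> (X s \<omega>) (\<alpha> s \<omega>)) + I t \<omega>))"

definition diffusion_state ::
  "'v measure \<Rightarrow> (real \<Rightarrow> 'v \<Rightarrow> real ^ 'd) \<Rightarrow> (real ^ 'd \<Rightarrow> 'a \<Rightarrow> real ^ 'd) \<Rightarrow>
   (real ^ 'd \<Rightarrow> real ^ 'd ^ 'd) \<Rightarrow> real ^ 'd \<Rightarrow> (real \<Rightarrow> 'v \<Rightarrow> 'a) \<Rightarrow> real \<Rightarrow> 'v \<Rightarrow> real ^ 'd" where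
  "diffusion_state P W \<mu> \<sigma> x \<alpha> = (SOME X. strong_solution P W \<mu> \<sigma> x \<alpha> X)"

definition diffusion_ergodic_value ::
  "'v measure \<Rightarrow> (real \<Rightarrow> 'v \<Rightarrow> real ^ 'd) \<Rightarrow> (real ^ 'd \<Rightarrow> 'a \<Rightarrow> real ^ 'd) \<Rightarrow>
   (real ^ 'd \<Rightarrow> real ^ 'd ^ 'd) \<Rightarrow> (real ^ 'd \<Rightarrow> 'a \<Rightarrow> real) \<Rightarrow> 'a::topological_space set \<Rightarrow>
   real ^ 'd \<Rightarrow> ereal" where
  "diffusion_ergodic_value P W \<mu> \<sigma> r A x =
     (SUP \<alpha>\<in>predictable_controls P (augmented_filtration P W) A.
        Liminf at_top (\<lambda>T. ereal (1 / T *
          (\<integral>\<omega>. (LINT t:{0..T}|lborel. r (diffusion_state P W \<mu> \<sigma> x \<alpha> t \<omega>) (\<alpha> t \<omega>)) \<partial>P))))"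

text \<open>A real supremum: it is used for bounded \<open>r\<close> and nonempty \<open>A\<close> only.\<close>

definition diffusion_discounted_value ::
  "'v measure \<Rightarrow> (real \<Rightarrow> 'v \<Rightarrow> real ^ 'd) \<Rightarrow> (real ^ 'd \<Rightarrow> 'a \<Rightarrow> real ^ 'd) \<Rightarrow>
   (real ^ 'd \<Rightarrow> real ^ 'd ^ 'd) \<Rightarrow> (real ^ 'd \<Rightarrow> 'a \<Rightarrow> real) \<Rightarrow> 'a::topological_space set \<Rightarrow>
   real \<Rightarrow> real ^ 'd \<Rightarrow> real" where
  "diffusion_discounted_value P W \<mu> \<sigma> r A l x =
     (SUP \<alpha>\<in>predictable_controls P (augmented_filtration P W) A.
        (\<integral>\<omega>. (LINT s:{0..}|lborel.
           exp (- l * s) * r (diffusion_state P W \<mu> \<sigma> x \<alpha> s \<omega>) (\<alpha> s \<omega>)) \<partial>P))"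

definition outer :: "real ^ 'd \<Rightarrow> real ^ 'd \<Rightarrow> real ^ 'd ^ 'd" where
  "outer v w = (\<chi> i j. v $ i * w $ j)"

text \<open>Loewner order: \<open>B - A\<close> is positive semidefinite.\<close>

definition loewner_le :: "real ^ 'd ^ 'd \<Rightarrow> real ^ 'd ^ 'd \<Rightarrow> bool" where
  "loewner_le A B \<longleftrightarrow> (\<forall>v. 0 \<le> v \<bullet> ((B - A) *v v))"

definition lip_const :: "('x::metric_space \<Rightarrow> real) \<Rightarrow> ereal" where
  "lip_const f = (SUP (x, y)\<in>{(x, y). x \<noteq> y}. ereal (\<bar>f x - f y\<bar> / dist x y))"

definition grad :: "(real ^ 'd \<Rightarrow> real) \<Rightarrow> real ^ 'd \<Rightarrow> real ^ 'd" where
  "grad \<phi> x = (\<chi> i. frechet_derivative \<phi> (at x) (axis i 1))"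

definition hess :: "(real ^ 'd \<Rightarrow> real) \<Rightarrow> real ^ 'd \<Rightarrow> real ^ 'd ^ 'd" where
  "hess \<phi> x = matrix (frechet_derivative (grad \<phi>) (at x))"

text \<open>\<open>C\<^sup>2\<close> on an open set \<open>U\<close>.\<close>

definition C2_on :: "(real ^ 'd) set \<Rightarrow> (real ^ 'd \<Rightarrow> real) \<Rightarrow> bool" where
  "C2_on U \<phi> \<longleftrightarrow>
     (\<forall>x\<in>U. \<phi> differentiable (at x) \<and> grad \<phi> differentiable (at x)) \<and> continuous_on U (hess \<phi>)"

text \<open>The norm of \<open>C\<^sup>2\<^sup>,\<^sup>\<gamma>\<^sub>b(U)\<close>, infinite for functions outside that space.\<close>

definition C2_hoelder_norm :: "real \<Rightarrow> (real ^ 'd) set \<Rightarrow> (real ^ 'd \<Rightarrow> real) \<Rightarrow> ereal" where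
  "C2_hoelder_norm \<gamma> U u =
     (if C2_on U u then
        (SUP x\<in>U. ereal \<bar>u x\<bar>) + (SUP x\<in>U. ereal (norm (grad u x))) +
        (SUP x\<in>U. ereal (norm (hess u x))) +
        (SUP (x, y)\<in>{(x, y). x \<in> U \<and> y \<in> U \<and> x \<noteq> y}.
           ereal (norm (hess u x - hess u y) / norm (x - y) powr \<gamma>))
      else \<infinity>)"

definition C0_lin :: "(real ^ 'd \<Rightarrow> real) set" where
  "C0_lin = {u. continuous_on UNIV u \<and> (SUP x. ereal (\<bar>u x\<bar> / (1 + norm x))) < \<infinity>}"

definition generator ::
  "(real ^ 'd \<Rightarrow> 'a \<Rightarrow> real ^ 'd) \<Rightarrow> (real ^ 'd \<Rightarrow> real ^ 'd ^ 'd) \<Rightarrow> 'a \<Rightarrow>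
   (real ^ 'd \<Rightarrow> real) \<Rightarrow> real ^ 'd \<Rightarrow> real" where
  "generator \<mu> \<sigma> a \<phi> x =
     grad \<phi> x \<bullet> \<mu> x a + 1 / 2 * trace (\<sigma> x ** transpose (\<sigma> x) ** hess \<phi> x)"

definition scaled_coeff ::
  "('x \<Rightarrow> 'a \<Rightarrow> 'e \<Rightarrow> 'x) \<Rightarrow> ('x \<Rightarrow> 'e \<Rightarrow> 'x) \<Rightarrow> real \<Rightarrow> 'x::real_vector \<Rightarrow> 'a \<Rightarrow> 'e \<Rightarrow> 'x" where
  "scaled_coeff b1 b2 \<epsilon> x a e = \<epsilon> *\<^sub>R b1 x a e + sqrt \<epsilon> *\<^sub>R b2 x e"

definition residual ::
  "'e measure \<Rightarrow> (real ^ 'd \<Rightarrow> 'a \<Rightarrow> 'e \<Rightarrow> real ^ 'd) \<Rightarrow> (real ^ 'd \<Rightarrow> 'a \<Rightarrow> real ^ 'd) \<Rightarrow>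
   (real ^ 'd \<Rightarrow> real ^ 'd ^ 'd) \<Rightarrow> (real ^ 'd \<Rightarrow> real) \<Rightarrow> real \<Rightarrow> real ^ 'd \<Rightarrow> 'a \<Rightarrow> real" where
  "residual \<nu> b \<mu> \<sigma> w \<epsilon> x a =
     1 / \<epsilon> * (\<integral>e. w (x + b x a e) - w x \<partial>\<nu>) - grad w x \<bullet> \<mu> x a
       - 1 / 2 * trace (\<sigma> x ** transpose (\<sigma> x) ** hess w x)"

end

theory Submission
  imports Defs
begin

text \<open>
  Let \<open>\<phi> = w + \<epsilon> powr (\<gamma>\<^sub>0 / 2) * \<delta>w\<close> be the corrected potential. A Taylor expansion shows that the
  residual of \<open>\<delta>w\<close>, the difference between the rescaled jump generator and the diffusion generator,
  is of order \<open>\<epsilon> powr (\<delta>\<gamma> / 2) * (1 + |x|)^3\<close>. By the two Bellman equations the drift of \<open>\<phi>\<close> along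
  the jump process plus the running reward is therefore at most
  \<open>\<rho>_bar + \<epsilon> powr (\<gamma>\<^sub>0 / 2) * \<delta>\<rho> + C * \<epsilon> powr ((\<gamma>\<^sub>0 + \<delta>\<gamma>) / 2) * (1 + |x|)^3\<close> for every action, with the
  reverse inequality (and \<open>- C\<close>) for a maximising action. Dynkin's formula, divided by the horizon,
  turns this into bounds on the rewards of all controls and of the feedback control: the Lyapunov
  function \<open>\<xi>\<close> bounds the time averages of the third moments uniformly in \<open>\<epsilon>\<close> and makes the boundary
  term \<open>E \<phi>(X\<^sub>T) / T\<close> vanish. The bound on \<open>\<delta>\<rho>\<close> is read off its equation at \<open>x = 0\<close>. The limit diffusion
  enters only through the Bellman equation of \<open>w\<close>.
\<close>

section \<open>Taylor expansion of the jump generator\<close>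

text \<open>The Hessians are Hoelder continuous on unit balls only, with a constant that grows like
  \<open>1 + norm x\<close>, and \<open>b1\<close> grows at the same rate; the cube in the error is
  one Hessian times two factors \<open>b1\<close>, and \<open>p_\<xi> \<ge> 3\<close> pays for it. A
  jump that may leave the unit ball starts where \<open>sqrt \<epsilon> * (1 + norm x)\<close> is
  bounded below, and that lower bound is traded for the missing power of \<epsilon>. The Lyapunov
  inequality is integrated without an exponential weight: it bounds the time average of \<xi>
  uniformly in the horizon, but the expectation at time T only by a multiple of T. This is enough,
  since \<open>y \<le> sqrt T + y powr q / T\<close> gives a first moment of order
  \<open>sqrt T\<close>, and \<phi> grows linearly. The jump equation is solved path by path, by
  recursion over the jumps. The times \<open>T n\<close> and marks \<open>E n\<close> are only known
  to be measurable for \<open>M\<close>, so the recursion does not show that the solution is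
  adapted; Picard iteration does, because each iterate is an integral along \<open>N\<close> of a
  predictable function.\<close>

lemma norm_matrix_vector_mult_le:
  fixes A :: "real ^ 'n ^ 'm"
  shows "norm (A *v x) \<le> norm A * norm x"
proof -
  \<comment> \<open>The norm of a matrix is the Euclidean norm of the norms of its rows, so
    Cauchy-Schwarz row by row suffices.\<close>
  have "norm (A *v x) \<le> L2_set (\<lambda>i. norm (A $ i) * norm x) UNIV"
    unfolding norm_vec_def[of "A *v x"]
    by (rule L2_set_mono)
      (simp_all add: matrix_vector_mul_component Cauchy_Schwarz_ineq2)
  also have "\<dots> = norm A * norm x"
    unfolding norm_vec_def[of A] by (simp add: L2_set_left_distrib)
  finally show ?thesis .
qed

lemma abs_quadratic_form_le:
  fixes H :: "real ^ 'd ^ 'd"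
  shows "\<bar>v \<bullet> (H *v u)\<bar> \<le> norm H * norm v * norm u"
proof -
  have "\<bar>v \<bullet> (H *v u)\<bar> \<le> norm v * norm (H *v u)"
    by (rule Cauchy_Schwarz_ineq2)
  also have "\<dots> \<le> norm v * (norm H * norm u)"
    by (intro mult_left_mono norm_matrix_vector_mult_le) simp
  finally show ?thesis by (simp add: mult_ac)
qed

text \<open>Lets the second-order term of the limit generator be read as the \<nu>-average of the
  quadratic Taylor terms.\<close>

lemma trace_outer_mult:
  fixes H :: "real ^ 'd ^ 'd"
  shows "trace (outer v v ** H) = v \<bullet> (H *v v)"
proof -
  have "trace (outer v v ** H) = (\<Sum>i\<in>UNIV. \<Sum>k\<in>UNIV. v $ i * v $ k * H $ k $ i)"
    by (simp add: trace_def outer_def matrix_matrix_mult_def)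
  also have "\<dots> = (\<Sum>k\<in>UNIV. \<Sum>i\<in>UNIV. v $ i * v $ k * H $ k $ i)"
    by (rule sum.swap)
  also have "\<dots> = v \<bullet> (H *v v)"
    by (simp add: inner_vec_def matrix_vector_mult_def sum_distrib_left mult_ac)
  finally show ?thesis .
qed

text \<open>Linearity in the covariance moves the trace under the \<nu>-integral in
  \<open>residual_bound\<close>.\<close>

lemma bounded_linear_trace_mult:
  fixes H :: "real ^ 'd ^ 'd"
  shows "bounded_linear (\<lambda>A. trace (A ** H))"
proof -
  have "linear (\<lambda>A::real ^ 'd ^ 'd. trace (A ** H))"
    by (rule linearI)
      (simp_all add: trace_def matrix_matrix_mult_def sum.distrib algebra_simps sum_distrib_left)
  then show ?thesis by (simp add: linear_conv_bounded_linear)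
qed

text \<open>Linearity in the Hessian gives the constant \<open>Kt\<close> in the bound of the
  generator at the origin.\<close>

lemma bounded_linear_mult_trace:
  fixes S :: "real ^ 'd ^ 'd"
  shows "bounded_linear (\<lambda>H. trace (S ** H))"
proof -
  have "linear (\<lambda>H::real ^ 'd ^ 'd. trace (S ** H))"
    by (rule linearI)
      (simp_all add: trace_def matrix_matrix_mult_def sum.distrib algebra_simps sum_distrib_left)
  then show ?thesis by (simp add: linear_conv_bounded_linear)
qed

text \<open>A crude constant is enough: the bound serves the integrability of the covariance
  integrand.\<close>

lemma norm_outer_le:
  fixes v u :: "real ^ 'd"
  shows "norm (outer v u) \<le> real CARD('d) * (real CARD('d) * (norm v * norm u))"
proof -
  have "norm (outer v u) \<le> (\<Sum>i\<in>UNIV. norm (outer v u $ i))"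
    unfolding norm_vec_def[of "outer v u"] by (rule L2_set_le_sum) simp
  also have "\<dots> \<le> (\<Sum>i\<in>UNIV. \<Sum>j\<in>UNIV. \<bar>outer v u $ i $ j\<bar>)"
    by (intro sum_mono norm_le_l1_cart)
  also have "\<dots> \<le> (\<Sum>i\<in>(UNIV::'d set). \<Sum>j\<in>(UNIV::'d set). norm v * norm u)"
  proof (intro sum_mono)
    fix i j
    show "\<bar>outer v u $ i $ j\<bar> \<le> norm v * norm u"
      by (simp add: outer_def abs_mult mult_mono component_le_norm_cart)
  qed
  finally show ?thesis by simp
qed

section \<open>Derivatives, the local Hoelder norm and Taylor's formula\<close>

lemma has_derivative_grad:
  assumes "u differentiable (at x)"
  shows "(u has_derivative (\<lambda>h. grad u x \<bullet> h)) (at x)"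
proof -
  let ?D = "frechet_derivative u (at x)"
  have D: "(u has_derivative ?D) (at x)"
    using assms by (simp add: frechet_derivative_works)
  have lin: "linear ?D" using D by (rule has_derivative_linear)
  have "?D h = grad u x \<bullet> h" for h
  proof -
    have "?D h = ?D (\<Sum>i\<in>UNIV. h $ i *\<^sub>R axis i 1)"
      by (metis (no_types, lifting) basis_expansion scalar_mult_eq_scaleR sum.cong)
    also have "\<dots> = (\<Sum>i\<in>UNIV. h $ i * ?D (axis i 1))"
      using lin by (simp add: linear_sum linear_cmul)
    also have "\<dots> = grad u x \<bullet> h"
      by (simp add: inner_vec_def grad_def mult_ac)
    finally show ?thesis .
  qed
  then have "?D = (\<lambda>h. grad u x \<bullet> h)" by blast
  with D show ?thesis by simp
qed

lemma has_derivative_hess: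
  assumes "grad u differentiable (at x)"
  shows "(grad u has_derivative (\<lambda>h. hess u x *v h)) (at x)"
proof -
  let ?D = "frechet_derivative (grad u) (at x)"
  have D: "(grad u has_derivative ?D) (at x)"
    using assms by (simp add: frechet_derivative_works)
  have "linear ?D" using D by (rule has_derivative_linear)
  then have "?D = (\<lambda>h. hess u x *v h)"
    by (auto simp: hess_def matrix_works)
  with D show ?thesis by simp
qed

lemma ereal_add_nonneg_leD:
  fixes a b :: ereal
  assumes "0 \<le> a" "0 \<le> b" "a + b \<le> c"
  shows "a \<le> c" "b \<le> c"
  using assms by (metis add_increasing add_increasing2 order_refl order_trans)+

lemma ereal_sum4_le:
  fixes a b c d :: ereal
  assumes "0 \<le> a" "0 \<le> b" "0 \<le> c" "0 \<le> d" "a + b + c + d \<le> e"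
  shows "a \<le> e \<and> b \<le> e \<and> c \<le> e \<and> d \<le> e"
proof -
  have "a \<le> a + b + c + d" "b \<le> a + b + c + d" "c \<le> a + b + c + d" "d \<le> a + b + c + d"
    using assms(1-4) by (auto intro: add_increasing add_increasing2)
  with assms(5) show ?thesis by (meson order_trans)
qed

text \<open>A finite bound excludes the infinite branch of the norm, which gives differentiability.
  The four suprema are nonnegative, so each is below the bound of their sum, and it is evaluated at
  the centre of the ball.\<close>

lemma C2_hoelder_norm_leD:
  fixes u :: "real ^ 'd \<Rightarrow> real"
  assumes le: "C2_hoelder_norm \<gamma> (ball x 1) u \<le> ereal B"
  shows "u differentiable (at x)" "grad u differentiable (at x)"
    "\<bar>u x\<bar> \<le> B" "norm (grad u x) \<le> B" "norm (hess u x) \<le> B"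
    "y \<in> ball x 1 \<Longrightarrow> norm (hess u y - hess u x) \<le> B * norm (y - x) powr \<gamma>"
proof -
  let ?U = "ball x 1"
  have C2: "C2_on ?U u"
    using le by (auto simp: C2_hoelder_norm_def split: if_splits)
  have x: "x \<in> ?U" by simp
  from C2 x show "u differentiable (at x)" "grad u differentiable (at x)"
    by (auto simp: C2_on_def)
  let ?a = "SUP x\<in>?U. ereal \<bar>u x\<bar>" and ?b = "SUP x\<in>?U. ereal (norm (grad u x))"
    and ?c = "SUP x\<in>?U. ereal (norm (hess u x))"
    and ?d = "SUP (x, y)\<in>{(x, y). x \<in> ?U \<and> y \<in> ?U \<and> x \<noteq> y}.
           ereal (norm (hess u x - hess u y) / norm (x - y) powr \<gamma>)"
  have nn: "0 \<le> ?a" "0 \<le> ?b" "0 \<le> ?c"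
    by (rule SUP_upper2[OF x]; simp)+
  \<comment> \<open>A second point of the ball: without a pair of distinct points the last supremum
    would be over the empty set, hence minus infinity, and could not be dropped from the
    sum.\<close>
  have "x + (1/2) *\<^sub>R axis undefined 1 \<in> ?U" "x + (1/2) *\<^sub>R axis undefined 1 \<noteq> x"
    by (auto simp: dist_norm axis_eq_0_iff)
  then have nd: "0 \<le> ?d"
    by (intro SUP_upper2[of "(x + (1/2) *\<^sub>R axis undefined 1, x)"]) (use x in auto)
  have *: "?a \<le> ereal B \<and> ?b \<le> ereal B \<and> ?c \<le> ereal B \<and> ?d \<le> ereal B"
    using le C2 nn nd by (intro ereal_sum4_le) (auto simp: C2_hoelder_norm_def)
  show "\<bar>u x\<bar> \<le> B" "norm (grad u x) \<le> B" "norm (hess u x) \<le> B"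
    using * x by (auto simp: SUP_le_iff)
  show "norm (hess u y - hess u x) \<le> B * norm (y - x) powr \<gamma>" if y: "y \<in> ?U"
  proof (cases "y = x")
    case False
    have "ereal (norm (hess u y - hess u x) / norm (y - x) powr \<gamma>) \<le> ?d"
      using False y x by (intro SUP_upper2[of "(y, x)"]) auto
    with * have "norm (hess u y - hess u x) / norm (y - x) powr \<gamma> \<le> B"
      by (meson ereal_less_eq(3) order_trans)
    with False show ?thesis by (simp add: pos_divide_le_eq)
  qed (use \<open>\<bar>u x\<bar> \<le> B\<close> in auto)
qed

text \<open>Mean value theorem along the segment; the first-order substitute for Taylor's formula
  when a jump is too long for the local Hoelder bound.\<close>

lemma abs_diff_le_grad:
  fixes u :: "real ^ 'd \<Rightarrow> real"
  assumes diff: "\<And>y. u differentiable (at y)"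
    and bd: "\<And>t. 0 \<le> t \<Longrightarrow> t \<le> 1 \<Longrightarrow> norm (grad u (x + t *\<^sub>R h)) \<le> B"
  shows "\<bar>u (x + h) - u x\<bar> \<le> B * norm h"
proof -
  have der: "DERIV (\<lambda>t. u (x + t *\<^sub>R h)) t :> grad u (x + t *\<^sub>R h) \<bullet> h" for t
    unfolding has_field_derivative_def
    by (rule has_derivative_eq_rhs, rule has_derivative_compose[OF _ has_derivative_grad[OF diff]])
      (auto intro!: derivative_eq_intros)
  obtain t where t: "0 < t" "t < 1" "u (x + 1 *\<^sub>R h) - u (x + 0 *\<^sub>R h) = (1 - 0) * (grad u (x + t *\<^sub>R h) \<bullet> h)"
    using MVT2[of 0 1 "\<lambda>t. u (x + t *\<^sub>R h)" "\<lambda>t. grad u (x + t *\<^sub>R h) \<bullet> h"] der by auto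
  then have "\<bar>u (x + h) - u x\<bar> \<le> norm (grad u (x + t *\<^sub>R h)) * norm h"
    by (simp add: Cauchy_Schwarz_ineq2)
  also have "\<dots> \<le> B * norm h" using t bd by (intro mult_right_mono) auto
  finally show ?thesis .
qed

text \<open>The Lagrange form of the expansion has the Hessian at an intermediate point in place of
  the one at \<open>x\<close>; the Hoelder bound controls the difference.\<close>

lemma taylor_second_order_hoelder:
  fixes u :: "real ^ 'd \<Rightarrow> real"
  assumes diff: "\<And>y. u differentiable (at y)" "\<And>y. grad u differentiable (at y)"
    and bd: "\<And>y. norm (y - x) < 1 \<Longrightarrow> norm (hess u y - hess u x) \<le> B * norm (y - x) powr \<gamma>"
    and h: "norm h < 1" and \<gamma>: "0 \<le> \<gamma>" and B: "0 \<le> B"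
  shows "\<bar>u (x + h) - u x - grad u x \<bullet> h - 1 / 2 * (h \<bullet> (hess u x *v h))\<bar>
    \<le> B / 2 * norm h powr \<gamma> * (norm h)\<^sup>2"
proof -
  \<comment> \<open>The successive derivatives along the segment, in the shape that
    \<open>Maclaurin\<close> expects; the last branch is evaluated at m = 2 only.\<close>
  define D where "D m t = (if m = (0::nat) then u (x + t *\<^sub>R h)
    else if m = 1 then grad u (x + t *\<^sub>R h) \<bullet> h else (hess u (x + t *\<^sub>R h) *v h) \<bullet> h)" for m t
  have der0: "DERIV (\<lambda>t. u (x + t *\<^sub>R h)) t :> grad u (x + t *\<^sub>R h) \<bullet> h" for t
    unfolding has_field_derivative_def
    by (rule has_derivative_eq_rhs, rule has_derivative_compose[OF _ has_derivative_grad[OF diff(1)]])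
      (auto intro!: derivative_eq_intros)
  have der1': "((\<lambda>t. grad u (x + t *\<^sub>R h)) has_derivative (\<lambda>s. hess u (x + t *\<^sub>R h) *v (s *\<^sub>R h))) (at t)" for t
    by (rule has_derivative_compose[OF _ has_derivative_hess[OF diff(2)]])
      (auto intro!: derivative_eq_intros)
  have der1: "DERIV (\<lambda>t. grad u (x + t *\<^sub>R h) \<bullet> h) t :> (hess u (x + t *\<^sub>R h) *v h) \<bullet> h" for t
    unfolding has_field_derivative_def
    by (rule has_derivative_eq_rhs, rule has_derivative_inner_left[OF der1'])
      (auto simp: matrix_vector_mult_scaleR mult_ac)
  have "\<forall>m t. m < 2 \<and> 0 \<le> t \<and> t \<le> 1 \<longrightarrow> DERIV (D m) t :> D (Suc m) t"
    using der0 der1 by (auto simp: D_def[abs_def] less_2_cases_iff)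
  from Maclaurin[OF _ _ refl this]
  obtain t where t: "0 < t" "t < 1"
    and eq: "D 0 1 = (\<Sum>m<2. D m 0 / fact m * 1 ^ m) + D 2 t / fact 2 * 1 ^ 2"
    by auto
  have "u (x + h) = u x + grad u x \<bullet> h + 1 / 2 * (h \<bullet> (hess u (x + t *\<^sub>R h) *v h))"
    using eq by (simp add: D_def numeral_2_eq_2 inner_commute)
  then have "\<bar>u (x + h) - u x - grad u x \<bullet> h - 1 / 2 * (h \<bullet> (hess u x *v h))\<bar>
    = 1 / 2 * \<bar>h \<bullet> ((hess u (x + t *\<^sub>R h) - hess u x) *v h)\<bar>"
    unfolding matrix_vector_mult_diff_rdistrib inner_diff_right by (simp add: field_simps abs_if)
  also have "\<dots> \<le> 1 / 2 * (norm (hess u (x + t *\<^sub>R h) - hess u x) * norm h * norm h)"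
    by (intro mult_left_mono abs_quadratic_form_le) simp
  also have "\<dots> \<le> 1 / 2 * ((B * norm h powr \<gamma>) * norm h * norm h)"
  proof -
    have "norm (hess u (x + t *\<^sub>R h) - hess u x) \<le> B * norm (t *\<^sub>R h) powr \<gamma>"
    proof -
      have "norm (t *\<^sub>R h) \<le> 1 * norm h" using t unfolding norm_scaleR by (intro mult_right_mono) auto
      with h show ?thesis using bd[of "x + t *\<^sub>R h"] by simp
    qed
    also have "\<dots> \<le> B * norm h powr \<gamma>"
      using t \<gamma> B by (intro mult_left_mono powr_mono2) (auto intro: mult_left_le_one_le)
    finally show ?thesis by (intro mult_left_mono mult_right_mono) auto
  qed
  finally show ?thesis by (simp add: power2_eq_square mult_ac)
qed

text \<open>Two regimes. If \<open>2 * K * sqrt \<epsilon> * (1 + norm x) < 1\<close>, the jump is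
  shorter than 1 and of order \<open>sqrt \<epsilon>\<close>, so Taylor's formula applies. Otherwise
  the increment, the gradient term and the quadratic term are bounded separately. Only
  \<open>v2\<close> enters the quadratic term that is subtracted; products with \<open>v1\<close>
  are of higher order in \<epsilon> and go to the error. The constant 26 is twice 13 = 9 + 3 + 1
  from the second regime; the first gives 7.\<close>

lemma taylor_remainder_scaled:
  fixes u :: "real ^ 'd \<Rightarrow> real" and v1 v2 :: "real ^ 'd"
  assumes reg: "\<And>y. C2_hoelder_norm \<beta> (ball y 1) u \<le> ereal (L * (1 + norm y))"
    and \<beta>: "0 < \<beta>" "\<beta> < 1" and \<epsilon>: "0 < \<epsilon>" "\<epsilon> < 1" and K: "1 \<le> K"
    and v: "norm v1 \<le> K * (1 + norm x)" "norm v2 \<le> K"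
  defines "B \<equiv> \<epsilon> *\<^sub>R v1 + sqrt \<epsilon> *\<^sub>R v2"
  shows "\<bar>u (x + B) - u x - grad u x \<bullet> B - \<epsilon> / 2 * (v2 \<bullet> (hess u x *v v2))\<bar>
    \<le> \<epsilon> * (26 * L * K ^ 4 * \<epsilon> powr (\<beta> / 2) * (1 + norm x) ^ 3)"
proof -
  define X s where "X = 1 + norm x" and "s = sqrt \<epsilon>"
  note D = C2_hoelder_norm_leD[OF reg]
  have X: "1 \<le> X" by (simp add: X_def)
  have s: "0 < s" "s < 1" "s * s = \<epsilon>" using \<epsilon> by (auto simp: s_def)
  have L: "0 \<le> L" using D(3)[of 0] by auto
  have H: "norm (hess u x) \<le> L * X" and G: "norm (grad u x) \<le> L * X"
    using D by (auto simp: X_def)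
  have s\<beta>: "s powr \<beta> = \<epsilon> powr (\<beta> / 2)"
    using s \<epsilon> by (simp add: s_def powr_half_sqrt[symmetric] powr_powr)
  have "s powr 1 \<le> s powr \<beta>" using s \<beta> by (intro powr_mono') auto
  then have s1: "s \<le> \<epsilon> powr (\<beta> / 2)" using s s\<beta> by simp
  have B: "norm B \<le> \<epsilon> * (K * X) + s * K"
  proof -
    have "norm B \<le> \<epsilon> * norm v1 + s * norm v2"
      unfolding B_def s_def by (rule norm_triangle_le) (use \<epsilon> in auto)
    also have "\<dots> \<le> \<epsilon> * (K * X) + s * K"
      using v \<epsilon> s by (intro add_mono mult_left_mono) (auto simp: X_def)
    finally show ?thesis .
  qed
  have "\<epsilon> \<le> s" using s by (metis mult_left_le_one_le less_imp_le)
  let ?q = "\<epsilon> / 2 * (v2 \<bullet> (hess u x *v v2))"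
  show ?thesis
  proof (cases "2 * K * s * X < 1")
    case True
    have "\<epsilon> * (K * X) \<le> s * (K * X)" "s * K \<le> s * (K * X)"
      using \<open>\<epsilon> \<le> s\<close> K X s by (auto intro!: mult_mono)
    with B True have B1: "norm B < 1" by (simp add: algebra_simps)
    \<comment> \<open>In this regime the part of the jump due to \<open>v1\<close> is no longer than
      the bound for \<open>v2\<close>, so the length of the jump carries no factor
      \<open>X\<close>.\<close>
    have "\<epsilon> * (K * X) \<le> s * K"
    proof -
      have "\<epsilon> * (K * X) = s * (s * K * X)" using s by (simp add: mult_ac flip: s(3))
      also have "\<dots> \<le> s * 1" using True s by (intro mult_left_mono) (auto simp: algebra_simps)
      also have "\<dots> \<le> s * K" using s K by (intro mult_left_mono) auto
      finally show ?thesis .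
    qed
    then have "norm B \<le> s * K + s * K" using B by linarith
    also have "\<dots> = 2 * K * s" by simp
    finally have B2: "norm B \<le> 2 * K * s" .
    have "\<bar>u (x + B) - u x - grad u x \<bullet> B - 1 / 2 * (B \<bullet> (hess u x *v B))\<bar>
      \<le> (L * X) / 2 * norm B powr \<beta> * (norm B)\<^sup>2"
      using D(6)[of _ x] B1 \<beta> L X
      by (intro taylor_second_order_hoelder D) (auto simp: X_def dist_norm norm_minus_commute)
    also have "\<dots> \<le> (L * X) / 2 * (2 * K * s) powr \<beta> * (2 * K * s)\<^sup>2"
      using B2 L X \<beta> K s by (intro mult_mono powr_mono2 power_mono) auto
    also have "(2 * K * s) powr \<beta> = (2 * K) powr \<beta> * s powr \<beta>"
      using K s by (simp add: powr_mult)
    \<comment> \<open>Since \<open>2 * K \<ge> 1\<close> and \<open>\<beta> \<le> 1\<close>, raising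
      the exponent to 1 keeps the constant polynomial in \<open>K\<close>.\<close>
    also have "(L * X) / 2 * ((2 * K) powr \<beta> * s powr \<beta>) * (2 * K * s)\<^sup>2
       \<le> (L * X) / 2 * ((2 * K) powr 1 * s powr \<beta>) * (2 * K * s)\<^sup>2"
      using L X K s \<beta> by (intro mult_right_mono mult_left_mono powr_mono) auto
    also have "\<dots> = 4 * L * K ^ 3 * X * (\<epsilon> * \<epsilon> powr (\<beta> / 2))"
      using K unfolding s\<beta> s(3)[symmetric] by (simp add: power2_eq_square power3_eq_cube)
    finally have 1: "\<bar>u (x + B) - u x - grad u x \<bullet> B - 1 / 2 * (B \<bullet> (hess u x *v B))\<bar>
      \<le> 4 * L * K ^ 3 * X * (\<epsilon> * \<epsilon> powr (\<beta> / 2))" .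
    \<comment> \<open>The quadratic term is taken at \<open>B\<close>, the limit needs it at
      \<open>v2\<close>. The difference has a factor \<open>\<epsilon> * s\<close>, and
      \<open>s \<le> \<epsilon> powr (\<beta> / 2)\<close>; its first summand is the source of
      \<open>X ^ 3\<close>.\<close>
    have "B \<bullet> (hess u x *v B) - \<epsilon> * (v2 \<bullet> (hess u x *v v2))
      = \<epsilon> * \<epsilon> * (v1 \<bullet> (hess u x *v v1)) + \<epsilon> * s * (v1 \<bullet> (hess u x *v v2)) + \<epsilon> * s * (v2 \<bullet> (hess u x *v v1))"
      unfolding B_def s_def[symmetric] s(3)[symmetric] using s(1)
      by (simp add: inner_add matrix_vector_right_distrib matrix_vector_mult_scaleR algebra_simps)
    also have "\<bar>\<dots>\<bar> \<le> \<epsilon> * \<epsilon> * (L * X * (K * X) * (K * X)) + \<epsilon> * s * (L * X * (K * X) * K) + \<epsilon> * s * (L * X * K * (K * X))"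
    proof -
      have q: "\<bar>a \<bullet> (hess u x *v b)\<bar> \<le> L * X * c * d" if "norm a \<le> c" "norm b \<le> d" for a b c d
      proof -
        have "0 \<le> c" "0 \<le> d" using that norm_ge_zero order_trans by blast+
        then have "norm (hess u x) * norm a * norm b \<le> L * X * c * d"
          using that H L X by (intro mult_mono) auto
        with abs_quadratic_form_le show ?thesis by (rule order_trans)
      qed
      have sc: "\<bar>c * z\<bar> \<le> c * d" if "0 \<le> c" "\<bar>z\<bar> \<le> d" for c d z :: real
        using that by (simp add: abs_mult mult_left_mono)
      show ?thesis
        by (intro order_trans[OF abs_triangle_ineq] add_mono sc q v[folded X_def]) (use \<epsilon> s in auto)
    qed
    also have "\<dots> \<le> \<epsilon> * s * (L * X * (K * X) * (K * X)) + \<epsilon> * s * (L * X * (K * X) * (K * X)) + \<epsilon> * s * (L * X * (K * X) * (K * X))"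
      using \<epsilon> s \<open>\<epsilon> \<le> s\<close> L X K by (intro add_mono mult_mono order_refl) auto
    also have "\<dots> = 3 * L * K\<^sup>2 * X ^ 3 * (\<epsilon> * s)"
      by (simp add: power2_eq_square power3_eq_cube)
    also have "\<dots> \<le> 3 * L * K\<^sup>2 * X ^ 3 * (\<epsilon> * \<epsilon> powr (\<beta> / 2))"
      using \<epsilon> s1 L X K by (intro mult_left_mono) auto
    finally have 2: "\<bar>B \<bullet> (hess u x *v B) - \<epsilon> * (v2 \<bullet> (hess u x *v v2))\<bar>
      \<le> 3 * L * K\<^sup>2 * X ^ 3 * (\<epsilon> * \<epsilon> powr (\<beta> / 2))" .
    have KX: "K ^ 3 * X \<le> K ^ 4 * X ^ 3" "K\<^sup>2 * X ^ 3 \<le> K ^ 4 * X ^ 3"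
      using K X power_increasing[of 3 4 K] power_increasing[of 1 3 X] power_increasing[of 2 4 K]
      by (auto intro!: mult_mono)
    have "\<bar>u (x + B) - u x - grad u x \<bullet> B - ?q\<bar>
      \<le> 4 * L * K ^ 3 * X * (\<epsilon> * \<epsilon> powr (\<beta> / 2)) + 3 * L * K\<^sup>2 * X ^ 3 * (\<epsilon> * \<epsilon> powr (\<beta> / 2))"
      using 1 2 by argo
    also have "\<dots> = (4 * (K ^ 3 * X) + 3 * (K\<^sup>2 * X ^ 3)) * (L * \<epsilon> * \<epsilon> powr (\<beta> / 2))"
      by (simp add: algebra_simps)
    also have "\<dots> \<le> (26 * (K ^ 4 * X ^ 3)) * (L * \<epsilon> * \<epsilon> powr (\<beta> / 2))"
    proof (rule mult_right_mono)
      have "0 \<le> K ^ 4 * X ^ 3" using K X by simp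
      with KX show "4 * (K ^ 3 * X) + 3 * (K\<^sup>2 * X ^ 3) \<le> 26 * (K ^ 4 * X ^ 3)" by linarith
    qed (use L \<epsilon> in auto)
    finally show ?thesis by (simp add: X_def mult_ac)
  next
    case False
    then have ge: "1 \<le> 2 * K * s * X" by simp
    \<comment> \<open>Multiplying by a quantity that is at least 1 upgrades \<open>s\<close> to
      \<open>s * s = \<epsilon>\<close> at the price of a factor \<open>X\<close>.\<close>
    have "s * K * 1 \<le> s * K * (2 * K * s * X)"
      using ge s K by (intro mult_left_mono) auto
    then have sK: "s * K \<le> 2 * K\<^sup>2 * \<epsilon> * X"
      unfolding s(3)[symmetric] by (simp add: power2_eq_square mult_ac)
    have "\<epsilon> * (K * X) \<le> K\<^sup>2 * \<epsilon> * X"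
      using \<epsilon> K X by (simp add: power2_eq_square mult_left_mono)
    with B sK have B1: "norm B \<le> 3 * K\<^sup>2 * \<epsilon> * X" by linarith
    have "\<epsilon> * (K * X) \<le> 1 * (K * X)" "s * K \<le> 1 * (K * X)"
      using \<epsilon> s K X by (intro mult_mono; auto)+
    with B have B2: "norm B \<le> 2 * K * X" by simp
    have "\<bar>u (x + B) - u x\<bar> \<le> (3 * L * K * X) * norm B"
    proof (rule abs_diff_le_grad[OF D(1)])
      fix t :: real assume t: "0 \<le> t" "t \<le> 1"
      have "norm (grad u (x + t *\<^sub>R B)) \<le> L * (1 + norm (x + t *\<^sub>R B))" by (rule D)
      also have "\<dots> \<le> L * (3 * K * X)"
      proof (rule mult_left_mono[OF _ L])
        have "norm (x + t *\<^sub>R B) \<le> norm x + norm B"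
        proof (rule norm_triangle_le)
          show "norm x + norm (t *\<^sub>R B) \<le> norm x + norm B"
            using t by (auto intro: mult_left_le_one_le)
        qed
        moreover have "1 + (norm x + norm B) \<le> 3 * K * X"
        proof -
          have "1 * X \<le> K * X" using K X by (intro mult_right_mono) auto
          moreover have "norm B \<le> 2 * (K * X)" using B2 by (simp add: mult_ac)
          moreover have "1 + norm x = X" by (simp add: X_def)
          ultimately have "1 + (norm x + norm B) \<le> 3 * (K * X)" by linarith
          then show ?thesis by (simp add: mult_ac)
        qed
        ultimately show "1 + norm (x + t *\<^sub>R B) \<le> 3 * K * X" by linarith
      qed
      finally show "norm (grad u (x + t *\<^sub>R B)) \<le> 3 * L * K * X"
        by (simp add: mult_ac)
    qed
    also have "\<dots> \<le> (3 * L * K * X) * (3 * K\<^sup>2 * \<epsilon> * X)"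
      using B1 L K X by (intro mult_left_mono) auto
    finally have 1: "\<bar>u (x + B) - u x\<bar> \<le> 9 * (L * \<epsilon> * (K ^ 3 * X\<^sup>2))"
      by (simp add: power2_eq_square power3_eq_cube mult_ac)
    have "\<bar>grad u x \<bullet> B\<bar> \<le> norm (grad u x) * norm B" by (rule Cauchy_Schwarz_ineq2)
    also have "\<dots> \<le> (L * X) * (3 * K\<^sup>2 * \<epsilon> * X)"
      using G B1 L X by (intro mult_mono) auto
    also have "\<dots> = 3 * (L * \<epsilon> * (K\<^sup>2 * X\<^sup>2))"
      by (simp add: power2_eq_square)
    finally have 2: "\<bar>grad u x \<bullet> B\<bar> \<le> 3 * (L * \<epsilon> * (K\<^sup>2 * X\<^sup>2))" .
    have "\<bar>?q\<bar> \<le> \<epsilon> / 2 * (norm (hess u x) * norm v2 * norm v2)"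
      using \<epsilon> abs_quadratic_form_le[of v2 "hess u x" v2] by (simp add: abs_mult mult_left_mono)
    also have "\<dots> \<le> \<epsilon> / 2 * ((L * X) * K * K)"
      using \<epsilon> H v K L X by (intro mult_left_mono mult_mono) auto
    also have "\<dots> \<le> L * \<epsilon> * (K\<^sup>2 * X)"
      using \<epsilon> L K X by (simp add: power2_eq_square mult_ac)
    finally have 3: "\<bar>?q\<bar> \<le> L * \<epsilon> * (K\<^sup>2 * X)" .
    have KX: "K\<^sup>2 * X\<^sup>2 \<le> K ^ 3 * X\<^sup>2" "K\<^sup>2 * X \<le> K ^ 3 * X\<^sup>2"
      using K X power_increasing[of 2 3 K] power_increasing[of 1 2 X]
      by (auto intro!: mult_mono)
    then have "L * \<epsilon> * (K\<^sup>2 * X\<^sup>2) \<le> L * \<epsilon> * (K ^ 3 * X\<^sup>2)" "L * \<epsilon> * (K\<^sup>2 * X) \<le> L * \<epsilon> * (K ^ 3 * X\<^sup>2)"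
      using L \<epsilon> by (auto intro!: mult_left_mono)
    with 1 2 3 have "\<bar>u (x + B) - u x - grad u x \<bullet> B - ?q\<bar> \<le> 13 * (L * \<epsilon> * (K ^ 3 * X\<^sup>2))"
      by argo
    also have "\<dots> \<le> 13 * (L * \<epsilon> * (K ^ 3 * X\<^sup>2)) * (2 * K * X * \<epsilon> powr (\<beta> / 2))"
    proof -
      \<comment> \<open>The same quantity to the power \<beta> supplies the missing
        \<open>s powr \<beta>\<close>; on the remaining base the exponent is raised to 1, which
        brings in the third \<open>X\<close>.\<close>
      have "1 \<le> (2 * K * s * X) powr \<beta>"
        using ge \<beta> by (intro ge_one_powr_ge_zero) auto
      also have "\<dots> = (2 * K * X) powr \<beta> * s powr \<beta>"
        using K s X by (simp add: powr_mult mult_ac)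
      also have "\<dots> \<le> (2 * K * X) powr 1 * s powr \<beta>"
      proof (intro mult_right_mono powr_mono)
        have "1 * 1 \<le> K * X" using K X by (intro mult_mono) auto
        then show "1 \<le> 2 * K * X" by simp
      qed (use \<beta> in auto)
      also have "\<dots> = 2 * K * X * \<epsilon> powr (\<beta> / 2)"
        using K X by (simp add: s\<beta>)
      finally show ?thesis
        using mult_left_mono[of 1 "2 * K * X * \<epsilon> powr (\<beta> / 2)" "13 * (L * \<epsilon> * (K ^ 3 * X\<^sup>2))"] L \<epsilon> K X
        by simp
    qed
    also have "\<dots> = \<epsilon> * (26 * L * K ^ 4 * \<epsilon> powr (\<beta> / 2) * X ^ 3)"
      by (simp add: power2_eq_square power3_eq_cube power4_eq_xxxx)
    finally show ?thesis by (simp add: X_def)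
  qed
qed

text \<open>Centering of \<open>b2\<close> removes the term of order \<open>sqrt \<epsilon>\<close>,
  the mean of \<open>b1\<close> produces the drift, and the covariance identity produces the
  second-order term. Hence \<epsilon> times the residual is the \<nu>-average of the pointwise
  Taylor remainder \<open>?Z\<close>.\<close>

lemma residual_bound:
  fixes u :: "real ^ 'd \<Rightarrow> real"
  assumes reg: "\<And>y. C2_hoelder_norm \<beta> (ball y 1) u \<le> ereal (L * (1 + norm y))"
    and \<beta>: "0 < \<beta>" "\<beta> < 1" and \<epsilon>: "0 < \<epsilon>" "\<epsilon> < 1" and K: "1 \<le> K"
    and \<nu>: "prob_space \<nu>"
    and meas[measurable]: "b1 x a \<in> borel_measurable \<nu>" "b2 x \<in> borel_measurable \<nu>"
    and bd: "\<And>e. norm (b1 x a e) \<le> K * (1 + norm x)" "\<And>e. norm (b2 x e) \<le> K"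
    and mean: "(\<integral>e. b2 x e \<partial>\<nu>) = 0" "\<mu> x a = (\<integral>e. b1 x a e \<partial>\<nu>)"
    and cov: "\<sigma> x ** transpose (\<sigma> x) = (\<integral>e. outer (b2 x e) (b2 x e) \<partial>\<nu>)"
  shows "\<bar>residual \<nu> (scaled_coeff b1 b2 \<epsilon>) \<mu> \<sigma> u \<epsilon> x a\<bar>
    \<le> 26 * L * K ^ 4 * \<epsilon> powr (\<beta> / 2) * (1 + norm x) ^ 3" (is "_ \<le> ?C")
proof -
  interpret prob_space \<nu> by fact
  note D = C2_hoelder_norm_leD[OF reg]
  let ?b = "scaled_coeff b1 b2 \<epsilon> x a" and ?H = "hess u x"
  have b: "?b e = \<epsilon> *\<^sub>R b1 x a e + sqrt \<epsilon> *\<^sub>R b2 x e" for e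
    by (simp add: scaled_coeff_def)
  have "continuous_on UNIV u"
    using D(1) by (meson differentiable_imp_continuous_within continuous_at_imp_continuous_on)
  then have [measurable]: "u \<in> borel_measurable borel" by (rule borel_measurable_continuous_onI)
  have [measurable]: "?b \<in> borel_measurable \<nu>" unfolding b by measurable
  have i1: "integrable \<nu> (b1 x a)" and i2: "integrable \<nu> (b2 x)"
    using bd by (auto intro!: integrable_const_bound)
  have i3: "integrable \<nu> (\<lambda>e. outer (b2 x e) (b2 x e))"
  proof (rule integrable_const_bound)
    have "continuous_on UNIV (\<lambda>v::real ^ 'd. outer v v)"
      unfolding outer_def by (intro continuous_intros)
    then have [measurable]: "(\<lambda>v::real ^ 'd. outer v v) \<in> borel_measurable borel"
      by (rule borel_measurable_continuous_onI)
    show "(\<lambda>e. outer (b2 x e) (b2 x e)) \<in> borel_measurable \<nu>" by measurable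
    show "AE e in \<nu>. norm (outer (b2 x e) (b2 x e)) \<le> real CARD('d) * (real CARD('d) * (K * K))"
    proof (rule AE_I2, rule order_trans[OF norm_outer_le])
      fix e
      have "norm (b2 x e) * norm (b2 x e) \<le> K * K" using bd K by (intro mult_mono) auto
      then show "real CARD('d) * (real CARD('d) * (norm (b2 x e) * norm (b2 x e)))
        \<le> real CARD('d) * (real CARD('d) * (K * K))" by (simp add: mult_left_mono)
    qed
  qed
  note iT = integrable_bounded_linear[OF bounded_linear_trace_mult i3, of ?H]
  have T: "trace (\<sigma> x ** transpose (\<sigma> x) ** ?H) = (\<integral>e. b2 x e \<bullet> (?H *v b2 x e) \<partial>\<nu>)"
    unfolding cov using integral_bounded_linear[OF bounded_linear_trace_mult i3, of ?H]
    by (simp add: trace_outer_mult)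
  have iu: "integrable \<nu> (\<lambda>e. u (x + ?b e) - u x)"
  proof (rule integrable_const_bound)
    show "AE e in \<nu>. norm (u (x + ?b e) - u x)
      \<le> L * (1 + (norm x + (\<epsilon> * (K * (1 + norm x)) + sqrt \<epsilon> * K))) + \<bar>u x\<bar>"
    proof (rule AE_I2)
      fix e
      have L: "0 \<le> L" using D(3)[of 0] by auto
      have "norm (?b e) \<le> \<epsilon> * norm (b1 x a e) + sqrt \<epsilon> * norm (b2 x e)"
        unfolding b by (rule norm_triangle_le) (use \<epsilon> in auto)
      also have "\<dots> \<le> \<epsilon> * (K * (1 + norm x)) + sqrt \<epsilon> * K"
        using bd \<epsilon> by (intro add_mono mult_left_mono) auto
      finally have "norm (x + ?b e) \<le> norm x + (\<epsilon> * (K * (1 + norm x)) + sqrt \<epsilon> * K)"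
        by (intro norm_triangle_le) simp
      then have "\<bar>u (x + ?b e)\<bar> \<le> L * (1 + (norm x + (\<epsilon> * (K * (1 + norm x)) + sqrt \<epsilon> * K)))"
        using L by (intro order_trans[OF D(3)] mult_left_mono) auto
      then show "norm (u (x + ?b e) - u x)
      \<le> L * (1 + (norm x + (\<epsilon> * (K * (1 + norm x)) + sqrt \<epsilon> * K))) + \<bar>u x\<bar>"
        unfolding real_norm_def by linarith
    qed
  qed measurable
  have ig: "integrable \<nu> (\<lambda>e. grad u x \<bullet> ?b e)" unfolding b using i1 i2 by simp
  let ?Z = "\<lambda>e. u (x + ?b e) - u x - grad u x \<bullet> ?b e - \<epsilon> / 2 * (b2 x e \<bullet> (?H *v b2 x e))"
  have "(\<integral>e. ?Z e \<partial>\<nu>) = (\<integral>e. u (x + ?b e) - u x \<partial>\<nu>) - (\<integral>e. grad u x \<bullet> ?b e \<partial>\<nu>)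
    - \<epsilon> / 2 * (\<integral>e. b2 x e \<bullet> (?H *v b2 x e) \<partial>\<nu>)"
    using iu ig iT by (simp add: trace_outer_mult)
  also have "(\<integral>e. grad u x \<bullet> ?b e \<partial>\<nu>) = \<epsilon> * (grad u x \<bullet> \<mu> x a)"
    unfolding b using i1 i2 mean by (simp add: inner_add_right)
  also have "I - \<epsilon> * g - \<epsilon> / 2 * T = \<epsilon> * (1 / \<epsilon> * I - g - 1 / 2 * T)" for I g T :: real
    using \<epsilon> by (simp add: right_diff_distrib)
  finally have Z: "(\<integral>e. ?Z e \<partial>\<nu>) = \<epsilon> * residual \<nu> (scaled_coeff b1 b2 \<epsilon>) \<mu> \<sigma> u \<epsilon> x a"
    unfolding residual_def T .
  have iZ: "integrable \<nu> ?Z" using iu ig iT by (simp add: trace_outer_mult)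
  have "\<bar>\<integral>e. ?Z e \<partial>\<nu>\<bar> \<le> (\<integral>e. \<bar>?Z e\<bar> \<partial>\<nu>)" by (rule integral_abs_bound)
  also have "\<dots> \<le> (\<integral>e. \<epsilon> * ?C \<partial>\<nu>)"
    using iZ unfolding b
    by (intro integral_mono taylor_remainder_scaled reg \<beta> \<epsilon> K bd integrable_abs) auto
  also have "\<dots> = \<epsilon> * ?C" by (simp add: prob_space)
  finally show ?thesis unfolding Z using \<epsilon> by (simp add: abs_mult)
qed

section \<open>Measurable selection and integrals with a parameter\<close>

text \<open>The selector is the lexicographic minimum: minimising one coordinate after the other keeps
  the hitting sets of closed sets measurable.\<close>

lemma measurable_selection:
  fixes K :: "'x \<Rightarrow> 'a::euclidean_space set"
  assumes K: "\<And>x. x \<in> space \<Omega> \<Longrightarrow> compact (K x)" "\<And>x. x \<in> space \<Omega> \<Longrightarrow> K x \<noteq> {}"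
    and meas: "\<And>C. closed C \<Longrightarrow> {x\<in>space \<Omega>. K x \<inter> C \<noteq> {}} \<in> sets \<Omega>"
  shows "\<exists>f\<in>borel_measurable \<Omega>. \<forall>x\<in>space \<Omega>. f x \<in> K x"
proof -
  \<comment> \<open>Induction over the set \<open>S\<close> of coordinates already minimised: all
    points of \<open>K' x\<close> share them, so \<open>K' x\<close> is a singleton once
    \<open>S = Basis\<close>.\<close>
  have "\<exists>K'. (\<forall>x\<in>space \<Omega>. compact (K' x) \<and> K' x \<noteq> {} \<and> K' x \<subseteq> K x
      \<and> (\<forall>a\<in>K' x. \<forall>b\<in>K' x. \<forall>i\<in>S. a \<bullet> i = b \<bullet> i))
    \<and> (\<forall>C. closed C \<longrightarrow> {x\<in>space \<Omega>. K' x \<inter> C \<noteq> {}} \<in> sets \<Omega>)" if "finite S" for S :: "'a set"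
    using that
  proof induction
    case empty
    with K meas show ?case by (intro exI[of _ K]) auto
  next
    case (insert i S)
    from insert.IH obtain K1 where *: "\<forall>x\<in>space \<Omega>. compact (K1 x) \<and> K1 x \<noteq> {} \<and> K1 x \<subseteq> K x
        \<and> (\<forall>a\<in>K1 x. \<forall>b\<in>K1 x. \<forall>i\<in>S. a \<bullet> i = b \<bullet> i)"
      and meas1: "\<forall>C. closed C \<longrightarrow> {x\<in>space \<Omega>. K1 x \<inter> C \<noteq> {}} \<in> sets \<Omega>"
      by (elim exE conjE)
    have K1: "compact (K1 x)" "K1 x \<noteq> {}" "K1 x \<subseteq> K x"
        "a \<in> K1 x \<Longrightarrow> b \<in> K1 x \<Longrightarrow> i \<in> S \<Longrightarrow> a \<bullet> i = b \<bullet> i" if "x \<in> space \<Omega>" for x a b i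
      using *[rule_format, OF that] by blast+
    define K2 where "K2 x = {a\<in>K1 x. \<forall>b\<in>K1 x. a \<bullet> i \<le> b \<bullet> i}" for x
    have min: "\<exists>a\<in>D. \<forall>b\<in>D. a \<bullet> i \<le> b \<bullet> i" if "compact D" "D \<noteq> {}" for D :: "'a set"
      using that by (intro continuous_attains_inf) (auto intro!: continuous_intros)
    have "compact (K2 x)" if "x \<in> space \<Omega>" for x
    proof -
      have "K2 x = K1 x \<inter> (\<Inter>b\<in>K1 x. {a. a \<bullet> i \<le> b \<bullet> i})"
        by (auto simp: K2_def)
      moreover have "closed (\<Inter>b\<in>K1 x. {a. a \<bullet> i \<le> b \<bullet> i})"
        by (intro closed_INT ballI closed_Collect_le continuous_intros)
      ultimately show ?thesis using K1(1)[OF that] by (simp add: compact_Int_closed)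
    qed
    moreover have "K2 x \<noteq> {}" if "x \<in> space \<Omega>" for x
      using min[OF K1(1)[OF that] K1(2)[OF that]] by (auto simp: K2_def)
    moreover have "{x\<in>space \<Omega>. K2 x \<inter> C \<noteq> {}} \<in> sets \<Omega>" if C: "closed C" for C
    proof -
      let ?Q = "\<lambda>q::rat. {a. a \<bullet> i \<le> of_rat q}"
      have clQ: "closed (?Q q)" for q by (intro closed_Collect_le continuous_intros)
      \<comment> \<open>The minimum of coordinate \<open>i\<close> over \<open>K1 x\<close> is
        attained in \<open>C\<close> iff every rational level reached by \<open>K1 x\<close> is
        reached by \<open>K1 x \<inter> C\<close>. Rational levels make this a countable condition
        on hitting sets of closed sets.\<close>
      have "K2 x \<inter> C \<noteq> {} \<longleftrightarrow> (\<forall>q. K1 x \<inter> ?Q q \<noteq> {} \<longrightarrow> K1 x \<inter> (C \<inter> ?Q q) \<noteq> {})"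
        if x: "x \<in> space \<Omega>" for x
      proof
        assume "K2 x \<inter> C \<noteq> {}"
        then show "\<forall>q. K1 x \<inter> ?Q q \<noteq> {} \<longrightarrow> K1 x \<inter> (C \<inter> ?Q q) \<noteq> {}"
          unfolding K2_def by (blast intro: order_trans)
      next
        assume R: "\<forall>q. K1 x \<inter> ?Q q \<noteq> {} \<longrightarrow> K1 x \<inter> (C \<inter> ?Q q) \<noteq> {}"
        obtain b where b: "b \<in> K1 x" "\<forall>c\<in>K1 x. b \<bullet> i \<le> c \<bullet> i"
          using min[OF K1(1)[OF x] K1(2)[OF x]] by auto
        have hit: "K1 x \<inter> (C \<inter> ?Q q) \<noteq> {}" if "b \<bullet> i < of_rat q" for q
        proof -
          have "b \<in> K1 x \<inter> ?Q q" using b(1) that by simp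
          with R show ?thesis by blast
        qed
        obtain q :: rat where "b \<bullet> i < of_rat q" using of_rat_dense[of "b \<bullet> i" "b \<bullet> i + 1"] by auto
        from hit[OF this] have "K1 x \<inter> C \<noteq> {}" by blast
        then obtain a where a: "a \<in> K1 x \<inter> C" "\<forall>c\<in>K1 x \<inter> C. a \<bullet> i \<le> c \<bullet> i"
          using min[of "K1 x \<inter> C"] K1(1)[OF x] C by (auto simp: compact_Int_closed)
        have "a \<bullet> i \<le> b \<bullet> i"
        proof (rule ccontr)
          assume "\<not> a \<bullet> i \<le> b \<bullet> i"
          then obtain q :: rat where q: "b \<bullet> i < of_rat q" "of_rat q < a \<bullet> i"
            using of_rat_dense by (metis not_le)
          from hit[OF q(1)] obtain c where "c \<in> K1 x \<inter> C" "c \<bullet> i \<le> of_rat q" by blast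
          with a(2) q(2) show False by force
        qed
        with a b have "a \<in> K2 x" unfolding K2_def by force
        with a show "K2 x \<inter> C \<noteq> {}" by auto
      qed
      then have "{x\<in>space \<Omega>. K2 x \<inter> C \<noteq> {}}
        = {x\<in>space \<Omega>. \<forall>q. K1 x \<inter> ?Q q \<noteq> {} \<longrightarrow> K1 x \<inter> (C \<inter> ?Q q) \<noteq> {}}"
        by auto
      also have "\<dots> \<in> sets \<Omega>"
        using meas1[rule_format, OF clQ] meas1[rule_format, OF closed_Int[OF C clQ]]
        by (intro sets.sets_Collect_countable_All sets.sets_Collect_imp)
      finally show ?thesis .
    qed
    moreover have "K2 x \<subseteq> K x" if "x \<in> space \<Omega>" for x
      using K1(3)[OF that] by (auto simp: K2_def)
    moreover have "a \<bullet> j = b \<bullet> j" if "x \<in> space \<Omega>" "a \<in> K2 x" "b \<in> K2 x" "j \<in> insert i S" for x a b j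
      using that K1(4)[of x a b j] by (auto simp: K2_def intro: antisym)
    ultimately show ?case by (intro exI[of _ K2] conjI ballI allI impI)
  qed
  from this[OF finite_Basis] obtain K' where *: "\<forall>x\<in>space \<Omega>. compact (K' x) \<and> K' x \<noteq> {} \<and> K' x \<subseteq> K x
      \<and> (\<forall>a\<in>K' x. \<forall>b\<in>K' x. \<forall>i\<in>Basis. a \<bullet> i = b \<bullet> i)"
    and meas': "\<forall>C. closed C \<longrightarrow> {x\<in>space \<Omega>. K' x \<inter> C \<noteq> {}} \<in> sets \<Omega>"
    by (elim exE conjE)
  have K': "K' x \<noteq> {}" "K' x \<subseteq> K x" "a \<in> K' x \<Longrightarrow> b \<in> K' x \<Longrightarrow> a = b" if "x \<in> space \<Omega>" for x a b
    using *[rule_format, OF that] by (blast intro: euclidean_eqI)+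
  define f where "f x = (SOME a. a \<in> K' x)" for x
  have f: "f x \<in> K' x" if "x \<in> space \<Omega>" for x
    using K'(1)[OF that] unfolding f_def by (simp add: some_in_eq)
  have "f \<in> borel_measurable \<Omega>"
    unfolding borel_eq_closed
  proof (rule measurable_measure_of)
    fix C :: "'a set" assume "C \<in> Collect closed"
    \<comment> \<open>For singletons, the preimage of a set under the selector is its hitting
      set.\<close>
    moreover have "f -` C \<inter> space \<Omega> = {x\<in>space \<Omega>. K' x \<inter> C \<noteq> {}}"
      using f K'(3) by blast
    ultimately show "f -` C \<inter> space \<Omega> \<in> sets \<Omega>" using meas' by simp
  qed auto
  with f K'(2) show ?thesis by blast
qed

text \<open>The maximisers form a nonempty compact set, and those \<open>x\<close> that have a
  maximiser in a closed \<open>C\<close> form the projection along the compact \<open>A\<close> of a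
  closed set, hence a closed set.\<close>

lemma measurable_argmax:
  fixes G :: "'x::euclidean_space \<Rightarrow> 'a::euclidean_space \<Rightarrow> real"
  assumes A: "compact A" "A \<noteq> {}"
    and G: "continuous_on (UNIV \<times> A) (\<lambda>(x, a). G x a)"
    and sup: "\<And>x. ereal c = (SUP a\<in>A. ereal (G x a))"
  shows "\<exists>g\<in>borel_measurable borel. \<forall>x. g x \<in> A \<and> G x (g x) = c"
proof -
  let ?K = "\<lambda>x. {a\<in>A. G x a = c}"
  have cG: "continuous_on A (G x)" for x
  proof -
    have "continuous_on A (\<lambda>a. (\<lambda>(x, a). G x a) (x, a))"
      by (rule continuous_on_compose2[OF G]) (auto intro!: continuous_intros)
    then show ?thesis by simp
  qed
  have "\<exists>f\<in>borel_measurable borel. \<forall>x\<in>space borel. f x \<in> ?K x"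
  proof (rule measurable_selection)
    fix x :: 'x
    have "closed (A \<inter> G x -` {c})"
      using cG[of x] compact_imp_closed[OF A(1)] by (intro continuous_closed_preimage) auto
    then have "compact (A \<inter> (A \<inter> G x -` {c}))" using A by (intro compact_Int_closed)
    also have "A \<inter> (A \<inter> G x -` {c}) = ?K x" by auto
    finally show "compact (?K x)" .
    obtain a where a: "a \<in> A" "\<forall>b\<in>A. G x b \<le> G x a"
      using continuous_attains_sup[OF A cG] by blast
    then have "(SUP a\<in>A. ereal (G x a)) = ereal (G x a)"
      by (intro antisym SUP_least SUP_upper) auto
    with a sup[of x] show "?K x \<noteq> {}" by auto
  next
    fix C :: "'a set" assume C: "closed C"
    \<comment> \<open>The coordinates are swapped because \<open>closed_compact_projection\<close>
      has the compact factor first.\<close>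
    let ?T = "(A \<times> UNIV) \<inter> (\<lambda>(a, x). G x a) -` {c} \<inter> (C \<times> UNIV)"
    have "continuous_on (A \<times> UNIV) (\<lambda>z. (\<lambda>(x, a). G x a) (snd z, fst z))"
      by (rule continuous_on_compose2[OF G]) (auto intro!: continuous_intros)
    then have "continuous_on (A \<times> UNIV) (\<lambda>(a, x). G x a)" by (simp add: case_prod_beta)
    then have "closed ?T"
      using C compact_imp_closed[OF A(1)]
      by (intro closed_Int continuous_closed_preimage) (auto intro!: closed_Times)
    with A(1) have "closed {x. \<exists>a. a \<in> A \<and> (a, x) \<in> ?T}"
      by (rule closed_compact_projection)
    also have "{x. \<exists>a. a \<in> A \<and> (a, x) \<in> ?T} = {x\<in>space borel. ?K x \<inter> C \<noteq> {}}"
      by auto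
    finally show "{x\<in>space borel. ?K x \<inter> C \<noteq> {}} \<in> sets borel" by simp
  qed
  then show ?thesis by auto
qed

text \<open>Dominated convergence along sequences. The bound \<open>B\<close> depends on the
  parameter, but along a convergent sequence it is bounded, being continuous.\<close>

lemma continuous_on_integral_bounded:
  fixes F :: "'p::metric_space \<Rightarrow> 'e \<Rightarrow> 'b::{banach, second_countable_topology}"
  assumes \<nu>: "prob_space \<nu>"
    and cont: "\<And>e. continuous_on S (\<lambda>p. F p e)"
    and meas: "\<And>p. p \<in> S \<Longrightarrow> F p \<in> borel_measurable \<nu>"
    and bd: "\<And>p e. p \<in> S \<Longrightarrow> norm (F p e) \<le> B p" and B: "continuous_on S B"
  shows "continuous_on S (\<lambda>p. \<integral>e. F p e \<partial>\<nu>)"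
  unfolding continuous_on_sequentially
proof (intro allI ballI impI, elim conjE)
  interpret prob_space \<nu> by fact
  fix p s assume p: "p \<in> S" and s: "\<forall>n. s n \<in> S" and lim: "s \<longlonglongrightarrow> p"
  have "(\<lambda>n. B (s n)) \<longlonglongrightarrow> B p"
    using B p s lim unfolding continuous_on_sequentially comp_def by blast
  then have "Bseq (\<lambda>n. B (s n))" by (intro convergent_imp_Bseq convergentI)
  then obtain C where C: "\<And>n. norm (B (s n)) \<le> C" by (auto simp: Bseq_def)
  have "(\<lambda>n. \<integral>e. F (s n) e \<partial>\<nu>) \<longlonglongrightarrow> (\<integral>e. F p e \<partial>\<nu>)"
  proof (rule integral_dominated_convergence)
    show "integrable \<nu> (\<lambda>e. C)" by simp
    show "F p \<in> borel_measurable \<nu>" by (rule meas[OF p])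
    show "F (s n) \<in> borel_measurable \<nu>" for n using s by (intro meas) blast
    show "AE e in \<nu>. (\<lambda>n. F (s n) e) \<longlonglongrightarrow> F p e"
      using cont p s lim unfolding continuous_on_sequentially comp_def by blast
    show "AE e in \<nu>. norm (F (s n) e) \<le> C" for n
    proof (rule AE_I2)
      fix e
      have "norm (F (s n) e) \<le> B (s n)" using s by (intro bd) blast
      also have "\<dots> \<le> C" using C[of n] by simp
      finally show "norm (F (s n) e) \<le> C" .
    qed
  qed
  then show "((\<lambda>p. \<integral>e. F p e \<partial>\<nu>) \<circ> s) \<longlonglongrightarrow> (\<integral>e. F p e \<partial>\<nu>)" by (simp add: comp_def)
qed

text \<open>From a fixed state, bounded jumps stay in a compact ball, on which a continuous function
  is bounded.\<close>

lemma integrable_continuous_shift: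
  fixes u :: "'x::euclidean_space \<Rightarrow> real"
  assumes \<nu>: "prob_space \<nu>" and u: "continuous_on UNIV u"
    and meas: "h \<in> borel_measurable \<nu>" and bd: "\<And>e. norm (h e) \<le> B"
  shows "integrable \<nu> (\<lambda>e. u (y + h e))"
proof -
  interpret prob_space \<nu> by fact
  have "bounded (u ` cball y B)"
    using u by (intro compact_imp_bounded compact_continuous_image continuous_on_subset[OF u]) auto
  then obtain C where C: "\<And>z. z \<in> cball y B \<Longrightarrow> norm (u z) \<le> C"
    unfolding bounded_iff by blast
  show ?thesis
  proof (rule integrable_const_bound[where B = C])
    show "AE e in \<nu>. norm (u (y + h e)) \<le> C" using bd by (intro AE_I2 C) (simp add: dist_norm)
    have "u \<in> borel_measurable borel" using u by (rule borel_measurable_continuous_onI)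
    then show "(\<lambda>e. u (y + h e)) \<in> borel_measurable \<nu>" using meas by measurable
  qed
qed

text \<open>The coefficients are continuous for actions in \<open>A\<close> only, hence the trace
  sigma-algebra on the action factor.\<close>

lemma borel_measurable_continuous_on_Times:
  fixes f :: "'x::euclidean_space \<times> 'a::euclidean_space \<times> 'e::euclidean_space \<Rightarrow> 'b::real_normed_vector"
  assumes f: "continuous_on (UNIV \<times> A \<times> UNIV) f"
  shows "(\<lambda>((y, a), e). f (y, a, e)) \<in> borel_measurable ((borel \<Otimes>\<^sub>M restrict_space borel A) \<Otimes>\<^sub>M borel)"
proof -
  let ?R = "(borel \<Otimes>\<^sub>M restrict_space borel A) \<Otimes>\<^sub>M borel :: (('x \<times> 'a) \<times> 'e) measure"
  have A: "(\<lambda>q. snd (fst q)) \<in> measurable ?R borel"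
    using measurable_compose[OF measurable_compose[OF measurable_fst measurable_snd] measurable_restrict_space1[OF measurable_ident_sets[OF refl]]] .
  have "(\<lambda>q. (fst (fst q), snd (fst q), snd q)) \<in> measurable ?R (borel \<Otimes>\<^sub>M borel \<Otimes>\<^sub>M borel)"
    by (intro measurable_Pair measurable_snd A measurable_compose[OF measurable_fst measurable_fst])
  then have "(\<lambda>q. (fst (fst q), snd (fst q), snd q)) \<in> measurable ?R (restrict_space borel (UNIV \<times> A \<times> UNIV))"
    by (intro measurable_restrict_space2) (auto simp: borel_prod space_pair_measure space_restrict_space)
  from measurable_compose[OF this borel_measurable_continuous_on_restrict[OF f]]
  have "(\<lambda>q. f (fst (fst q), snd (fst q), snd q)) \<in> borel_measurable ?R" .
  moreover have "(\<lambda>((y, a), e). f (y, a, e)) = (\<lambda>q. f (fst (fst q), snd (fst q), snd q))" by auto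
  ultimately show ?thesis by simp
qed

lemma borel_measurable_continuous_on_Times2:
  fixes f :: "'x::euclidean_space \<times> 'a::euclidean_space \<Rightarrow> 'b::real_normed_vector"
  assumes f: "continuous_on (UNIV \<times> A) f"
  shows "f \<in> borel_measurable (borel \<Otimes>\<^sub>M restrict_space borel A)"
proof -
  let ?R = "borel \<Otimes>\<^sub>M restrict_space borel A :: ('x \<times> 'a) measure"
  have "snd \<in> measurable ?R borel"
    using measurable_compose[OF measurable_snd measurable_restrict_space1[OF measurable_ident_sets[OF refl]]] .
  then have "(\<lambda>q. (fst q, snd q)) \<in> measurable ?R (borel \<Otimes>\<^sub>M borel)"
    by (intro measurable_Pair measurable_fst)
  then have "(\<lambda>q. q) \<in> measurable ?R (restrict_space borel (UNIV \<times> A))"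
    by (intro measurable_restrict_space2) (auto simp: borel_prod space_pair_measure space_restrict_space)
  from measurable_compose[OF this borel_measurable_continuous_on_restrict[OF f]]
  show ?thesis .
qed

lemma continuous_on_trace_mult:
  fixes P Q R :: "'z::topological_space \<Rightarrow> real ^ 'd ^ 'd"
  assumes "continuous_on S P" "continuous_on S Q"
  shows "continuous_on S (\<lambda>z. trace (P z ** transpose (P z) ** Q z))"
  unfolding trace_def matrix_matrix_mult_def transpose_def
  using assms by (auto intro!: continuous_intros)

section \<open>Integration along a marked point process\<close>

lemma down_closed_finite:
  fixes S :: "nat set"
  assumes "finite S" "\<And>m n. n \<in> S \<Longrightarrow> m \<le> n \<Longrightarrow> m \<in> S"
  shows "S = {..<card S}"
proof (cases "S = {}")
  case False
  have "S = {..Max S}"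
  proof (intro equalityI subsetI)
    show "k \<in> S" if "k \<in> {..Max S}" for k
      using that by (intro assms(2)[OF Max_in[OF assms(1) False]]) simp
  qed (simp add: assms(1))
  then show ?thesis by (metis card_atMost lessThan_Suc_atMost)
qed simp

lemma measurable_eqI: "(\<And>\<omega>. f \<omega> = g \<omega>) \<Longrightarrow> g \<in> measurable R K \<Longrightarrow> f \<in> measurable R K"
  by (simp add: ext cong: measurable_cong)

lemma Int_stable_Times:
  "Int_stable A \<Longrightarrow> Int_stable B \<Longrightarrow> Int_stable {a \<times> b | a b. a \<in> A \<and> b \<in> B}"
proof (intro Int_stableI)
  fix x y assume st: "Int_stable A" "Int_stable B"
    and "x \<in> {a \<times> b | a b. a \<in> A \<and> b \<in> B}" "y \<in> {a \<times> b | a b. a \<in> A \<and> b \<in> B}"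
  then obtain a b c d where "x = a \<times> b" "a \<in> A" "b \<in> B" "y = c \<times> d" "c \<in> A" "d \<in> B" by blast
  with st have "x \<inter> y = (a \<inter> c) \<times> (b \<inter> d)" "a \<inter> c \<in> A" "b \<inter> d \<in> B"
    by (simp_all add: Times_Int_Times Int_stableD)
  then show "x \<inter> y \<in> {a \<times> b | a b. a \<in> A \<and> b \<in> B}" by blast
qed

text \<open>Fixes one enumeration of the jumps, which \<open>marked_point_process\<close> only
  asserts to exist. Its times and marks are measurable for \<open>M\<close>; what is measurable for
  the filtration has to be reached through \<open>N\<close>.\<close>

locale marked_jumps =
  fixes M :: "'w measure" and N :: "'w \<Rightarrow> ('e::euclidean_space \<times> real) measure"
    and T :: "nat \<Rightarrow> 'w \<Rightarrow> ereal" and E :: "nat \<Rightarrow> 'w \<Rightarrow> 'e"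
    and \<nu> :: "'e measure" and \<eta> :: real
  assumes prob_M: "prob_space M"
    and T_meas [measurable]: "\<And>n. T n \<in> borel_measurable M"
    and E_meas [measurable]: "\<And>n. E n \<in> borel_measurable M"
    and T_pos: "\<And>\<omega>. \<omega> \<in> space M \<Longrightarrow> 0 < T 0 \<omega>"
    and T_mono_Suc: "\<And>\<omega> n. \<omega> \<in> space M \<Longrightarrow> T n \<omega> \<le> T (Suc n) \<omega>"
    and T_strict_Suc: "\<And>\<omega> n. \<omega> \<in> space M \<Longrightarrow> T n \<omega> < \<infinity> \<Longrightarrow> T n \<omega> < T (Suc n) \<omega>"
    and T_tendsto: "AE \<omega> in M. (\<lambda>n. T n \<omega>) \<longlonglongrightarrow> \<infinity>"
    and N_eq: "\<And>\<omega>. \<omega> \<in> space M \<Longrightarrow>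
      N \<omega> = distr (count_space {n. T n \<omega> < \<infinity>}) borel (\<lambda>n. (E n \<omega>, real_of_ereal (T n \<omega>)))"
    and prob_\<nu>: "prob_space \<nu>" and sets_\<nu> [measurable_cong]: "sets \<nu> = sets borel"
    and \<eta>_pos: "0 < \<eta>"
    and compensator: "has_compensator M (mark_filtration M N) N
      (scale_measure (ennreal \<eta>) (\<nu> \<Otimes>\<^sub>M lborel))"
begin

abbreviation F :: "real \<Rightarrow> 'w measure" where "F \<equiv> mark_filtration M N"
abbreviation pred :: "(real \<times> 'w) measure" where "pred \<equiv> predictable_sigma M F"
abbreviation \<tau> :: "nat \<Rightarrow> 'w \<Rightarrow> real" where "\<tau> n \<omega> \<equiv> real_of_ereal (T n \<omega>)"

section \<open>Counting the jumps on the event of non-explosion\<close>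

definition good :: "'w set" where "good = {\<omega>\<in>space M. (\<lambda>n. T n \<omega>) \<longlonglongrightarrow> \<infinity>}"

text \<open>Meaningful on \<open>good\<close>, where the two sets are finite initial segments of the
  naturals. On an infinite set \<open>card\<close> returns 0.\<close>

definition cnt :: "real \<Rightarrow> 'w \<Rightarrow> nat" where "cnt t \<omega> = card {n. T n \<omega> \<le> ereal t}"

definition cnt_before :: "real \<Rightarrow> 'w \<Rightarrow> nat" where "cnt_before t \<omega> = card {n. T n \<omega> < ereal t}"

sublocale prob_space M by (rule prob_M)
sublocale \<nu>: prob_space \<nu> by (rule prob_\<nu>)

lemma space_\<nu> [simp]: "space \<nu> = UNIV"
  using sets_eq_imp_space_eq[OF sets_\<nu>] by simp

lemma good_in_space: "\<omega> \<in> good \<Longrightarrow> \<omega> \<in> space M"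
  by (simp add: good_def)

lemma T_mono: "\<omega> \<in> space M \<Longrightarrow> m \<le> n \<Longrightarrow> T m \<omega> \<le> T n \<omega>"
  by (rule lift_Suc_mono_le[of "\<lambda>n. T n \<omega>"]) (simp_all add: T_mono_Suc)

lemma T_gt_0: "\<omega> \<in> space M \<Longrightarrow> 0 < T n \<omega>"
  by (rule less_le_trans[OF T_pos T_mono[of \<omega> 0 n]]) simp_all

lemma ereal_\<tau>: "\<omega> \<in> space M \<Longrightarrow> T n \<omega> < \<infinity> \<Longrightarrow> ereal (\<tau> n \<omega>) = T n \<omega>"
  using T_gt_0[of \<omega> n] by (cases "T n \<omega>") auto

lemma \<tau>_pos: "\<omega> \<in> space M \<Longrightarrow> T n \<omega> < \<infinity> \<Longrightarrow> 0 < \<tau> n \<omega>"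
  using T_gt_0[of \<omega> n] by (cases "T n \<omega>") auto

text \<open>Monotonicity of the jump times reduces divergence to countably many conditions, which
  makes the event measurable.\<close>

lemma good_iff: "good = {\<omega>\<in>space M. \<forall>K::nat. \<exists>n. ereal (real K) < T n \<omega>}"
proof (intro set_eqI iffI)
  fix \<omega> assume "\<omega> \<in> good"
  then have lim: "(\<lambda>n. T n \<omega>) \<longlonglongrightarrow> \<infinity>" and \<omega>: "\<omega> \<in> space M"
    unfolding good_def by simp_all
  have "\<exists>n. ereal (real K) < T n \<omega>" for K :: nat
  proof -
    have "\<forall>\<^sub>F n in sequentially. ereal (real K) < T n \<omega>"
      by (rule order_tendstoD(1)[OF lim]) simp
    then show ?thesis by (rule eventually_happens'[OF sequentially_bot])
  qed
  with \<omega> show "\<omega> \<in> {\<omega>\<in>space M. \<forall>K::nat. \<exists>n. ereal (real K) < T n \<omega>}"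
    by (intro CollectI conjI allI)
next
  fix \<omega> assume *: "\<omega> \<in> {\<omega>\<in>space M. \<forall>K::nat. \<exists>n. ereal (real K) < T n \<omega>}"
  then have \<omega>: "\<omega> \<in> space M" by simp
  have "(\<lambda>n. T n \<omega>) \<longlonglongrightarrow> \<infinity>"
    unfolding tendsto_PInfty
  proof
    fix r
    obtain K :: nat where "r \<le> real K" using real_arch_simple by blast
    moreover from * obtain n where n: "ereal (real K) < T n \<omega>" by blast
    ultimately have "ereal r < T n \<omega>" by (meson ereal_less_eq(3) le_less_trans)
    then show "\<forall>\<^sub>F n in sequentially. ereal r < T n \<omega>"
      by (meson eventually_sequentiallyI less_le_trans T_mono[OF \<omega>])
  qed
  with \<omega> show "\<omega> \<in> good" by (simp add: good_def)
qed

lemma good_sets [measurable]: "good \<in> sets M"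
  unfolding good_iff by measurable

lemma bad_null: "space M - good \<in> null_sets M"
proof -
  have "AE \<omega> in M. \<omega> \<notin> space M - good" using T_tendsto by (auto simp: good_def)
  then show ?thesis by (intro AE_iff_null_sets[THEN iffD2]) auto
qed

lemma AE_good: "AE \<omega> in M. \<omega> \<in> good"
  using T_tendsto by (auto simp: good_def)

lemma jumps_before:
  assumes \<omega>: "\<omega> \<in> good"
  shows "{n. T n \<omega> \<le> ereal t} = {..<cnt t \<omega>}" "{n. T n \<omega> < ereal t} = {..<cnt_before t \<omega>}"
proof -
  have sp: "\<omega> \<in> space M" using \<omega> by (rule good_in_space)
  have "\<forall>\<^sub>F n in sequentially. ereal t < T n \<omega>"
    using \<omega> by (auto simp: good_def intro: order_tendstoD)
  then obtain n where n: "\<forall>m\<ge>n. ereal t < T m \<omega>" by (auto simp: eventually_sequentially)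
  have "{m. T m \<omega> \<le> ereal t} \<subseteq> {..n}"
  proof
    fix m assume "m \<in> {m. T m \<omega> \<le> ereal t}"
    with n show "m \<in> {..n}" by (metis atMost_iff linorder_not_le mem_Collect_eq nle_le)
  qed
  then have fin: "finite {n. T n \<omega> \<le> ereal t}" by (rule finite_subset) simp
  then show "{n. T n \<omega> \<le> ereal t} = {..<cnt t \<omega>}"
    unfolding cnt_def using T_mono[OF sp]
    by (intro down_closed_finite) (auto intro: order_trans)
  have "finite {n. T n \<omega> < ereal t}" by (rule finite_subset[OF _ fin]) auto
  then show "{n. T n \<omega> < ereal t} = {..<cnt_before t \<omega>}"
    unfolding cnt_before_def using T_mono[OF sp]
    by (intro down_closed_finite) (auto intro: le_less_trans)
qed

lemma less_cnt_iff: "\<omega> \<in> good \<Longrightarrow> n < cnt t \<omega> \<longleftrightarrow> T n \<omega> \<le> ereal t"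
  using jumps_before(1)[of \<omega> t] by blast

lemma less_cnt_before_iff: "\<omega> \<in> good \<Longrightarrow> n < cnt_before t \<omega> \<longleftrightarrow> T n \<omega> < ereal t"
  using jumps_before(2)[of \<omega> t] by blast

lemma less_cntD:
  assumes "\<omega> \<in> good" "n < cnt t \<omega>"
  shows "T n \<omega> < \<infinity>" "0 < \<tau> n \<omega>" "\<tau> n \<omega> \<le> t"
proof -
  have le: "T n \<omega> \<le> ereal t" using assms less_cnt_iff by blast
  then show fin: "T n \<omega> < \<infinity>" by (rule le_less_trans) simp
  show "0 < \<tau> n \<omega>" by (rule \<tau>_pos[OF good_in_space[OF assms(1)] fin])
  have "ereal (\<tau> n \<omega>) \<le> ereal t"
    unfolding ereal_\<tau>[OF good_in_space[OF assms(1)] fin] by (rule le)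
  then show "\<tau> n \<omega> \<le> t" by simp
qed

lemma cnt_eqI:
  assumes "\<omega> \<in> good" "\<And>n. n < m \<Longrightarrow> T n \<omega> \<le> ereal t" "ereal t < T m \<omega>"
  shows "cnt t \<omega> = m"
proof (rule antisym)
  show "cnt t \<omega> \<le> m" using less_cnt_iff[OF assms(1), of m t] assms(3) by (simp add: not_less[symmetric])
  show "m \<le> cnt t \<omega>" using less_cnt_iff[OF assms(1)] assms(2) by (metis less_irrefl not_le)
qed

lemma strict_T: "\<omega> \<in> space M \<Longrightarrow> T n \<omega> < \<infinity> \<Longrightarrow> m < n \<Longrightarrow> T m \<omega> < T n \<omega>"
proof -
  assume \<omega>: "\<omega> \<in> space M" and fin: "T n \<omega> < \<infinity>" and mn: "m < n"
  have "T m \<omega> < \<infinity>" using T_mono[OF \<omega>, of m n] mn fin by (intro le_less_trans[of "T m \<omega>" "T n \<omega>"]) auto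
  then have "T m \<omega> < T (Suc m) \<omega>" by (rule T_strict_Suc[OF \<omega>])
  also have "\<dots> \<le> T n \<omega>" using mn by (intro T_mono[OF \<omega>]) simp
  finally show ?thesis .
qed

text \<open>Jumps are numbered from 0 and their finite times are strictly increasing, so exactly
  \<open>n\<close> of them precede jump \<open>n\<close>.\<close>

lemma cnt_before_\<tau>:
  assumes "\<omega> \<in> good" "T n \<omega> < \<infinity>"
  shows "cnt_before (\<tau> n \<omega>) \<omega> = n"
proof -
  have sp: "\<omega> \<in> space M" using assms good_in_space by blast
  have "m < cnt_before (\<tau> n \<omega>) \<omega> \<longleftrightarrow> m < n" for m
    unfolding less_cnt_before_iff[OF assms(1)] ereal_\<tau>[OF sp assms(2)]
    using strict_T[OF sp assms(2), of m] T_mono[OF sp, of n m] by (cases "m < n") auto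
  then show ?thesis by (metis linorder_neqE_nat less_irrefl)
qed

lemma eventually_cnt_right:
  assumes \<omega>: "\<omega> \<in> good"
  shows "\<forall>\<^sub>F s in at_right t. cnt s \<omega> = cnt t \<omega>"
proof -
  \<comment> \<open>\<open>T (cnt t \<omega>) \<omega>\<close> is the first jump time after
    \<open>t\<close>, and the count stays constant until then; the real \<open>c\<close> below
    replaces it in case it is infinite.\<close>
  have "\<not> T (cnt t \<omega>) \<omega> \<le> ereal t" using less_cnt_iff[OF \<omega>] by blast
  then have "ereal t < T (cnt t \<omega>) \<omega>" by simp
  then obtain c where c: "t < c" "ereal c \<le> T (cnt t \<omega>) \<omega>"
    by (cases "T (cnt t \<omega>) \<omega>") (auto intro: that[of "t + 1"])
  have "\<forall>\<^sub>F s in at_right t. s \<in> {t<..<c}" using c by (intro eventually_at_right_real)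
  then show ?thesis
  proof eventually_elim
    case (elim s)
    show ?case
    proof (rule cnt_eqI[OF \<omega>])
      fix n assume "n < cnt t \<omega>"
      then have "T n \<omega> \<le> ereal t" using less_cnt_iff[OF \<omega>] by blast
      also have "\<dots> \<le> ereal s" using elim by simp
      finally show "T n \<omega> \<le> ereal s" .
    next
      have "ereal s < ereal c" using elim by simp
      then show "ereal s < T (cnt t \<omega>) \<omega>" using c(2) by (rule less_le_trans)
    qed
  qed
qed

lemma eventually_cnt_left:
  assumes \<omega>: "\<omega> \<in> good"
  shows "\<forall>\<^sub>F s in at_left t. cnt s \<omega> = cnt_before t \<omega>"
proof -
  have sp: "\<omega> \<in> space M" using \<omega> by (rule good_in_space)
  have "\<forall>\<^sub>F s in at_left t. \<forall>n\<in>{..<cnt_before t \<omega>}. T n \<omega> \<le> ereal s"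
  proof (intro eventually_ball_finite ballI)
    fix n assume "n \<in> {..<cnt_before t \<omega>}"
    then have n: "T n \<omega> < ereal t" using less_cnt_before_iff[OF \<omega>] by blast
    then have "T n \<omega> < \<infinity>" by (rule less_le_trans) simp
    note \<tau> = ereal_\<tau>[OF sp this]
    have "ereal (\<tau> n \<omega>) < ereal t" unfolding \<tau> by (rule n)
    then have "\<tau> n \<omega> < t" by simp
    then have "\<forall>\<^sub>F s in at_left t. s \<in> {\<tau> n \<omega><..<t}" by (rule eventually_at_left_real)
    then show "\<forall>\<^sub>F s in at_left t. T n \<omega> \<le> ereal s"
    proof eventually_elim
      case (elim s)
      then have "ereal (\<tau> n \<omega>) \<le> ereal s" by simp
      then show ?case unfolding \<tau> .
    qed
  qed simp
  moreover have "\<forall>\<^sub>F s in at_left t. s < t" by (simp add: eventually_at_filter)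
  ultimately show ?thesis
  proof eventually_elim
    case (elim s)
    have "ereal t \<le> T (cnt_before t \<omega>) \<omega>"
      using less_cnt_before_iff[OF \<omega>, of "cnt_before t \<omega>" t] by (simp add: not_less)
    moreover have "ereal s < ereal t" using elim by simp
    ultimately have "ereal s < T (cnt_before t \<omega>) \<omega>" by (meson less_le_trans)
    with elim show ?case by (intro cnt_eqI[OF \<omega>]) auto
  qed
qed

text \<open>A process that depends on time through the jump count alone is right-continuous. The
  third claim turns left limits at jump times into indices: the state just before jump
  \<open>n\<close> is the state after \<open>n\<close> jumps.\<close>

lemma step_path:
  fixes X :: "real \<Rightarrow> 'w \<Rightarrow> 'x::t2_space"
  assumes \<omega>: "\<omega> \<in> good" and X: "\<And>s. 0 \<le> s \<Longrightarrow> X s \<omega> = y (cnt s \<omega>)"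
  shows "0 \<le> t \<Longrightarrow> ((\<lambda>s. X s \<omega>) \<longlongrightarrow> X t \<omega>) (at_right t)"
    and "0 < t \<Longrightarrow> ((\<lambda>s. X s \<omega>) \<longlongrightarrow> y (cnt_before t \<omega>)) (at_left t)"
    and "T n \<omega> < \<infinity> \<Longrightarrow> left_lim X (\<tau> n \<omega>) \<omega> = y n"
proof -
  show "((\<lambda>s. X s \<omega>) \<longlongrightarrow> X t \<omega>) (at_right t)" if t: "0 \<le> t"
  proof (rule tendsto_eventually)
    have "\<forall>\<^sub>F s in at_right t. t < s" by (simp add: eventually_at_filter)
    with eventually_cnt_right[OF \<omega>, of t] show "\<forall>\<^sub>F s in at_right t. X s \<omega> = X t \<omega>"
      by eventually_elim (use t X in auto)
  qed
  show l: "((\<lambda>s. X s \<omega>) \<longlongrightarrow> y (cnt_before t \<omega>)) (at_left t)" if t: "0 < t" for t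
  proof (rule tendsto_eventually)
    have "\<forall>\<^sub>F s in at_left t. s \<in> {0<..<t}" using t by (rule eventually_at_left_real)
    with eventually_cnt_left[OF \<omega>, of t] show "\<forall>\<^sub>F s in at_left t. X s \<omega> = y (cnt_before t \<omega>)"
      by eventually_elim (use X in auto)
  qed
  show "left_lim X (\<tau> n \<omega>) \<omega> = y n" if "T n \<omega> < \<infinity>"
  proof -
    have pos: "0 < \<tau> n \<omega>" using \<tau>_pos that \<omega> good_in_space by blast
    have "Lim (at_left (\<tau> n \<omega>)) (\<lambda>s. X s \<omega>) = y n"
      using l[OF pos] unfolding cnt_before_\<tau>[OF \<omega> that] by (intro tendsto_Lim) auto
    moreover have "\<not> \<tau> n \<omega> \<le> 0" using pos by linarith
    ultimately show ?thesis unfolding left_lim_def by (simp only: if_False)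
  qed
qed

text \<open>Stated over a semiring, so that the Bochner and the nonnegative integral share it. Jump
  times are positive, so including time 0 in the strip adds no jump.\<close>

lemma indicator_jump:
  assumes \<omega>: "\<omega> \<in> good"
  shows "indicator {n. T n \<omega> < \<infinity>} n * indicator (UNIV \<times> {0..t}) (E n \<omega>, \<tau> n \<omega>) = (indicator {..<cnt t \<omega>} n :: 'c::semiring_1)"
proof (cases "n < cnt t \<omega>")
  case True
  then show ?thesis using less_cntD[OF \<omega> True] by (simp add: less_imp_le)
next
  case False
  have "\<not> \<tau> n \<omega> \<le> t" if "T n \<omega> < \<infinity>"
    using False less_cnt_iff[OF \<omega>, of n t] ereal_\<tau>[OF good_in_space[OF \<omega>] that] by (metis ereal_less_eq(3))
  with False show ?thesis by (auto simp: indicator_def)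
qed

text \<open>Measurability is asked after the cut to the strip, because the integrands will be
  predictable and so are controlled at nonnegative times only.\<close>

lemma set_lebesgue_integral_N:
  fixes g :: "'e \<times> real \<Rightarrow> 'b::{banach, second_countable_topology}"
  assumes \<omega>: "\<omega> \<in> good" and g: "(\<lambda>z. indicator (UNIV \<times> {0..t}) z *\<^sub>R g z) \<in> borel_measurable borel"
  shows "(LINT z:UNIV \<times> {0..t}|N \<omega>. g z) = (\<Sum>n<cnt t \<omega>. g (E n \<omega>, \<tau> n \<omega>))"
proof -
  have sp: "\<omega> \<in> space M" using \<omega> by (rule good_in_space)
  let ?g = "\<lambda>n. g (E n \<omega>, \<tau> n \<omega>)"
  let ?h = "\<lambda>n. indicator (UNIV \<times> {0..t}) (E n \<omega>, \<tau> n \<omega>) *\<^sub>R ?g n"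
  have "(LINT z:UNIV \<times> {0..t}|N \<omega>. g z) = (\<integral>n. ?h n \<partial>count_space {n. T n \<omega> < \<infinity>})"
    unfolding N_eq[OF sp] set_lebesgue_integral_def by (rule integral_distr[OF _ g]) simp
  also have "\<dots> = (\<integral>n. indicator {n. T n \<omega> < \<infinity>} n *\<^sub>R ?h n \<partial>count_space UNIV)"
    by (subst integral_restrict_space[symmetric]) (auto simp: restrict_count_space)
  also have "\<dots> = (\<integral>n. indicator {..<cnt t \<omega>} n *\<^sub>R ?g n \<partial>count_space UNIV)"
    by (simp only: scaleR_scaleR indicator_jump[OF \<omega>])
  also have "\<dots> = (\<integral>n. ?g n \<partial>count_space {..<cnt t \<omega>})"
    by (subst integral_restrict_space[symmetric]) (auto simp: restrict_count_space)
  also have "\<dots> = (\<Sum>n<cnt t \<omega>. ?g n)"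
    by (rule lebesgue_integral_count_space_finite) simp
  finally show ?thesis .
qed

lemma set_nn_integral_N:
  fixes g :: "'e \<times> real \<Rightarrow> ennreal"
  assumes \<omega>: "\<omega> \<in> good" and g: "(\<lambda>z. g z * indicator (UNIV \<times> {0..t}) z) \<in> borel_measurable borel"
  shows "(\<integral>\<^sup>+z\<in>UNIV \<times> {0..t}. g z \<partial>N \<omega>) = (\<Sum>n<cnt t \<omega>. g (E n \<omega>, \<tau> n \<omega>))"
proof -
  have sp: "\<omega> \<in> space M" using \<omega> by (rule good_in_space)
  let ?g = "\<lambda>n. g (E n \<omega>, \<tau> n \<omega>)"
  let ?h = "\<lambda>n. ?g n * indicator (UNIV \<times> {0..t}) (E n \<omega>, \<tau> n \<omega>)"
  have "(\<integral>\<^sup>+z\<in>UNIV \<times> {0..t}. g z \<partial>N \<omega>) = (\<integral>\<^sup>+n. ?h n \<partial>count_space {n. T n \<omega> < \<infinity>})"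
    unfolding N_eq[OF sp] by (rule nn_integral_distr) (use g in simp_all)
  also have "\<dots> = (\<integral>\<^sup>+n. ?h n * indicator {n. T n \<omega> < \<infinity>} n \<partial>count_space UNIV)"
    by (subst nn_integral_restrict_space[symmetric]) (auto simp: restrict_count_space)
  also have "\<dots> = (\<integral>\<^sup>+n. ?g n * indicator {..<cnt t \<omega>} n \<partial>count_space UNIV)"
    by (simp only: mult.assoc mult.commute[of "indicator (UNIV \<times> {0..t}) _"] indicator_jump[OF \<omega>])
  also have "\<dots> = (\<integral>\<^sup>+n. ?g n \<partial>count_space {..<cnt t \<omega>})"
    by (subst nn_integral_restrict_space[symmetric]) (auto simp: restrict_count_space)
  also have "\<dots> = (\<Sum>n<cnt t \<omega>. ?g n)"
    by (rule nn_integral_count_space_finite) simp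
  finally show ?thesis .
qed

text \<open>The measure \<open>N \<omega>\<close> varies with \<omega>. Moving
  \<open>T n \<omega> < \<infinity>\<close> into the integrand leaves the fixed counting measure on
  the naturals, where measurability of parameter integrals applies.\<close>

lemma borel_measurable_integral_N:
  fixes g :: "'w \<Rightarrow> 'e \<times> real \<Rightarrow> 'b::{banach, second_countable_topology}"
  assumes [measurable]: "(\<lambda>(\<omega>, z). g \<omega> z) \<in> borel_measurable (M \<Otimes>\<^sub>M borel)"
  shows "(\<lambda>\<omega>. \<integral>z. g \<omega> z \<partial>N \<omega>) \<in> borel_measurable M"
proof -
  interpret c: sigma_finite_measure "count_space (UNIV :: nat set)"
    by (rule sigma_finite_measure_count_space_countable) simp
  let ?h = "\<lambda>\<omega> n. indicator {n. T n \<omega> < \<infinity>} n *\<^sub>R g \<omega> (E n \<omega>, \<tau> n \<omega>)"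
  have [measurable]: "(\<lambda>z. g \<omega> z) \<in> borel_measurable borel" if "\<omega> \<in> space M" for \<omega>
    using measurable_compose[OF measurable_Pair1'[OF that] assms] by simp
  have "(\<integral>z. g \<omega> z \<partial>N \<omega>) = (\<integral>n. ?h \<omega> n \<partial>count_space UNIV)" if "\<omega> \<in> space M" for \<omega>
  proof -
    have "(\<integral>z. g \<omega> z \<partial>N \<omega>) = (\<integral>n. g \<omega> (E n \<omega>, \<tau> n \<omega>) \<partial>count_space {n. T n \<omega> < \<infinity>})"
      unfolding N_eq[OF that] using that by (intro integral_distr) auto
    also have "\<dots> = (\<integral>n. ?h \<omega> n \<partial>count_space UNIV)"
      by (subst integral_restrict_space[symmetric]) (auto simp: restrict_count_space)
    finally show ?thesis .
  qed
  moreover have "(\<lambda>\<omega>. \<integral>n. ?h \<omega> n \<partial>count_space UNIV) \<in> borel_measurable M"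
  proof (rule c.borel_measurable_lebesgue_integral)
    have "(\<lambda>\<omega>. ?h \<omega> n) \<in> borel_measurable M" for n
      unfolding indicator_def by measurable
    then have "(\<lambda>(n, \<omega>). ?h \<omega> n) \<in> borel_measurable (count_space UNIV \<Otimes>\<^sub>M M)"
      by (intro measurable_pair_measure_countable1) simp_all
    from measurable_pair_swap[OF this]
    show "(\<lambda>(\<omega>, n). ?h \<omega> n) \<in> borel_measurable (M \<Otimes>\<^sub>M count_space UNIV)" by simp
  qed
  ultimately show ?thesis by (simp cong: measurable_cong)
qed

section \<open>The filtration and its predictable sets\<close>

lemma space_F [simp]: "space (F t) = space M"
  by (simp add: mark_filtration_def augmented_filtration_def space_measure_of_conv)

lemma F_gen_sub: "{(\<lambda>\<omega>. LINT z:UNIV \<times> {0..s}|N \<omega>. fst z) -` B \<inter> space M | s B.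
    0 \<le> s \<and> s \<le> t \<and> B \<in> sets borel} \<union> null_sets M \<subseteq> sets M"
proof -
  have [measurable]: "(fst :: 'e \<times> real \<Rightarrow> 'e) \<in> borel_measurable borel"
    by (intro borel_measurable_continuous_onI continuous_on_fst continuous_on_id)
  have [measurable]: "(UNIV :: 'e set) \<times> {0..s::real} \<in> sets borel" for s
    by (intro borel_closed closed_Times) auto
  have "(\<lambda>\<omega>. LINT z:UNIV \<times> {0..s}|N \<omega>. fst z) \<in> borel_measurable M" for s
    unfolding set_lebesgue_integral_def by (rule borel_measurable_integral_N) measurable
  then show ?thesis by (auto intro: measurable_sets)
qed

lemma sets_F: "sets (F t) = sigma_sets (space M) ({(\<lambda>\<omega>. LINT z:UNIV \<times> {0..s}|N \<omega>. fst z) -` B \<inter> space M | s B.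
    0 \<le> s \<and> s \<le> t \<and> B \<in> sets borel} \<union> null_sets M)"
proof -
  have "sets M \<subseteq> Pow (space M)" using sets.sets_into_space by blast
  then show ?thesis
    unfolding mark_filtration_def augmented_filtration_def
    using F_gen_sub[of t] by (intro sets_measure_of) (meson order_trans)
qed

lemma sets_F_subset: "sets (F t) \<subseteq> sets M"
  unfolding sets_F by (rule sets.sigma_sets_subset[OF F_gen_sub])

lemma null_sets_F: "A \<in> null_sets M \<Longrightarrow> A \<in> sets (F t)"
  unfolding sets_F by (auto intro: sigma_sets.Basic)

lemma sets_F_mono: "s \<le> t \<Longrightarrow> sets (F s) \<subseteq> sets (F t)"
  unfolding sets_F by (rule sigma_sets_subseteq) (blast intro: order_trans)

lemma measurable_F_M: "f \<in> measurable (F t) K \<Longrightarrow> f \<in> measurable M K"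
  using sets_F_subset[of t] by (auto simp: measurable_def)

lemma measurable_F_mono: "s \<le> t \<Longrightarrow> f \<in> measurable (F s) K \<Longrightarrow> f \<in> measurable (F t) K"
  using sets_F_mono[of s t] by (auto simp: measurable_def)

text \<open>Non-explosion depends on the whole path, but it is almost sure, and every
  \<open>F t\<close> contains the null sets of \<open>M\<close>.\<close>

lemma good_F: "good \<in> sets (F t)"
proof -
  have "space (F t) - (space M - good) \<in> sets (F t)"
    by (intro sets.compl_sets null_sets_F bad_null)
  moreover have "space (F t) - (space M - good) = good" using good_in_space by auto
  ultimately show ?thesis by simp
qed

lemma space_pred [simp]: "space pred = {0..} \<times> space M"
  by (simp add: predictable_sigma_def space_measure_of_conv)

lemma pred_gen_sub:
  "{{0} \<times> B | B. B \<in> sets (F 0)} \<union> {{s<..t} \<times> B | s t B. 0 \<le> s \<and> s < t \<and> B \<in> sets (F s)}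
    \<subseteq> Pow ({0..} \<times> space M)"
  using sets.sets_into_space[of _ "F _"] by fastforce

lemma sets_pred: "sets pred = sigma_sets ({0..} \<times> space M)
  ({{0} \<times> B | B. B \<in> sets (F 0)} \<union> {{s<..t} \<times> B | s t B. 0 \<le> s \<and> s < t \<and> B \<in> sets (F s)})"
  unfolding predictable_sigma_def by (rule sets_measure_of[OF pred_gen_sub])

lemma pred_gen0: "B \<in> sets (F 0) \<Longrightarrow> {0} \<times> B \<in> sets pred"
  unfolding sets_pred by (auto intro!: sigma_sets.Basic)

lemma pred_gen: "0 \<le> s \<Longrightarrow> s < t \<Longrightarrow> B \<in> sets (F s) \<Longrightarrow> {s<..t} \<times> B \<in> sets pred"
  unfolding sets_pred by (auto intro!: sigma_sets.Basic)

text \<open>On nonnegative times the predictable sigma-algebra is coarser than the product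
  one.\<close>

lemma measurable_predI:
  assumes f: "f \<in> measurable R (borel \<Otimes>\<^sub>M M)" and pos: "\<And>x. x \<in> space R \<Longrightarrow> 0 \<le> fst (f x)"
  shows "f \<in> measurable R pred"
  unfolding predictable_sigma_def
proof (rule measurable_measure_of)
  show "f \<in> space R \<rightarrow> {0..} \<times> space M"
    using measurable_space[OF f] pos by (auto simp: space_pair_measure mem_Times_iff)
next
  fix y assume "y \<in> {{0} \<times> B |B. B \<in> sets (F 0)} \<union> {{s<..t} \<times> B |s t B. 0 \<le> s \<and> s < t \<and> B \<in> sets (F s)}"
  then have "y \<in> sets (borel \<Otimes>\<^sub>M M)"
    by (auto intro!: pair_measureI subsetD[OF sets_F_subset])
  then show "f -` y \<inter> space R \<in> sets R" by (rule measurable_sets[OF f])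
qed (rule pred_gen_sub)

text \<open>Pointwise limit of predictable step processes: on each cell of a grid of mesh
  \<open>1 / Suc i\<close>, the value of \<open>X\<close> at the left end of the cell, which is
  known there and lies strictly before \<open>t\<close>.\<close>

lemma left_lim_predictable:
  fixes X :: "real \<Rightarrow> 'w \<Rightarrow> 'x::metric_space"
  assumes ad: "adapted F X" and cad: "cadlag_paths M X"
  shows "(\<lambda>(t, \<omega>). left_lim X t \<omega>) \<in> borel_measurable pred"
proof (rule borel_measurable_LIMSEQ_metric)
  \<comment> \<open>The left end of the cell containing \<open>t\<close>. The cells are open on the
    left and closed on the right, hence the ceiling minus one: a grid point is sent to the previous
    grid point.\<close>
  let ?k = "\<lambda>i t. real (nat \<lceil>t * real (Suc i)\<rceil> - 1) / real (Suc i)"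
  let ?Z = "\<lambda>i (t, \<omega>). if t \<le> 0 then X 0 \<omega> else X (?k i t) \<omega>"
  have k: "?k i t = real k / real (Suc i)" "\<lceil>t * real (Suc i)\<rceil> = int k + 1"
    if "real k / real (Suc i) < t" "t \<le> (real k + 1) / real (Suc i)" for i k t
  proof -
    have "real k < t * real (Suc i)" "t * real (Suc i) \<le> real k + 1"
      using that by (simp_all add: pos_divide_less_eq pos_le_divide_eq del: of_nat_Suc)
    then show "\<lceil>t * real (Suc i)\<rceil> = int k + 1" by (intro ceiling_unique) auto
    then show "?k i t = real k / real (Suc i)" by (simp add: nat_add_distrib)
  qed
  have ex: "\<exists>k. real k / real (Suc i) < t \<and> t \<le> (real k + 1) / real (Suc i)" if "0 < t" for i t
  proof (intro exI conjI)
    have "0 < t * real (Suc i)" using that by simp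
    then have c: "1 \<le> \<lceil>t * real (Suc i)\<rceil>" by linarith
    let ?n = "nat \<lceil>t * real (Suc i)\<rceil> - 1"
    have "int ?n = \<lceil>t * real (Suc i)\<rceil> - 1" using c by linarith
    then have n: "real ?n = of_int \<lceil>t * real (Suc i)\<rceil> - 1"
      by (metis of_int_diff of_int_1 of_int_of_nat_eq)
    have "real ?n < t * real (Suc i)" "t * real (Suc i) \<le> real ?n + 1"
      unfolding n by linarith+
    then show "real ?n / real (Suc i) < t" "t \<le> (real ?n + 1) / real (Suc i)"
      by (simp_all add: pos_divide_less_eq pos_le_divide_eq del: of_nat_Suc)
  qed
  show "?Z i \<in> borel_measurable pred" for i
  proof (rule measurableI)
    fix B :: "'x set" assume B: "B \<in> sets borel"
    have XF: "X s -` B \<inter> space M \<in> sets (F s)" if "0 \<le> s" for s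
      using ad that B measurable_sets[of "X s" "F s" borel B] by (simp add: adapted_def)
    have "?Z i -` B \<inter> space pred = {0} \<times> (X 0 -` B \<inter> space M) \<union>
      (\<Union>k. {real k / real (Suc i)<..(real k + 1) / real (Suc i)} \<times> (X (real k / real (Suc i)) -` B \<inter> space M))"
      (is "_ = ?R")
    proof (intro set_eqI iffI)
      fix p assume p: "p \<in> ?Z i -` B \<inter> space pred"
      obtain t \<omega> where [simp]: "p = (t, \<omega>)" by (cases p)
      show "p \<in> ?R"
      proof (cases "t \<le> 0")
        case True
        with p show ?thesis by auto
      next
        case False
        then obtain k where "real k / real (Suc i) < t \<and> t \<le> (real k + 1) / real (Suc i)"
          using ex[of t i] by auto
        with p False k(1)[of k i t] show ?thesis by (auto simp del: of_nat_Suc)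
      qed
    next
      fix p assume p: "p \<in> ?R"
      then show "p \<in> ?Z i -` B \<inter> space pred"
      proof
        assume "p \<in> {0} \<times> (X 0 -` B \<inter> space M)"
        then show ?thesis by auto
      next
        assume "p \<in> (\<Union>k. {real k / real (Suc i)<..(real k + 1) / real (Suc i)} \<times> (X (real k / real (Suc i)) -` B \<inter> space M))"
        then obtain k t \<omega> where *: "p = (t, \<omega>)" "real k / real (Suc i) < t" "t \<le> (real k + 1) / real (Suc i)"
          "X (real k / real (Suc i)) \<omega> \<in> B" "\<omega> \<in> space M" by (auto simp del: of_nat_Suc)
        have "0 \<le> real k / real (Suc i)" by simp
        with * have "0 < t" by linarith
        with * k(1)[OF *(2,3)] show ?thesis by (simp del: of_nat_Suc)
      qed
    qed
    also have "\<dots> \<in> sets pred"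
      by (intro sets.Un sets.countable_UN image_subsetI pred_gen0 pred_gen XF)
        (auto simp: divide_strict_right_mono simp del: of_nat_Suc)
    finally show "?Z i -` B \<inter> space pred \<in> sets pred" .
  qed simp
  fix p assume "p \<in> space pred"
  then obtain t \<omega> where p: "p = (t, \<omega>)" "0 \<le> t" "\<omega> \<in> space M" by auto
  show "(\<lambda>i. ?Z i p) \<longlonglongrightarrow> (\<lambda>(t, \<omega>). left_lim X t \<omega>) p"
  proof (cases "t = 0")
    case True
    with p show ?thesis by (simp add: left_lim_def)
  next
    case False
    with p have t: "0 < t" by simp
    obtain l where l: "((\<lambda>s. X s \<omega>) \<longlongrightarrow> l) (at_left t)"
      using cad t p(3) unfolding cadlag_paths_def by blast
    have "left_lim X t \<omega> = l"
      using t tendsto_Lim[OF _ l] by (simp add: left_lim_def)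
    have b: "t - 1 / real (Suc i) \<le> ?k i t \<and> ?k i t < t" for i
    proof -
      from ex[OF t, of i] obtain k where k': "real k / real (Suc i) < t" "t \<le> (real k + 1) / real (Suc i)"
        by blast
      then show ?thesis unfolding k(1)[OF k'] by (simp add: add_divide_distrib del: of_nat_Suc)
    qed
    have "(\<lambda>i. ?k i t) \<longlonglongrightarrow> t"
    proof (rule tendsto_sandwich[where h = "\<lambda>_. t"])
      show "(\<lambda>i. t - 1 / real (Suc i)) \<longlonglongrightarrow> t"
        using tendsto_diff[OF tendsto_const LIMSEQ_Suc[OF lim_1_over_n]] by simp
    qed (use b in \<open>auto intro!: always_eventually simp: less_imp_le simp del: of_nat_Suc\<close>)
    then have "filterlim (\<lambda>i. ?k i t) (at_left t) sequentially"
      unfolding filterlim_at using b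
      by (auto intro!: always_eventually simp del: of_nat_Suc) (metis less_irrefl)
    from filterlim_compose[OF l this] show ?thesis
      using t p \<open>left_lim X t \<omega> = l\<close> by simp
  qed
qed

text \<open>The integral of a predictable function along \<open>N\<close> up to time
  \<open>t\<close>. Since \<open>good\<close> lies in every \<open>F t\<close>, the value 0 off that
  set keeps measurability as a statement about all \<omega>.\<close>

definition jsum :: "real \<Rightarrow> ((real \<times> 'w) \<times> 'e \<Rightarrow> 'b) \<Rightarrow> 'w \<Rightarrow> 'b::comm_monoid_add" where
  "jsum t H \<omega> = (if \<omega> \<in> good then \<Sum>n<cnt t \<omega>. H ((\<tau> n \<omega>, \<omega>), E n \<omega>) else 0)"

abbreviation predE :: "((real \<times> 'w) \<times> 'e) measure" where "predE \<equiv> pred \<Otimes>\<^sub>M borel"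

lemma jump_in_space:
  "\<omega> \<in> good \<Longrightarrow> n < cnt t \<omega> \<Longrightarrow> ((\<tau> n \<omega>, \<omega>), e) \<in> space predE"
  using less_cntD(2)[of \<omega> n t] good_in_space by (simp add: space_pair_measure less_imp_le)

lemma section_measurable:
  fixes H :: "(real \<times> 'w) \<times> 'e \<Rightarrow> 'k"
  assumes H: "H \<in> measurable predE K" and \<omega>: "\<omega> \<in> space M"
  shows "(\<lambda>z. H ((snd z, \<omega>), fst z)) \<in> measurable (restrict_space borel (UNIV \<times> {0..t})) K"
proof (rule measurable_compose[OF _ H], rule measurable_Pair)
  have [measurable]: "(fst :: 'e \<times> real \<Rightarrow> 'e) \<in> borel_measurable borel" "(snd :: 'e \<times> real \<Rightarrow> real) \<in> borel_measurable borel"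
    by (intro borel_measurable_continuous_onI continuous_intros)+
  show "(\<lambda>z. (snd z, \<omega>)) \<in> measurable (restrict_space (borel :: ('e \<times> real) measure) (UNIV \<times> {0..t})) pred"
    using \<omega> by (intro measurable_predI measurable_restrict_space1) (auto simp: space_restrict_space)
  show "fst \<in> measurable (restrict_space (borel :: ('e \<times> real) measure) (UNIV \<times> {0..t})) borel"
    by (intro measurable_restrict_space1) measurable
qed

lemma strip_borel [measurable, simp]: "(UNIV :: 'e set) \<times> {a..b::real} \<in> sets borel"
  by (intro borel_closed closed_Times) auto

lemma LINT_N_eq_jsum:
  fixes H :: "(real \<times> 'w) \<times> 'e \<Rightarrow> 'b::{banach, second_countable_topology}"
  assumes H: "H \<in> borel_measurable predE" and \<omega>: "\<omega> \<in> good"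
  shows "(LINT z:UNIV \<times> {0..t}|N \<omega>. H ((snd z, \<omega>), fst z)) = jsum t H \<omega>"
proof -
  have "(\<lambda>z. indicator (UNIV \<times> {0..t}) z *\<^sub>R H ((snd z, \<omega>), fst z)) \<in> borel_measurable borel"
    using section_measurable[OF H good_in_space[OF \<omega>], of t]
    by (subst (asm) borel_measurable_restrict_space_iff) auto
  from set_lebesgue_integral_N[OF \<omega> this] show ?thesis
    using \<omega> by (simp add: jsum_def)
qed

lemma nn_integral_N_eq_jsum:
  fixes H :: "(real \<times> 'w) \<times> 'e \<Rightarrow> ennreal"
  assumes H: "H \<in> borel_measurable predE" and \<omega>: "\<omega> \<in> good"
  shows "(\<integral>\<^sup>+z\<in>UNIV \<times> {0..t}. H ((snd z, \<omega>), fst z) \<partial>N \<omega>) = jsum t H \<omega>"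
proof -
  have "(\<lambda>z. H ((snd z, \<omega>), fst z) * indicator (UNIV \<times> {0..t}) z) \<in> borel_measurable borel"
    using section_measurable[OF H good_in_space[OF \<omega>], of t]
    by (subst (asm) borel_measurable_restrict_space_iff_ennreal) auto
  from set_nn_integral_N[OF \<omega> this] show ?thesis
    using \<omega> by (simp add: jsum_def)
qed

lemma compensator_adapted:
  "B \<in> sets borel \<Longrightarrow> 0 \<le> t \<Longrightarrow> (\<lambda>\<omega>. emeasure (N \<omega>) (B \<times> {0..t})) \<in> borel_measurable (F t)"
  using compensator by (auto simp: has_compensator_def adapted_def)

text \<open>The only place where adaptedness of \<open>N\<close>, contained in
  \<open>has_compensator\<close>, enters; the measurability of all other jump sums is built from
  these counts.\<close>

lemma jsum_mark_measurable:
  assumes C: "C \<in> sets borel" and t: "0 \<le> t"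
  shows "jsum t (\<lambda>(p, e). indicator C e :: real) \<in> borel_measurable (F t)"
proof -
  have "jsum t (\<lambda>(p, e). indicator C e :: real) \<omega> =
    indicator good \<omega> * enn2real (emeasure (N \<omega>) (C \<times> {0..t}))" for \<omega>
  proof (cases "\<omega> \<in> good")
    case True
    have CB: "C \<times> UNIV \<inter> UNIV \<times> {0..t} \<in> sets (borel :: ('e \<times> real) measure)"
      using C by (auto simp: borel_prod[symmetric] intro: pair_measureI)
    have CB': "C \<times> {0..t} = C \<times> UNIV \<inter> UNIV \<times> {0..t}" by auto
    have "emeasure (N \<omega>) (C \<times> {0..t}) = (\<integral>\<^sup>+z. indicator (C \<times> {0..t}) z \<partial>N \<omega>)"
      using CB CB' by (simp add: N_eq[OF good_in_space[OF True]])
    also have "\<dots> = (\<integral>\<^sup>+z\<in>UNIV \<times> {0..t}. indicator C (fst z) \<partial>N \<omega>)"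
      by (intro nn_integral_cong) (auto simp: indicator_def)
    also have "\<dots> = (\<Sum>n<cnt t \<omega>. indicator C (E n \<omega>))"
    proof (subst set_nn_integral_N[OF True])
      have "(\<lambda>z. indicator C (fst z) * indicator (UNIV \<times> {0..t}) z :: ennreal) = indicator (C \<times> UNIV \<inter> UNIV \<times> {0..t})"
        by (auto simp: indicator_def)
      then show "(\<lambda>z. indicator C (fst z) * indicator (UNIV \<times> {0..t}) z :: ennreal) \<in> borel_measurable borel"
        using CB by simp
    qed simp
    also have "\<dots> = ennreal (\<Sum>n<cnt t \<omega>. indicator C (E n \<omega>))"
      by (simp flip: sum_ennreal ennreal_indicator)
    finally show ?thesis using True by (simp add: jsum_def sum_nonneg)
  qed (simp add: jsum_def)
  moreover have "(\<lambda>\<omega>. indicator good \<omega> * enn2real (emeasure (N \<omega>) (C \<times> {0..t}))) \<in> borel_measurable (F t)"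
    using good_F[of t] compensator_adapted[OF C t] by measurable
  ultimately show ?thesis by (rule measurable_eqI)
qed

lemma cnt_mono: "\<omega> \<in> good \<Longrightarrow> s \<le> t \<Longrightarrow> cnt s \<omega> \<le> cnt t \<omega>"
proof -
  assume \<omega>: "\<omega> \<in> good" and "s \<le> t"
  then have "{n. T n \<omega> \<le> ereal s} \<subseteq> {n. T n \<omega> \<le> ereal t}"
    by (auto intro: order_trans[of _ "ereal s"])
  then show ?thesis unfolding jumps_before(1)[OF \<omega>] by simp
qed

lemma less_cnt_iff_\<tau>:
  assumes "\<omega> \<in> good" "n < cnt t \<omega>"
  shows "n < cnt s \<omega> \<longleftrightarrow> \<tau> n \<omega> \<le> s"
  unfolding less_cnt_iff[OF assms(1)]
  using ereal_\<tau>[OF good_in_space[OF assms(1)] less_cntD(1)[OF assms]] by (metis ereal_less_eq(3))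

text \<open>The jumps with time in \<open>{s<..u}\<close> up to \<open>t\<close> are those counted
  at \<open>min t u\<close> but not at \<open>s\<close>. The sum is thus an increment of a counting
  process times the indicator of \<open>B\<close>, both known at time \<open>t\<close> when
  \<open>s < t\<close>; otherwise nothing is counted.\<close>

lemma jsum_gen_measurable:
  assumes s: "0 \<le> s" "s < u" and B: "B \<in> sets (F s)" and C: "C \<in> sets borel" and t: "0 \<le> t"
  shows "jsum t (indicator (({s<..u} \<times> B) \<times> C) :: _ \<Rightarrow> real) \<in> borel_measurable (F t)"
proof (cases "s < t")
  case False
  have "\<not> s < \<tau> n \<omega>" if "\<omega> \<in> good" "n < cnt t \<omega>" for n \<omega>
    using False less_cntD(3)[OF that] by simp
  then have "jsum t (indicator (({s<..u} \<times> B) \<times> C) :: _ \<Rightarrow> real) = (\<lambda>\<omega>. 0)"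
    by (auto simp: jsum_def fun_eq_iff indicator_def intro!: sum.neutral)
  then show ?thesis by simp
next
  case True
  let ?m = "min t u" and ?K = "\<lambda>t. jsum t (\<lambda>(p, e). indicator C e :: real)"
  have "jsum t (indicator (({s<..u} \<times> B) \<times> C)) \<omega> = indicator B \<omega> * (?K ?m \<omega> - ?K s \<omega>)" for \<omega>
  proof (cases "\<omega> \<in> good")
    case \<omega>: True
    have le: "cnt s \<omega> \<le> cnt ?m \<omega>" "cnt ?m \<omega> \<le> cnt t \<omega>"
      using True s by (auto intro!: cnt_mono[OF \<omega>])
    have "?K ?m \<omega> - ?K s \<omega> = (\<Sum>n\<in>{..<cnt ?m \<omega>} - {..<cnt s \<omega>}. indicator C (E n \<omega>))"
      using \<omega> le by (subst sum_diff) (auto simp: jsum_def)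
    also have "\<dots> = (\<Sum>n<cnt t \<omega>. indicator {s<..u} (\<tau> n \<omega>) * indicator C (E n \<omega>))"
    proof (rule sum.mono_neutral_cong_left)
      show "{..<cnt ?m \<omega>} - {..<cnt s \<omega>} \<subseteq> {..<cnt t \<omega>}" using le by auto
      show "\<forall>n\<in>{..<cnt t \<omega>} - ({..<cnt ?m \<omega>} - {..<cnt s \<omega>}).
        indicator {s<..u} (\<tau> n \<omega>) * indicator C (E n \<omega>) = (0::real)"
      proof
        fix n assume "n \<in> {..<cnt t \<omega>} - ({..<cnt ?m \<omega>} - {..<cnt s \<omega>})"
        then show "indicator {s<..u} (\<tau> n \<omega>) * indicator C (E n \<omega>) = (0::real)"
          using less_cnt_iff_\<tau>[OF \<omega>, of n t s] less_cnt_iff_\<tau>[OF \<omega>, of n t ?m] less_cntD(3)[OF \<omega>, of n t]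
          by (auto simp: indicator_def)
      qed
      fix n assume n: "n \<in> {..<cnt ?m \<omega>} - {..<cnt s \<omega>}"
      then have "n < cnt t \<omega>" using le by auto
      with n show "indicator C (E n \<omega>) = indicator {s<..u} (\<tau> n \<omega>) * (indicator C (E n \<omega>) :: real)"
        using less_cnt_iff_\<tau>[OF \<omega>, of n t s] less_cnt_iff_\<tau>[OF \<omega>, of n t ?m] by (auto simp: indicator_def)
    qed simp
    finally have "?K ?m \<omega> - ?K s \<omega> = (\<Sum>n<cnt t \<omega>. indicator {s<..u} (\<tau> n \<omega>) * indicator C (E n \<omega>))" .
    note eq = this
    show ?thesis
      unfolding eq using \<omega> by (cases "\<omega> \<in> B") (simp_all add: jsum_def indicator_times)
  qed (simp add: jsum_def)
  moreover have "B \<in> sets (F t)" using sets_F_mono[of s t] True B by auto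
  moreover have "?K s \<in> borel_measurable (F t)"
    using True by (intro measurable_F_mono[OF _ jsum_mark_measurable] C s) auto
  moreover have "?K ?m \<in> borel_measurable (F t)"
    using s t by (intro measurable_F_mono[OF _ jsum_mark_measurable] C) auto
  ultimately show ?thesis by (intro measurable_eqI[of "jsum t _"]) (assumption, simp)
qed

lemma jsum_add: "jsum t (\<lambda>p. H p + G p) \<omega> = jsum t H \<omega> + jsum t G \<omega>"
  by (simp add: jsum_def sum.distrib)

lemma jsum_diff:
  fixes H G :: "_ \<Rightarrow> 'b::real_vector"
  shows "jsum t (\<lambda>p. H p - G p) \<omega> = jsum t H \<omega> - jsum t G \<omega>"
  by (simp add: jsum_def sum_subtractf)

lemma jsum_cong:
  assumes "\<And>p. p \<in> space predE \<Longrightarrow> H p = G p"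
  shows "jsum t H \<omega> = jsum t G \<omega>"
  unfolding jsum_def by (auto intro!: sum.cong assms[OF jump_in_space])

text \<open>A pi-lambda argument over rectangles of predictable generators and Borel sets of marks.
  Generators at time 0 contribute nothing, because no jump occurs there.\<close>

lemma jsum_indicator_measurable:
  assumes t: "0 \<le> t" and A: "A \<in> sets predE"
  shows "jsum t (indicator A :: _ \<Rightarrow> real) \<in> borel_measurable (F t)"
proof -
  let ?G = "{{0} \<times> B | B. B \<in> sets (F 0)} \<union> {{s<..t} \<times> B | s t B. 0 \<le> s \<and> s < t \<and> B \<in> sets (F s)}"
  let ?GG = "{a \<times> b | a b. a \<in> ?G \<and> b \<in> sets (borel :: 'e measure)}"
  let ?\<Omega> = "space pred \<times> (UNIV :: 'e set)"
  have sets_eq: "sets predE = sets (sigma ?\<Omega> ?GG)"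
  proof -
    \<comment> \<open>A countable family of generators that covers the space, as required for
      rectangles to generate the product sigma-algebra.\<close>
    let ?C = "insert ({0} \<times> space M) (range (\<lambda>k::nat. {real k<..real k + 1} \<times> space M))"
    have "sets predE = sets (sigma (space pred \<times> space (borel :: 'e measure)) ?GG)"
    proof (rule sets_pair_eq[where Ca = ?C and Cb = "{UNIV}"])
      show "?G \<subseteq> Pow (space pred)" using pred_gen_sub by simp
      show "sets pred = sigma_sets (space pred) ?G" using sets_pred by simp
      have top: "space M \<in> sets (F t)" for t using sets.top[of "F t"] by simp
      show "?C \<subseteq> ?G"
      proof (rule subsetI)
        fix x assume "x \<in> ?C"
        then consider "x = {0} \<times> space M" | k :: nat where "x = {real k<..real k + 1} \<times> space M" by blast
        then show "x \<in> ?G"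
        proof cases
          case 1
          with top show ?thesis by (intro UnI1 CollectI exI[of _ "space M"]) simp
        next
          case (2 k)
          with top show ?thesis
            by (intro UnI2 CollectI exI[of _ "real k"] exI[of _ "real k + 1"] exI[of _ "space M"]) simp
        qed
      qed
      show "\<Union>?C = space pred"
      proof (intro equalityI subsetI)
        fix p assume p: "p \<in> space pred"
        then obtain t \<omega> where [simp]: "p = (t, \<omega>)" and t: "0 \<le> t" "\<omega> \<in> space M" by auto
        show "p \<in> \<Union>?C"
        proof (cases "t = 0")
          case False
          with t have "1 \<le> \<lceil>t\<rceil>" by linarith
          then have n: "int (nat \<lceil>t\<rceil> - 1) = \<lceil>t\<rceil> - 1" by linarith
          then have "real (nat \<lceil>t\<rceil> - 1) = of_int \<lceil>t\<rceil> - 1" by (metis of_int_diff of_int_1 of_int_of_nat_eq)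
          then have "t \<in> {real (nat \<lceil>t\<rceil> - 1)<..real (nat \<lceil>t\<rceil> - 1) + 1}"
            unfolding greaterThanAtMost_iff by linarith
          with t(2) have "p \<in> {real (nat \<lceil>t\<rceil> - 1)<..real (nat \<lceil>t\<rceil> - 1) + 1} \<times> space M" by simp
          then show ?thesis by (intro UnionI[OF insertI2[OF rangeI]])
        qed (use t in simp)
      qed auto
    qed (auto simp: sets.sigma_sets_eq[of borel, simplified])
    then show ?thesis by simp
  qed
  have sub: "?GG \<subseteq> Pow ?\<Omega>"
  proof
    fix x assume "x \<in> ?GG"
    then obtain a b where x: "x = a \<times> b" "a \<in> ?G" by blast
    from subsetD[OF pred_gen_sub x(2)] show "x \<in> Pow ?\<Omega>" unfolding x by auto
  qed
  have "Int_stable ?G"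
  proof (rule Int_stableI)
    fix a b assume a: "a \<in> ?G" and b: "b \<in> ?G"
    have e: "{} \<in> ?G" by (auto intro!: exI[of _ "{}"])
    consider B B' where "a = {0} \<times> B" "b = {0} \<times> B'" "B \<inter> B' \<in> sets (F 0)" | "a \<inter> b = {}"
      | s u B s' u' B' where "a = {s<..u} \<times> B" "b = {s'<..u'} \<times> B'" "0 \<le> s" "B \<in> sets (F s)" "B' \<in> sets (F s')"
      using a b by fastforce
    then show "a \<inter> b \<in> ?G"
    proof cases
      case (1 B B')
      then have "a \<inter> b = {0} \<times> (B \<inter> B')" by auto
      with 1(3) show ?thesis by blast
    next
      case 2
      with e show ?thesis by simp
    next
      case (3 s u B s' u' B')
      have ab: "a \<inter> b = {max s s'<..min u u'} \<times> (B \<inter> B')" using 3 by auto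
      show ?thesis
      proof (cases "max s s' < min u u'")
        case True
        have "B \<inter> B' \<in> sets (F (max s s'))"
          using 3(4,5) sets_F_mono[of s "max s s'"] sets_F_mono[of s' "max s s'"] by auto
        with True 3(3) ab show ?thesis
          by (intro UnI2 CollectI exI[of _ "max s s'"] exI[of _ "min u u'"] exI[of _ "B \<inter> B'"]) auto
      next
        case False
        then have "a \<inter> b = {}" unfolding ab by simp
        with e show ?thesis by simp
      qed
    qed
  qed
  then have st: "Int_stable ?GG"
    by (rule Int_stable_Times) (auto simp: Int_stable_def)
  have A': "A \<in> sigma_sets ?\<Omega> ?GG" using A sets_eq sub by simp
  let ?I = "\<lambda>A. indicator A :: (real \<times> 'w) \<times> 'e \<Rightarrow> real"
  have gen: "jsum t (?I a) \<in> borel_measurable (F t)" if "a \<in> ?GG" for a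
  proof -
    from that obtain a1 C where a: "a = a1 \<times> C" "a1 \<in> ?G" "C \<in> sets borel" by blast
    from a(2) show ?thesis
    proof
      assume "a1 \<in> {{0} \<times> B | B. B \<in> sets (F 0)}"
      then have "((\<tau> n \<omega>, \<omega>), E n \<omega>) \<notin> a" if "\<omega> \<in> good" "n < cnt t \<omega>" for n \<omega>
        using a(1) less_cntD(2)[OF that] by auto
      then have "jsum t (?I a) = (\<lambda>\<omega>. 0)"
        by (simp add: jsum_def fun_eq_iff)
      then show ?thesis by simp
    next
      assume "a1 \<in> {{s<..t} \<times> B | s t B. 0 \<le> s \<and> s < t \<and> B \<in> sets (F s)}"
      then show ?thesis using a jsum_gen_measurable[OF _ _ _ a(3) t] by blast
    qed
  qed
  have one: "jsum t (?I ?\<Omega>) \<in> borel_measurable (F t)"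
  proof -
    have "jsum t (?I ?\<Omega>) \<omega> = jsum t (\<lambda>(p, e). indicator UNIV e) \<omega>" for \<omega>
      by (rule jsum_cong) (auto simp: space_pair_measure)
    then show ?thesis by (rule measurable_eqI) (intro jsum_mark_measurable t, simp)
  qed
  show ?thesis
    using st sub A'
  proof (induction rule: sigma_sets_induct_disjoint)
    case (basic A) then show ?case by (rule gen)
  next
    case empty
    have "jsum t (?I {}) = (\<lambda>\<omega>. 0)" by (simp add: jsum_def fun_eq_iff)
    then show ?case by (simp only: borel_measurable_const)
  next
    case (compl A)
    have "jsum t (?I (?\<Omega> - A)) \<omega> = jsum t (?I ?\<Omega>) \<omega> - jsum t (?I A) \<omega>" for \<omega>
      unfolding jsum_diff[symmetric] using sigma_sets_into_sp[OF sub compl.hyps]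
      by (intro jsum_cong) (auto simp: indicator_def)
    then show ?case by (rule measurable_eqI) (intro borel_measurable_diff one compl.IH)
  next
    case (union A)
    \<comment> \<open>Disjointness turns the indicator of the union into a series, which passes
      through the finite jump sum.\<close>
    have "(\<lambda>i. jsum t (?I (A i)) \<omega>) sums jsum t (?I (\<Union>i. A i)) \<omega>" for \<omega>
      unfolding jsum_def using union.hyps(1)
      by (auto intro!: sums_sum indicator_sums simp: disjoint_family_on_def)
    then have "jsum t (?I (\<Union>i. A i)) \<omega> = (\<Sum>i. jsum t (?I (A i)) \<omega>)" for \<omega>
      by (simp add: sums_iff)
    then show ?case by (rule measurable_eqI) (intro borel_measurable_suminf union.IH)
  qed
qed

lemma jsum_nonneg_measurable:
  fixes H :: "(real \<times> 'w) \<times> 'e \<Rightarrow> real"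
  assumes t: "0 \<le> t" and H: "H \<in> borel_measurable predE" "\<And>p. 0 \<le> H p"
  shows "jsum t H \<in> borel_measurable (F t)"
  using H
proof (induction rule: borel_measurable_induct_real)
  case (set A) then show ?case by (rule jsum_indicator_measurable[OF t])
next
  case (mult u c)
  have "jsum t (\<lambda>x. c * u x) = (\<lambda>\<omega>. c * jsum t u \<omega>)"
    by (auto simp: jsum_def sum_distrib_left)
  with mult show ?case by simp
next
  case (add u v)
  then show ?case by (simp add: jsum_add[abs_def])
next
  case (seq U)
  have "(\<lambda>i. jsum t (U i) \<omega>) \<longlonglongrightarrow> jsum t u \<omega>" if "\<And>p. p \<in> space predE \<Longrightarrow> (\<lambda>i. U i p) \<longlonglongrightarrow> u p" for \<omega> u
    unfolding jsum_def by (auto intro!: tendsto_sum that[OF jump_in_space])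
  note lim = this
  show ?case
  proof (rule borel_measurable_LIMSEQ_real)
    show "(\<lambda>i. jsum t (U i) \<omega>) \<longlonglongrightarrow> jsum t H \<omega>" for \<omega>
      by (rule lim) (rule seq.hyps)
  qed (rule seq.IH)
qed

lemma jsum_measurable:
  fixes H :: "(real \<times> 'w) \<times> 'e \<Rightarrow> 'x::euclidean_space"
  assumes t: "0 \<le> t" and H: "H \<in> borel_measurable predE"
  shows "jsum t H \<in> borel_measurable (F t)"
  unfolding borel_measurable_euclidean_space[of "jsum t H"]
proof
  fix i :: 'x assume "i \<in> Basis"
  have max: "max 0 a - max 0 (- a) = a" for a :: real by simp
  have Hi: "(\<lambda>p. H p \<bullet> i) \<in> borel_measurable predE"
    by (rule borel_measurable_inner[OF H borel_measurable_const])
  have pos: "(\<lambda>p. max 0 (H p \<bullet> i)) \<in> borel_measurable predE"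
    by (intro borel_measurable_max borel_measurable_const Hi)
  have neg: "(\<lambda>p. max 0 (- (H p \<bullet> i))) \<in> borel_measurable predE"
    by (intro borel_measurable_max borel_measurable_const borel_measurable_uminus Hi)
  have "jsum t H \<omega> \<bullet> i = jsum t (\<lambda>p. max 0 (H p \<bullet> i)) \<omega> - jsum t (\<lambda>p. max 0 (- (H p \<bullet> i))) \<omega>" for \<omega>
    unfolding jsum_diff[symmetric] max by (simp add: jsum_def inner_sum_left)
  then show "(\<lambda>\<omega>. jsum t H \<omega> \<bullet> i) \<in> borel_measurable (F t)"
    by (rule measurable_eqI)
      (rule borel_measurable_diff[OF jsum_nonneg_measurable[OF t pos] jsum_nonneg_measurable[OF t neg]]; simp)
qed

end

section \<open>Jump equations\<close>

context marked_jumps begin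

text \<open>The value \<open>c\<close> off \<open>good\<close> will be the initial state, so that
  the equation written with \<open>jsum\<close> holds there as well.\<close>

definition step_process :: "(nat \<Rightarrow> 'w \<Rightarrow> 'x) \<Rightarrow> 'x \<Rightarrow> real \<Rightarrow> 'w \<Rightarrow> 'x" where
  "step_process y c t \<omega> = (if \<omega> \<in> good then y (cnt t \<omega>) \<omega> else c)"

lemma cadlag_step_process:
  fixes y :: "nat \<Rightarrow> 'w \<Rightarrow> 'x::t2_space"
  shows "cadlag_paths M (step_process y c)"
  unfolding cadlag_paths_def
proof (intro ballI conjI allI impI)
  fix \<omega> t assume "\<omega> \<in> space M"
  have X: "step_process y c s \<omega> = (\<lambda>n. y n \<omega>) (cnt s \<omega>)" if "\<omega> \<in> good" for s
    using that by (simp add: step_process_def)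
  show "((\<lambda>s. step_process y c s \<omega>) \<longlongrightarrow> step_process y c t \<omega>) (at_right t)" if "0 \<le> t"
  proof (cases "\<omega> \<in> good")
    case True
    show ?thesis by (rule step_path(1)[where X = "step_process y c" and y = "\<lambda>n. y n \<omega>", OF True X[OF True] that])
  qed (simp add: step_process_def)
  show "\<exists>l. ((\<lambda>s. step_process y c s \<omega>) \<longlongrightarrow> l) (at_left t)" if "0 < t"
  proof (cases "\<omega> \<in> good")
    case True
    show ?thesis by (rule exI, rule step_path(2)[where X = "step_process y c" and y = "\<lambda>n. y n \<omega>", OF True X[OF True] that])
  qed (auto simp: step_process_def)
qed

lemma left_lim_step_process:
  fixes y :: "nat \<Rightarrow> 'w \<Rightarrow> 'x::t2_space"
  assumes "\<omega> \<in> good" "n < cnt t \<omega>"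
  shows "left_lim (step_process y c) (\<tau> n \<omega>) \<omega> = y n \<omega>"
  using assms by (intro step_path(3)[OF assms(1) _ less_cntD(1)[OF assms]]) (simp add: step_process_def)

text \<open>The coefficient depends on time and scenario as well as on the state, which covers
  prescribed controls and feedback by one construction.\<close>

abbreviation coeff_measurable :: "(real \<times> 'w \<Rightarrow> 'x \<Rightarrow> 'e \<Rightarrow> 'x::euclidean_space) \<Rightarrow> bool" where
  "coeff_measurable \<beta> \<equiv> (\<lambda>((p, y), e). \<beta> p y e) \<in> borel_measurable ((pred \<Otimes>\<^sub>M borel) \<Otimes>\<^sub>M borel)"

lemma coeff_at_measurable:
  fixes \<beta> :: "real \<times> 'w \<Rightarrow> 'x \<Rightarrow> 'e \<Rightarrow> 'x::euclidean_space"
  assumes \<beta>: "coeff_measurable \<beta>"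
    and L: "L \<in> borel_measurable pred"
  shows "(\<lambda>(p, e). \<beta> p (L p) e) \<in> borel_measurable predE"
proof -
  have "(\<lambda>q. ((fst q, L (fst q)), snd q)) \<in> measurable predE ((pred \<Otimes>\<^sub>M borel) \<Otimes>\<^sub>M (borel :: 'e measure))"
    by (intro measurable_Pair measurable_fst measurable_snd measurable_compose[OF measurable_fst L])
  from measurable_compose[OF this \<beta>] show ?thesis by (simp add: case_prod_beta)
qed

text \<open>The state after \<open>n\<close> jumps, defined for all \<open>n\<close>. Jumps at
  infinite time enter with the default of \<open>real_of_ereal\<close>, but only indices below
  \<open>cnt t\<close> are ever read off.\<close>

primrec chain :: "(real \<times> 'w \<Rightarrow> 'x \<Rightarrow> 'e \<Rightarrow> 'x) \<Rightarrow> 'x \<Rightarrow> nat \<Rightarrow> 'w \<Rightarrow> 'x::euclidean_space" where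
  "chain \<beta> x 0 \<omega> = x"
| "chain \<beta> x (Suc n) \<omega> = chain \<beta> x n \<omega> + \<beta> (\<tau> n \<omega>, \<omega>) (chain \<beta> x n \<omega>) (E n \<omega>)"

text \<open>Picard iterates: they become stationary after finitely many steps on every bounded time interval.\<close>

primrec picard :: "(real \<times> 'w \<Rightarrow> 'x \<Rightarrow> 'e \<Rightarrow> 'x) \<Rightarrow> 'x \<Rightarrow> nat \<Rightarrow> nat \<Rightarrow> 'w \<Rightarrow> 'x::euclidean_space" where
  "picard \<beta> x 0 n \<omega> = x"
| "picard \<beta> x (Suc k) n \<omega> = x + (\<Sum>j<n. \<beta> (\<tau> j \<omega>, \<omega>) (picard \<beta> x k j \<omega>) (E j \<omega>))"

lemma chain_eq_sum: "chain \<beta> x n \<omega> = x + (\<Sum>j<n. \<beta> (\<tau> j \<omega>, \<omega>) (chain \<beta> x j \<omega>) (E j \<omega>))"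
  by (induction n) (simp_all add: add.assoc)

text \<open>The state after \<open>n\<close> jumps depends on the states before earlier jumps only,
  so each iteration makes one further jump correct.\<close>

lemma picard_eq_chain: "n \<le> k \<Longrightarrow> picard \<beta> x k n \<omega> = chain \<beta> x n \<omega>"
proof (induction k arbitrary: n)
  case (Suc k)
  then have "(\<Sum>j<n. \<beta> (\<tau> j \<omega>, \<omega>) (picard \<beta> x k j \<omega>) (E j \<omega>)) = (\<Sum>j<n. \<beta> (\<tau> j \<omega>, \<omega>) (chain \<beta> x j \<omega>) (E j \<omega>))"
    by (intro sum.cong) auto
  then show ?case by (simp add: chain_eq_sum[of \<beta> x n])
qed simp

text \<open>One Picard step as a jump integral: the left limits of the process built from
  \<open>y\<close> are the values of \<open>y\<close> needed by the sum.\<close>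

lemma step_process_sum:
  fixes y z :: "nat \<Rightarrow> 'w \<Rightarrow> 'x::euclidean_space"
  assumes "\<And>n \<omega>. z n \<omega> = x + (\<Sum>j<n. \<beta> (\<tau> j \<omega>, \<omega>) (y j \<omega>) (E j \<omega>))"
  shows "step_process z x t \<omega> = x + jsum t (\<lambda>(p, e). \<beta> p ((\<lambda>(s, \<omega>). left_lim (step_process y x) s \<omega>) p) e) \<omega>"
proof (cases "\<omega> \<in> good")
  case True
  then show ?thesis
    by (simp add: step_process_def[of z] jsum_def assms left_lim_step_process[OF True, where t = t])
qed (simp add: step_process_def jsum_def)

text \<open>An adapted cadlag iterate has predictable left limits, and the jump integral of a
  predictable integrand is adapted again.\<close>

lemma picard_adapted:
  assumes \<beta>: "coeff_measurable \<beta>"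
  shows "adapted F (step_process (picard \<beta> x k) x)"
proof (induction k)
  case 0
  have "step_process (picard \<beta> x 0) x = (\<lambda>t \<omega>. x)" by (simp add: step_process_def fun_eq_iff)
  then show ?case unfolding adapted_def by (simp only: borel_measurable_const simp_thms)
next
  case (Suc k)
  let ?H = "\<lambda>(p, e). \<beta> p ((\<lambda>(s, \<omega>). left_lim (step_process (picard \<beta> x k) x) s \<omega>) p) e"
  have "?H \<in> borel_measurable predE"
    by (rule coeff_at_measurable[OF \<beta> left_lim_predictable[OF Suc.IH cadlag_step_process]])
  then have m: "(\<lambda>\<omega>. x + jsum t ?H \<omega>) \<in> borel_measurable (F t)" if "0 \<le> t" for t
    using that by (intro borel_measurable_add borel_measurable_const jsum_measurable)
  show ?case
    unfolding adapted_def
  proof (intro allI impI, rule measurable_eqI)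
    show "step_process (picard \<beta> x (Suc k)) x t \<omega> = x + jsum t ?H \<omega>" for t \<omega>
      by (rule step_process_sum) simp
  qed (rule m)
qed

definition solution :: "(real \<times> 'w \<Rightarrow> 'x \<Rightarrow> 'e \<Rightarrow> 'x) \<Rightarrow> 'x \<Rightarrow> real \<Rightarrow> 'w \<Rightarrow> 'x::euclidean_space" where
  "solution \<beta> x = step_process (chain \<beta> x) x"

text \<open>At a fixed time and scenario the Picard iterates equal the solution from iterate
  \<open>cnt t \<omega>\<close> on, so it is a pointwise limit of adapted processes.\<close>

lemma solution_adapted:
  assumes \<beta>: "coeff_measurable \<beta>"
  shows "adapted F (solution \<beta> x)"
  unfolding adapted_def
proof (intro allI impI)
  fix t :: real assume t: "0 \<le> t"
  show "solution \<beta> x t \<in> borel_measurable (F t)"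
  proof (rule borel_measurable_LIMSEQ_metric)
    show "step_process (picard \<beta> x k) x t \<in> borel_measurable (F t)" for k
      using picard_adapted[OF \<beta>] t by (simp add: adapted_def)
    show "(\<lambda>k. step_process (picard \<beta> x k) x t \<omega>) \<longlonglongrightarrow> solution \<beta> x t \<omega>" for \<omega>
      by (rule tendsto_eventually, rule eventually_sequentiallyI[of "cnt t \<omega>"])
        (simp add: step_process_def solution_def picard_eq_chain)
  qed
qed

lemma cadlag_solution: "cadlag_paths M (solution \<beta> x)"
  unfolding solution_def by (rule cadlag_step_process)

lemma solution_integral:
  assumes \<beta>: "coeff_measurable \<beta>"
    and \<omega>: "\<omega> \<in> good"
  shows "solution \<beta> x t \<omega> = x + (LINT z:UNIV \<times> {0..t}|N \<omega>. \<beta> (snd z, \<omega>) (left_lim (solution \<beta> x) (snd z) \<omega>) (fst z))"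
proof -
  let ?H = "\<lambda>(p, e). \<beta> p ((\<lambda>(s, \<omega>). left_lim (solution \<beta> x) s \<omega>) p) e"
  have "?H \<in> borel_measurable predE"
    by (rule coeff_at_measurable[OF \<beta> left_lim_predictable[OF solution_adapted[OF \<beta>] cadlag_solution]])
  from LINT_N_eq_jsum[OF this \<omega>, of t] show ?thesis
    using step_process_sum[where y = "chain \<beta> x" and z = "chain \<beta> x", OF chain_eq_sum, of t \<omega>] by (simp add: solution_def)
qed

text \<open>The equation makes any solution a function \<open>c\<close> of the jump count. Its left
  limit at jump \<open>n\<close> is then \<open>c n\<close>, so \<open>c\<close> obeys the recursion
  of \<open>chain\<close>.\<close>

lemma solution_unique:
  fixes X :: "real \<Rightarrow> 'w \<Rightarrow> 'x::euclidean_space"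
  assumes \<beta>: "coeff_measurable \<beta>"
    and X: "adapted F X" "cadlag_paths M X"
    and eq: "\<And>t. 0 \<le> t \<Longrightarrow> X t \<omega> = x + (LINT z:UNIV \<times> {0..t}|N \<omega>. \<beta> (snd z, \<omega>) (left_lim X (snd z) \<omega>) (fst z))"
    and \<omega>: "\<omega> \<in> good" and t: "0 \<le> t"
  shows "X t \<omega> = chain \<beta> x (cnt t \<omega>) \<omega>" "n < cnt t \<omega> \<Longrightarrow> left_lim X (\<tau> n \<omega>) \<omega> = chain \<beta> x n \<omega>"
proof -
  let ?H = "\<lambda>(p, e). \<beta> p ((\<lambda>(s, \<omega>). left_lim X s \<omega>) p) e"
  have "?H \<in> borel_measurable predE"
    by (rule coeff_at_measurable[OF \<beta> left_lim_predictable[OF X]])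
  from LINT_N_eq_jsum[OF this \<omega>] eq have X_eq: "X s \<omega> = x + jsum s ?H \<omega>" if "0 \<le> s" for s
    using that by simp
  define c where "c n = x + (\<Sum>j<n. \<beta> (\<tau> j \<omega>, \<omega>) (left_lim X (\<tau> j \<omega>) \<omega>) (E j \<omega>))" for n
  have Xc: "X s \<omega> = c (cnt s \<omega>)" if "0 \<le> s" for s
    using X_eq[OF that] \<omega> by (simp add: c_def jsum_def)
  have ll: "left_lim X (\<tau> n \<omega>) \<omega> = c n" if "n < cnt t \<omega>" for n
    by (rule step_path(3)[where X = X and y = c, OF \<omega> Xc less_cntD(1)[OF \<omega> that]])
  have c_chain: "c n = chain \<beta> x n \<omega>" if "n \<le> cnt t \<omega>" for n
    using that
  proof (induction n)
    case (Suc n)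
    have "c (Suc n) = c n + \<beta> (\<tau> n \<omega>, \<omega>) (left_lim X (\<tau> n \<omega>) \<omega>) (E n \<omega>)"
      by (simp add: c_def add.assoc)
    with Suc ll[of n] show ?case by simp
  qed (simp add: c_def)
  show "X t \<omega> = chain \<beta> x (cnt t \<omega>) \<omega>" using Xc[OF t] c_chain by simp
  show "left_lim X (\<tau> n \<omega>) \<omega> = chain \<beta> x n \<omega>" if "n < cnt t \<omega>" using ll[OF that] c_chain that by simp
qed

end

section \<open>Dynkin formula and long-run averages\<close>

text \<open>Fatou's lemma, in the form that removes the truncation of the Lyapunov function.\<close>

lemma nn_integral_le_of_tendsto:
  fixes u :: "nat \<Rightarrow> 'a \<Rightarrow> real"
  assumes i: "\<And>n. integrable R (u n)" and nn: "\<And>n p. 0 \<le> u n p"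
    and lim: "\<And>p. (\<lambda>n. u n p) \<longlonglongrightarrow> v p" and le: "\<And>n. (\<integral>p. u n p \<partial>R) \<le> B"
  shows "(\<integral>\<^sup>+p. ennreal (v p) \<partial>R) \<le> ennreal B"
proof -
  have "ennreal (v p) = liminf (\<lambda>n. ennreal (u n p))" for p
    by (rule lim_imp_Liminf[symmetric]) (auto intro: tendsto_ennrealI lim)
  then have "(\<integral>\<^sup>+p. ennreal (v p) \<partial>R) \<le> liminf (\<lambda>n. \<integral>\<^sup>+p. ennreal (u n p) \<partial>R)"
    using i by (simp add: nn_integral_liminf)
  also have "\<dots> \<le> ennreal B"
    using i nn le by (intro Liminf_le always_eventually allI) (simp_all add: nn_integral_eq_integral ennreal_leI)
  finally show ?thesis .
qed

section \<open>Expectations of jump sums\<close>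

context marked_jumps begin

text \<open>Time itself is predictable; this allows the compensator identity, given on the whole
  half-line, to be cut at a horizon inside the integrand.\<close>

lemma fst_predictable: "fst \<in> borel_measurable pred"
  unfolding borel_measurable_iff_le
proof
  fix a :: real
  have top: "space M \<in> sets (F t)" for t using sets.top[of "F t"] by simp
  show "{p \<in> space pred. fst p \<le> a} \<in> sets pred"
  proof (cases "0 < a")
    case True
    have "{p \<in> space pred. fst p \<le> a} = {0} \<times> space M \<union> {0<..a} \<times> space M" using True by auto
    then show ?thesis using True by (simp only:) (intro sets.Un pred_gen0 pred_gen top order_refl)
  next
    case False
    then have "{p \<in> space pred. fst p \<le> a} = (if a < 0 then {} else {0} \<times> space M)" by auto
    then show ?thesis using pred_gen0[OF top] by simp
  qed
qed

text \<open>Lebesgue measure on the time interval times the probability, of total mass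
  \<open>t\<close> for nonnegative \<open>t\<close>. With the marks added, \<eta> times
  \<open>LamE\<close> is the measure that replaces \<open>N\<close> in expectations.\<close>

abbreviation Lam :: "real \<Rightarrow> (real \<times> 'w) measure" where
  "Lam t \<equiv> restrict_space lborel {0..t} \<Otimes>\<^sub>M M"

abbreviation LamE :: "real \<Rightarrow> ((real \<times> 'w) \<times> 'e) measure" where
  "LamE t \<equiv> Lam t \<Otimes>\<^sub>M \<nu>"

lemma finite_Leb: "finite_measure (restrict_space lborel {0..t::real})"
  by (intro finite_measureI) (simp add: space_restrict_space emeasure_restrict_space emeasure_lborel_Icc_eq)

lemma pair_sigma_finite_Lam: "pair_sigma_finite (restrict_space lborel {0..t::real}) M"
proof -
  interpret L: finite_measure "restrict_space lborel {0..t::real}" by (rule finite_Leb)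
  show ?thesis by unfold_locales
qed

lemma finite_Lam: "finite_measure (Lam t)"
  by (rule finite_measure_pair_measure[OF _ finite_Leb]) unfold_locales

lemma finite_LamE: "finite_measure (LamE t)"
  by (rule finite_measure_pair_measure[OF _ finite_Lam]) unfold_locales

lemma space_Lam [simp]: "space (Lam t) = {0..t} \<times> space M"
  by (simp add: space_pair_measure space_restrict_space)

lemma measure_Lam: "0 \<le> t \<Longrightarrow> measure (Lam t) ({0..t} \<times> space M) = t"
proof -
  assume t: "0 \<le> t"
  have "emeasure (Lam t) ({0..t} \<times> space M) = emeasure (restrict_space lborel {0..t}) {0..t} * emeasure M (space M)"
    by (intro emeasure_pair_measure_Times) (auto simp: sets_restrict_space)
  also have "\<dots> = ennreal t" using t by (simp add: emeasure_restrict_space emeasure_space_1)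
  finally show ?thesis using t by (simp add: measure_def)
qed

lemma measurable_pred_Lam: "f \<in> measurable pred K \<Longrightarrow> f \<in> measurable (Lam t) K"
proof -
  have "(\<lambda>p. p) \<in> measurable (Lam t) pred"
  proof (rule measurable_predI)
    have "(\<lambda>p. (fst p, snd p)) \<in> measurable (Lam t) (borel \<Otimes>\<^sub>M M)"
      by (intro measurable_Pair measurable_snd measurable_compose[OF measurable_fst]
          measurable_restrict_space1) simp
    then show "(\<lambda>p. p) \<in> measurable (Lam t) (borel \<Otimes>\<^sub>M M)" by simp
  qed auto
  then show "f \<in> measurable pred K \<Longrightarrow> f \<in> measurable (Lam t) K" by (rule measurable_compose)
qed

lemma measurable_pred_LamE:
  assumes "H \<in> measurable predE K"
  shows "H \<in> measurable (LamE t) K"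
proof -
  have "(\<lambda>q. (fst q, snd q)) \<in> measurable (LamE t) predE"
  proof (rule measurable_Pair)
    show "fst \<in> measurable (LamE t) pred"
      by (rule measurable_compose[OF measurable_fst measurable_pred_Lam]) simp
    have "snd \<in> measurable (LamE t) \<nu>" by (rule measurable_snd)
    then show "snd \<in> measurable (LamE t) borel" by (simp cong: measurable_cong_sets add: sets_\<nu>)
  qed
  from measurable_compose[OF this assms] show ?thesis by simp
qed

text \<open>On \<open>good\<close> the integral along \<open>N\<close> is a jump sum; on the side of
  the compensator, Tonelli's theorem rearranges mark, time and scenario into
  \<open>LamE\<close>.\<close>

lemma nn_integral_compensator:
  fixes H :: "(real \<times> 'w) \<times> 'e \<Rightarrow> ennreal"
  assumes H: "H \<in> borel_measurable predE"
  shows "(\<integral>\<^sup>+\<omega>. jsum t H \<omega> \<partial>M) = ennreal \<eta> * (\<integral>\<^sup>+q. H q \<partial>(LamE t))"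
proof -
  interpret PL: pair_sigma_finite "restrict_space lborel {0..t}" M by (rule pair_sigma_finite_Lam)
  interpret PK: pair_sigma_finite \<nu> "lborel :: real measure" ..
  let ?H = "\<lambda>q. H q * indicator {0..t} (fst (fst q))"
  have fst_pred: "(\<lambda>q. fst (fst q)) \<in> borel_measurable predE"
    using fst_predictable
    by (rule measurable_compose[OF measurable_fst])
  have H': "?H \<in> borel_measurable predE"
    by (intro borel_measurable_times_ennreal H measurable_compose[OF fst_pred borel_measurable_indicator]) simp
  have strip: "a * indicator {0..t} (snd z) * indicator (UNIV \<times> {0..}) z = a * indicator (UNIV \<times> {0..t}) z"
    for a :: ennreal and z :: "'e \<times> real"
    by (auto simp: indicator_def split: if_splits)
  have "(\<integral>\<^sup>+\<omega>. jsum t H \<omega> \<partial>M) = (\<integral>\<^sup>+\<omega>. (\<integral>\<^sup>+z\<in>UNIV \<times> {0..t}. H ((snd z, \<omega>), fst z) \<partial>N \<omega>) \<partial>M)"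
    using AE_good by (intro nn_integral_cong_AE) (auto simp: nn_integral_N_eq_jsum[OF H])
  also have "\<dots> = (\<integral>\<^sup>+\<omega>. (\<integral>\<^sup>+z\<in>UNIV \<times> {0..}. ?H ((snd z, \<omega>), fst z) \<partial>N \<omega>) \<partial>M)"
    by (rule nn_integral_cong) (simp only: fst_conv strip)
  also have "\<dots> = (\<integral>\<^sup>+\<omega>. (\<integral>\<^sup>+z\<in>UNIV \<times> {0..}. ?H ((snd z, \<omega>), fst z) \<partial>scale_measure (ennreal \<eta>) (\<nu> \<Otimes>\<^sub>M lborel)) \<partial>M)"
    by (rule bspec[OF conjunct2[OF compensator[unfolded has_compensator_def]] H'])
  also have "\<dots> = (\<integral>\<^sup>+\<omega>. ennreal \<eta> * (\<integral>\<^sup>+s. (\<integral>\<^sup>+e. H ((s, \<omega>), e) \<partial>\<nu>) \<partial>restrict_space lborel {0..t}) \<partial>M)"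
  proof (intro nn_integral_cong)
    fix \<omega> assume \<omega>: "\<omega> \<in> space M"
    have s: "sets (\<nu> \<Otimes>\<^sub>M lborel) = sets (borel :: ('e \<times> real) measure)"
      by (subst borel_prod[symmetric]) (intro sets_pair_measure_cong sets_\<nu> sets_lborel)
    have g: "(\<lambda>z. H ((snd z, \<omega>), fst z) * indicator (UNIV \<times> {0..t}) z) \<in> borel_measurable (\<nu> \<Otimes>\<^sub>M lborel)"
      using section_measurable[OF H \<omega>, of t] unfolding measurable_cong_sets[OF s refl]
      by (subst (asm) borel_measurable_restrict_space_iff_ennreal) auto
    have "(\<integral>\<^sup>+z\<in>UNIV \<times> {0..}. ?H ((snd z, \<omega>), fst z) \<partial>scale_measure (ennreal \<eta>) (\<nu> \<Otimes>\<^sub>M lborel))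
      = (\<integral>\<^sup>+z\<in>UNIV \<times> {0..t}. H ((snd z, \<omega>), fst z) \<partial>scale_measure (ennreal \<eta>) (\<nu> \<Otimes>\<^sub>M lborel))"
      by (simp only: fst_conv strip)
    also have "\<dots> = ennreal \<eta> * (\<integral>\<^sup>+z\<in>UNIV \<times> {0..t}. H ((snd z, \<omega>), fst z) \<partial>(\<nu> \<Otimes>\<^sub>M lborel))"
      by (rule nn_integral_scale_measure[OF g])
    also have "(\<integral>\<^sup>+z\<in>UNIV \<times> {0..t}. H ((snd z, \<omega>), fst z) \<partial>(\<nu> \<Otimes>\<^sub>M lborel))
      = (\<integral>\<^sup>+s. (\<integral>\<^sup>+e. H ((s, \<omega>), e) * indicator (UNIV \<times> {0..t}) (e, s) \<partial>\<nu>) \<partial>lborel)"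
      using PK.nn_integral_snd[OF g] by simp
    also have "\<dots> = (\<integral>\<^sup>+s. (\<integral>\<^sup>+e. H ((s, \<omega>), e) \<partial>\<nu>) * indicator {0..t} s \<partial>lborel)"
      by (intro nn_integral_cong) (auto simp: indicator_def)
    also have "\<dots> = (\<integral>\<^sup>+s. (\<integral>\<^sup>+e. H ((s, \<omega>), e) \<partial>\<nu>) \<partial>restrict_space lborel {0..t})"
      by (subst nn_integral_restrict_space) auto
    finally show "(\<integral>\<^sup>+z\<in>UNIV \<times> {0..}. ?H ((snd z, \<omega>), fst z) \<partial>scale_measure (ennreal \<eta>) (\<nu> \<Otimes>\<^sub>M lborel))
      = ennreal \<eta> * (\<integral>\<^sup>+s. (\<integral>\<^sup>+e. H ((s, \<omega>), e) \<partial>\<nu>) \<partial>restrict_space lborel {0..t})" .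
  qed
  also have "\<dots> = ennreal \<eta> * (\<integral>\<^sup>+\<omega>. (\<integral>\<^sup>+s. (\<integral>\<^sup>+e. H ((s, \<omega>), e) \<partial>\<nu>) \<partial>restrict_space lborel {0..t}) \<partial>M)"
  proof (rule nn_integral_cmult)
    have "(\<lambda>p. \<integral>\<^sup>+e. H (p, e) \<partial>\<nu>) \<in> borel_measurable (Lam t)"
      by (rule \<nu>.borel_measurable_nn_integral_fst[OF measurable_pred_LamE[OF H]])
    from PL.M1.borel_measurable_nn_integral_fst[OF measurable_pair_swap[OF this]]
    show "(\<lambda>\<omega>. \<integral>\<^sup>+s. (\<integral>\<^sup>+e. H ((s, \<omega>), e) \<partial>\<nu>) \<partial>restrict_space lborel {0..t}) \<in> borel_measurable M" by simp
  qed
  also have "(\<integral>\<^sup>+\<omega>. (\<integral>\<^sup>+s. (\<integral>\<^sup>+e. H ((s, \<omega>), e) \<partial>\<nu>) \<partial>restrict_space lborel {0..t}) \<partial>M)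
    = (\<integral>\<^sup>+p. (\<integral>\<^sup>+e. H (p, e) \<partial>\<nu>) \<partial>Lam t)"
    by (rule PL.nn_integral_snd[OF \<nu>.borel_measurable_nn_integral_fst[OF measurable_pred_LamE[OF H]]])
  also have "\<dots> = (\<integral>\<^sup>+q. H q \<partial>(LamE t))"
    by (rule \<nu>.nn_integral_fst[OF measurable_pred_LamE[OF H]])
  finally show ?thesis .
qed

lemma integral_compensator:
  fixes H :: "(real \<times> 'w) \<times> 'e \<Rightarrow> real"
  assumes t: "0 \<le> t" and H: "H \<in> borel_measurable predE" and i: "integrable (LamE t) H"
  shows "integrable M (jsum t H)" "(\<integral>\<omega>. jsum t H \<omega> \<partial>M) = \<eta> * (\<integral>q. H q \<partial>(LamE t))"
proof -
  have pos: "integrable M (jsum t G) \<and> (\<integral>\<omega>. jsum t G \<omega> \<partial>M) = \<eta> * (\<integral>q. G q \<partial>(LamE t))"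
    if G: "G \<in> borel_measurable predE" "\<And>q. 0 \<le> G q" "integrable (LamE t) G" for G
  proof -
    have nn: "0 \<le> jsum t G \<omega>" for \<omega> using G(2) by (simp add: jsum_def sum_nonneg)
    have "ennreal (jsum t G \<omega>) = jsum t (\<lambda>q. ennreal (G q)) \<omega>" for \<omega>
      using G(2) by (simp add: jsum_def sum_ennreal)
    then have "(\<integral>\<^sup>+\<omega>. ennreal (jsum t G \<omega>) \<partial>M) = (\<integral>\<^sup>+\<omega>. jsum t (\<lambda>q. ennreal (G q)) \<omega> \<partial>M)" by simp
    also have "\<dots> = ennreal \<eta> * (\<integral>\<^sup>+q. ennreal (G q) \<partial>(LamE t))"
      using G(1) by (intro nn_integral_compensator) simp
    also have "(\<integral>\<^sup>+q. ennreal (G q) \<partial>(LamE t)) = ennreal (\<integral>q. G q \<partial>(LamE t))"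
      using G by (intro nn_integral_eq_integral) auto
    finally have "(\<integral>\<^sup>+\<omega>. ennreal (jsum t G \<omega>) \<partial>M) = ennreal (\<eta> * (\<integral>q. G q \<partial>(LamE t)))"
      using \<eta>_pos G(2) by (simp add: ennreal_mult)
    moreover have "jsum t G \<in> borel_measurable M"
      by (rule measurable_F_M[OF jsum_measurable[OF t G(1)]])
    ultimately show ?thesis
      using nn G(2) \<eta>_pos by (subst (asm) nn_integral_eq_integrable) auto
  qed
  have max: "max 0 a - max 0 (- a) = a" for a :: real by simp
  have Hd: "jsum t H \<omega> = jsum t (\<lambda>q. max 0 (H q)) \<omega> - jsum t (\<lambda>q. max 0 (- H q)) \<omega>" for \<omega>
    unfolding jsum_diff[symmetric] max ..
  have ip: "integrable (LamE t) (\<lambda>q. max 0 (H q))" "integrable (LamE t) (\<lambda>q. max 0 (- H q))"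
    using i by (intro integrable_max; simp)+
  have p1: "integrable M (jsum t (\<lambda>q. max 0 (H q))) \<and> (\<integral>\<omega>. jsum t (\<lambda>q. max 0 (H q)) \<omega> \<partial>M) = \<eta> * (\<integral>q. max 0 (H q) \<partial>(LamE t))"
    by (rule pos[OF _ _ ip(1)]) (use H in \<open>intro borel_measurable_max borel_measurable_const\<close>, simp_all)
  have p2: "integrable M (jsum t (\<lambda>q. max 0 (- H q))) \<and> (\<integral>\<omega>. jsum t (\<lambda>q. max 0 (- H q)) \<omega> \<partial>M) = \<eta> * (\<integral>q. max 0 (- H q) \<partial>(LamE t))"
    by (rule pos[OF _ _ ip(2)]) (use H in \<open>intro borel_measurable_max borel_measurable_const borel_measurable_uminus\<close>, simp_all)
  show "integrable M (jsum t H)"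
    unfolding Hd[abs_def] using p1 p2 by (intro Bochner_Integration.integrable_diff) auto
  have "(\<integral>\<omega>. jsum t H \<omega> \<partial>M) = \<eta> * ((\<integral>q. max 0 (H q) \<partial>(LamE t)) - (\<integral>q. max 0 (- H q) \<partial>(LamE t)))"
    unfolding Hd using p1 p2 by (simp add: right_diff_distrib)
  also have "(\<integral>q. max 0 (H q) \<partial>(LamE t)) - (\<integral>q. max 0 (- H q) \<partial>(LamE t)) = (\<integral>q. H q \<partial>(LamE t))"
    unfolding Bochner_Integration.integral_diff[OF ip, symmetric] max ..
  finally show "(\<integral>\<omega>. jsum t H \<omega> \<partial>M) = \<eta> * (\<integral>q. H q \<partial>(LamE t))" .
qed

lemma integral_LamE:
  fixes H :: "(real \<times> 'w) \<times> 'e \<Rightarrow> real"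
  assumes i: "integrable (LamE t) H"
  shows "integrable (Lam t) (\<lambda>p. \<integral>e. H (p, e) \<partial>\<nu>)"
    "(\<integral>q. H q \<partial>(LamE t)) = (\<integral>p. (\<integral>e. H (p, e) \<partial>\<nu>) \<partial>Lam t)"
proof -
  interpret Lam: finite_measure "Lam t" by (rule finite_Lam)
  interpret pair_sigma_finite "Lam t" \<nu> ..
  show "integrable (Lam t) (\<lambda>p. \<integral>e. H (p, e) \<partial>\<nu>)" by (rule integrable_fst'[OF i])
  show "(\<integral>q. H q \<partial>(LamE t)) = (\<integral>p. (\<integral>e. H (p, e) \<partial>\<nu>) \<partial>Lam t)"
    by (rule integral_fst'[OF i, symmetric])
qed

end

text \<open>An arbitrary solution rather than the constructed one, since the reward refers to a
  solution picked by \<open>SOME\<close>.\<close>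

locale jump_equation = marked_jumps M N T E \<nu> \<eta>
  for M :: "'w measure" and N :: "'w \<Rightarrow> ('e::euclidean_space \<times> real) measure" and T E \<nu> \<eta> +
  fixes \<beta> :: "real \<times> 'w \<Rightarrow> 'x \<Rightarrow> 'e \<Rightarrow> 'x::euclidean_space"
    and X :: "real \<Rightarrow> 'w \<Rightarrow> 'x" and x :: 'x
  assumes \<beta>: "coeff_measurable \<beta>"
    and X_adapted: "adapted F X" and X_cadlag: "cadlag_paths M X"
    and X_eq: "AE \<omega> in M. \<forall>t\<ge>0. X t \<omega> =
      x + (LINT z:UNIV \<times> {0..t}|N \<omega>. \<beta> (snd z, \<omega>) (left_lim X (snd z) \<omega>) (fst z))"
begin

definition L :: "real \<times> 'w \<Rightarrow> 'x" where "L = (\<lambda>(s, \<omega>). left_lim X s \<omega>)"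

lemma L_measurable: "L \<in> borel_measurable pred"
  unfolding L_def by (rule left_lim_predictable[OF X_adapted X_cadlag])

lemma AE_chain: "AE \<omega> in M. \<omega> \<in> good \<and> (\<forall>t\<ge>0. X t \<omega> = chain \<beta> x (cnt t \<omega>) \<omega> \<and>
    (\<forall>n<cnt t \<omega>. L (\<tau> n \<omega>, \<omega>) = chain \<beta> x n \<omega>))"
  using X_eq AE_good
proof eventually_elim
  case (elim \<omega>)
  have eq: "X t \<omega> = x + (LINT z:UNIV \<times> {0..t}|N \<omega>. \<beta> (snd z, \<omega>) (left_lim X (snd z) \<omega>) (fst z))" if "0 \<le> t" for t
    using elim that by blast
  note u = solution_unique[OF \<beta> X_adapted X_cadlag eq elim(2)]
  show ?case
  proof (intro conjI allI impI)
    fix t :: real assume t: "0 \<le> t"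
    show "X t \<omega> = chain \<beta> x (cnt t \<omega>) \<omega>" by (rule u(1)) (use t in auto)
    show "L (\<tau> n \<omega>, \<omega>) = chain \<beta> x n \<omega>" if "n < cnt t \<omega>" for n
      unfolding L_def prod.case by (rule u(2)[OF _ t that])
  qed (rule elim(2))
qed

definition jump_incr :: "('x \<Rightarrow> real) \<Rightarrow> (real \<times> 'w) \<times> 'e \<Rightarrow> real" where
  "jump_incr \<phi> = (\<lambda>(p, e). \<phi> (L p + \<beta> p (L p) e) - \<phi> (L p))"

lemma jump_incr_measurable:
  assumes \<phi>: "\<phi> \<in> borel_measurable borel"
  shows "jump_incr \<phi> \<in> borel_measurable predE"
proof -
  have L: "(\<lambda>q. L (fst q)) \<in> borel_measurable predE"
    by (rule measurable_compose[OF measurable_fst L_measurable])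
  have "(\<lambda>q. \<beta> (fst q) (L (fst q)) (snd q)) \<in> borel_measurable predE"
    using coeff_at_measurable[OF \<beta> L_measurable] by (simp add: case_prod_beta)
  from borel_measurable_diff[OF measurable_compose[OF borel_measurable_add[OF L this] \<phi>] measurable_compose[OF L \<phi>]]
  show ?thesis by (simp add: jump_incr_def case_prod_beta)
qed

text \<open>Along a pure jump path the increments of \<phi> over the jumps telescope; this takes the
  place of Ito's formula.\<close>

lemma dynkin_path:
  "AE \<omega> in M. \<forall>t\<ge>0. \<phi> (X t \<omega>) = \<phi> x + jsum t (jump_incr \<phi>) \<omega>"
  using AE_chain
proof eventually_elim
  case (elim \<omega>)
  show ?case
  proof (intro allI impI)
    fix t :: real assume t: "0 \<le> t"
    have "jsum t (jump_incr \<phi>) \<omega> = (\<Sum>n<cnt t \<omega>. \<phi> (chain \<beta> x (Suc n) \<omega>) - \<phi> (chain \<beta> x n \<omega>))"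
      using elim t by (simp add: jsum_def jump_incr_def)
    also have "\<dots> = \<phi> (X t \<omega>) - \<phi> x"
      using elim t by (subst sum_lessThan_telescope) simp
    finally show "\<phi> (X t \<omega>) = \<phi> x + jsum t (jump_incr \<phi>) \<omega>" by simp
  qed
qed

lemma X_measurable: "0 \<le> t \<Longrightarrow> X t \<in> borel_measurable M"
  using X_adapted measurable_F_M by (auto simp: adapted_def)

lemma dynkin:
  assumes \<phi>: "\<phi> \<in> borel_measurable borel" and t: "0 \<le> t"
    and i: "integrable (LamE t) (jump_incr \<phi>)"
  shows "integrable M (\<lambda>\<omega>. \<phi> (X t \<omega>))"
    "(\<integral>\<omega>. \<phi> (X t \<omega>) \<partial>M) = \<phi> x + \<eta> * (\<integral>q. jump_incr \<phi> q \<partial>(LamE t))"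
proof -
  note c = integral_compensator[OF t jump_incr_measurable[OF \<phi>] i]
  have ae: "AE \<omega> in M. \<phi> (X t \<omega>) = \<phi> x + jsum t (jump_incr \<phi>) \<omega>"
    using dynkin_path[of \<phi>] by eventually_elim (use t in simp)
  have m: "(\<lambda>\<omega>. \<phi> (X t \<omega>)) \<in> borel_measurable M" "jsum t (jump_incr \<phi>) \<in> borel_measurable M"
    using measurable_compose[OF X_measurable[OF t] \<phi>] c(1) by auto
  show "integrable M (\<lambda>\<omega>. \<phi> (X t \<omega>))"
    using ae m c(1) by (subst integrable_cong_AE[OF _ _ ae]) auto
  have "(\<integral>\<omega>. \<phi> (X t \<omega>) \<partial>M) = (\<integral>\<omega>. \<phi> x + jsum t (jump_incr \<phi>) \<omega> \<partial>M)"
    using m by (intro integral_cong_AE ae) auto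
  also have "\<dots> = \<phi> x + \<eta> * (\<integral>q. jump_incr \<phi> q \<partial>(LamE t))"
    using c by (simp add: prob_space)
  finally show "(\<integral>\<omega>. \<phi> (X t \<omega>) \<partial>M) = \<phi> x + \<eta> * (\<integral>q. jump_incr \<phi> q \<partial>(LamE t))" .
qed

text \<open>Dynkin's formula is applied to the bounded functions \<open>min \<xi> n\<close>, which inherit the drift
  condition on \<open>{\<xi> \<le> n}\<close> and cannot increase by a jump from \<open>{\<xi> > n}\<close>; no stopping is needed.\<close>

lemma lyapunov:
  fixes \<xi> :: "'x \<Rightarrow> real"
  assumes \<xi>: "\<xi> \<in> borel_measurable borel" "\<And>y. 0 \<le> \<xi> y" "\<xi> x = 0"
    and int: "\<And>p y. p \<in> space pred \<Longrightarrow> integrable \<nu> (\<lambda>e. \<xi> (y + \<beta> p y e))"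
    and drift: "\<And>p y. p \<in> space pred \<Longrightarrow> \<eta> * (\<integral>e. \<xi> (y + \<beta> p y e) - \<xi> y \<partial>\<nu>) \<le> - C1 * \<xi> y + C2"
    and C: "0 < C1" "0 \<le> C2" and t: "0 \<le> t"
  shows "(\<integral>\<^sup>+p. ennreal (\<xi> (L p)) \<partial>Lam t) \<le> ennreal (C2 * t / C1)"
    "(\<integral>\<^sup>+\<omega>. ennreal (\<xi> (X t \<omega>)) \<partial>M) \<le> ennreal (C2 * t)"
proof -
  interpret Lam: finite_measure "Lam t" by (rule finite_Lam)
  interpret LamE: finite_measure "LamE t" by (rule finite_LamE)
  define f where "f n y = min (\<xi> y) (real n)" for n y
  \<comment> \<open>Above level \<open>n\<close> the drift of \<open>f n\<close> is only known to be
    nonpositive, so the term it pays for is cut to 0 there instead of being capped at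
    \<open>n\<close>.\<close>
  define g where "g n p = (if \<xi> (L p) \<le> real n then \<xi> (L p) else 0)" for n p
  have fm: "f n \<in> borel_measurable borel" for n
    unfolding f_def using \<xi>(1) by measurable
  have \<xi>L: "(\<lambda>p. \<xi> (L p)) \<in> borel_measurable (Lam t)"
    by (rule measurable_pred_Lam[OF measurable_compose[OF L_measurable \<xi>(1)]])
  have gm: "g n \<in> borel_measurable (Lam t)" for n
    unfolding g_def using \<xi>L by measurable
  have gi: "integrable (Lam t) (g n)" for n
    by (rule Lam.integrable_const_bound[where B = "real n"]) (use \<xi>(2) gm in \<open>auto simp: g_def\<close>)
  have ji: "integrable (LamE t) (jump_incr (f n))" for n
  proof (rule LamE.integrable_const_bound[where B = "real n"])
    show "jump_incr (f n) \<in> borel_measurable (LamE t)"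
      by (rule measurable_pred_LamE[OF jump_incr_measurable[OF fm]])
    have "\<bar>f n y - f n z\<bar> \<le> real n" for y z
      using \<xi>(2)[of y] \<xi>(2)[of z] by (auto simp: f_def)
    then show "AE q in LamE t. norm (jump_incr (f n) q) \<le> real n"
      by (simp add: jump_incr_def case_prod_beta)
  qed
  have drift': "\<eta> * (\<integral>e. jump_incr (f n) (p, e) \<partial>\<nu>) \<le> - C1 * g n p + C2" if p: "p \<in> space (Lam t)" for n p
  proof -
    have p': "p \<in> space pred" using p by auto
    let ?y = "L p"
    have i: "integrable \<nu> (\<lambda>e. \<xi> (?y + \<beta> p ?y e))" by (rule int[OF p'])
    have im: "integrable \<nu> (\<lambda>e. f n (?y + \<beta> p ?y e))"
      unfolding f_def using i by (intro integrable_min) auto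
    show ?thesis
    proof (cases "\<xi> ?y \<le> real n")
      case True
      have "(\<integral>e. jump_incr (f n) (p, e) \<partial>\<nu>) \<le> (\<integral>e. \<xi> (?y + \<beta> p ?y e) - \<xi> ?y \<partial>\<nu>)"
        unfolding jump_incr_def prod.case using i im True
        by (intro integral_mono) (auto simp: f_def)
      then have "\<eta> * (\<integral>e. jump_incr (f n) (p, e) \<partial>\<nu>) \<le> \<eta> * (\<integral>e. \<xi> (?y + \<beta> p ?y e) - \<xi> ?y \<partial>\<nu>)"
        using \<eta>_pos by (intro mult_left_mono) auto
      also have "\<dots> \<le> - C1 * \<xi> ?y + C2" by (rule drift[OF p'])
      finally show ?thesis using True by (simp add: g_def)
    next
      case False
      have "(\<integral>e. jump_incr (f n) (p, e) \<partial>\<nu>) \<le> (\<integral>e. 0 \<partial>\<nu>)"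
        unfolding jump_incr_def prod.case using im False
        by (intro integral_mono) (auto simp: f_def)
      then have "\<eta> * (\<integral>e. jump_incr (f n) (p, e) \<partial>\<nu>) \<le> 0"
        using \<eta>_pos by (simp add: mult_le_0_iff)
      then show ?thesis using False C by (simp add: g_def)
    qed
  qed
  \<comment> \<open>Both claims come from this inequality, by dropping one of the two nonnegative
    terms and letting \<open>n\<close> tend to infinity. The initial value vanishes because
    \<open>\<xi> x = 0\<close>.\<close>
  have main: "(\<integral>\<omega>. f n (X t \<omega>) \<partial>M) + C1 * (\<integral>p. g n p \<partial>Lam t) \<le> C2 * t" for n
  proof -
    have "\<eta> * (\<integral>q. jump_incr (f n) q \<partial>(LamE t)) = (\<integral>p. \<eta> * (\<integral>e. jump_incr (f n) (p, e) \<partial>\<nu>) \<partial>Lam t)"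
      unfolding integral_LamE(2)[OF ji] by simp
    also have "\<dots> \<le> (\<integral>p. - C1 * g n p + C2 \<partial>Lam t)"
      using integral_LamE(1)[OF ji] gi drift' by (intro integral_mono) auto
    also have "\<dots> = - C1 * (\<integral>p. g n p \<partial>Lam t) + C2 * t"
      using gi by (simp add: measure_Lam[OF t])
    finally show ?thesis
      using dynkin(2)[OF fm t ji, of n] \<xi>(3) by (simp add: f_def)
  qed
  have nn: "0 \<le> (\<integral>\<omega>. f n (X t \<omega>) \<partial>M)" "0 \<le> (\<integral>p. g n p \<partial>Lam t)" for n
    using \<xi>(2) by (auto intro!: integral_nonneg_AE simp: f_def g_def)
  have ev: "\<forall>\<^sub>F n in sequentially. \<xi> y \<le> real n" for y
    by (meson eventually_sequentiallyI of_nat_le_iff order_trans real_arch_simple)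
  show "(\<integral>\<^sup>+p. ennreal (\<xi> (L p)) \<partial>Lam t) \<le> ennreal (C2 * t / C1)"
  proof (rule nn_integral_le_of_tendsto[OF gi])
    show "(\<lambda>n. g n p) \<longlonglongrightarrow> \<xi> (L p)" for p
      using ev[of "L p"] by (intro tendsto_eventually) (auto simp: g_def elim: eventually_mono)
    show "(\<integral>p. g n p \<partial>Lam t) \<le> C2 * t / C1" for n
      using main[of n] nn[of n] C by (simp add: pos_le_divide_eq mult.commute)
  qed (use \<xi>(2) in \<open>simp add: g_def\<close>)
  show "(\<integral>\<^sup>+\<omega>. ennreal (\<xi> (X t \<omega>)) \<partial>M) \<le> ennreal (C2 * t)"
  proof (rule nn_integral_le_of_tendsto[OF dynkin(1)[OF fm t ji]])
    show "(\<lambda>n. f n (X t \<omega>)) \<longlonglongrightarrow> \<xi> (X t \<omega>)" for \<omega>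
      using ev[of "X t \<omega>"] by (intro tendsto_eventually) (auto simp: f_def elim: eventually_mono)
    show "(\<integral>\<omega>. f n (X t \<omega>) \<partial>M) \<le> C2 * t" for n
      using main[of n] nn(2)[of n] C(1) mult_nonneg_nonneg[of C1 "\<integral>p. g n p \<partial>Lam t"] by linarith
  qed (use \<xi>(2) in \<open>simp add: f_def\<close>)
qed

end

text \<open>From \<open>(1 + y) ^ 3 \<le> 4 + 4 * y ^ 3\<close>, which is convexity of the cube, and
  \<open>y ^ 3 \<le> 1 + y powr p\<close>.\<close>

lemma growth_bound:
  fixes y p :: real
  assumes "0 \<le> y" "3 \<le> p"
  shows "(1 + y) ^ 3 \<le> 8 + 4 * y powr p"
proof -
  have "y ^ 3 \<le> 1 + y powr p"
  proof (cases "y \<le> 1")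
    case True
    then have "y ^ 3 \<le> 1" using assms by (simp add: power_le_one)
    also have "\<dots> \<le> 1 + y powr p" by simp
    finally show ?thesis .
  next
    case False
    then have "y ^ 3 = y powr 3" by (simp add: powr_numeral)
    also have "\<dots> \<le> y powr p" using False assms by (intro powr_mono) auto
    finally show ?thesis by simp
  qed
  moreover have "(1 + y) ^ 3 \<le> 4 + 4 * y ^ 3"
  proof -
    have "0 \<le> 3 * ((1 + y) * (1 - y)\<^sup>2)" using assms by simp
    also have "\<dots> = 4 + 4 * y ^ 3 - (1 + y) ^ 3"
      by (simp add: power2_eq_square power3_eq_cube algebra_simps)
    finally show ?thesis by simp
  qed
  ultimately show ?thesis by linarith
qed

text \<open>Above \<open>sqrt T\<close> one has \<open>y * T \<le> y ^ 3 \<le> y powr p\<close>. It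
  turns a moment of order \<open>p\<close> that grows like \<open>T\<close> into a first moment of
  order \<open>sqrt T\<close>.\<close>

lemma norm_le_sqrt_plus:
  fixes y p T :: real
  assumes "0 \<le> y" "3 \<le> p" "1 \<le> T"
  shows "y \<le> sqrt T + y powr p / T"
proof (cases "y \<le> sqrt T")
  case True
  then show ?thesis using assms by (intro add_increasing2) auto
next
  case False
  have y1: "1 \<le> y" using False assms by (meson dual_order.trans linear real_sqrt_ge_one)
  have "T \<le> y\<^sup>2" using False assms by (metis less_imp_le not_le real_sqrt_le_iff real_sqrt_unique power2_eq_square sqrt_le_D)
  then have "y * T \<le> y * y\<^sup>2" using assms by (intro mult_left_mono)
  also have "\<dots> = y powr 3" using y1 by (simp add: powr_numeral power2_eq_square power3_eq_cube)
  also have "\<dots> \<le> y powr p" using y1 assms by (intro powr_mono) auto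
  finally have "y \<le> y powr p / T" using assms by (simp add: pos_le_divide_eq)
  then show ?thesis using assms by (intro add_increasing) auto
qed

section \<open>Long-run averages along a solution\<close>

context jump_equation begin

text \<open>\<open>g\<close> is the drift of \<phi> plus the running reward. By Dynkin's formula the
  time averages of \<open>g\<close> and \<open>rr\<close> differ by the boundary term of \<phi>
  divided by the horizon, which tends to 0. \<open>D\<close> bounds the time average of
  \<open>(1 + norm (L p)) ^ 3\<close>, by \<open>growth_bound\<close>, the lower bound on \<xi> and
  the average \<open>C2 / C1\<close> of \<xi>.\<close>

lemma long_run_average:
  fixes \<phi> \<xi> :: "'x \<Rightarrow> real" and rr :: "real \<times> 'w \<Rightarrow> real"
  assumes \<phi>: "\<phi> \<in> borel_measurable borel" "\<And>y. \<bar>\<phi> y\<bar> \<le> C\<phi> * (1 + norm y)"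
    and growth: "\<And>p y e. p \<in> space pred \<Longrightarrow> norm (\<beta> p y e) \<le> K * (1 + norm y)"
    and \<xi>: "\<xi> \<in> borel_measurable borel" "\<And>y. 0 \<le> \<xi> y" "\<xi> x = 0"
    and int: "\<And>p y. p \<in> space pred \<Longrightarrow> integrable \<nu> (\<lambda>e. \<xi> (y + \<beta> p y e))"
    and drift: "\<And>p y. p \<in> space pred \<Longrightarrow> \<eta> * (\<integral>e. \<xi> (y + \<beta> p y e) - \<xi> y \<partial>\<nu>) \<le> - C1 * \<xi> y + C2"
    and C: "0 < C1" "0 \<le> C2" and l: "0 < l" "\<And>y. l * norm y powr q \<le> \<xi> y" "3 \<le> q"
    and rr: "rr \<in> borel_measurable pred" "\<And>p. p \<in> space pred \<Longrightarrow> \<bar>rr p\<bar> \<le> R"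
    and \<kappa>: "0 \<le> \<kappa>"
  defines "g \<equiv> \<lambda>p. \<eta> * (\<integral>e. \<phi> (L p + \<beta> p (L p) e) - \<phi> (L p) \<partial>\<nu>) + rr p"
    and "D \<equiv> 8 + 4 * C2 / (C1 * l)"
    and "avg \<equiv> \<lambda>T. 1 / (\<eta> * T) * (\<integral>\<omega>. jsum T (\<lambda>(p, e). rr p) \<omega> \<partial>M)"
  shows "(\<And>p. p \<in> space pred \<Longrightarrow> g p \<le> c + \<kappa> * (1 + norm (L p)) ^ 3) \<Longrightarrow>
      Liminf at_top (\<lambda>T. ereal (avg T)) \<le> ereal (c + \<kappa> * D)"
    and "(\<And>p. p \<in> space pred \<Longrightarrow> c - \<kappa> * (1 + norm (L p)) ^ 3 \<le> g p) \<Longrightarrow>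
      ereal (c - \<kappa> * D) \<le> Liminf at_top (\<lambda>T. ereal (avg T))"
proof -
  \<comment> \<open>The boundary term: \<open>1 + sqrt T + C2 / l\<close> bounds the expectation of
    \<open>1 + norm (X T \<omega>)\<close>, where \<open>C2 / l\<close> is the bound
    \<open>C2 * T\<close> for the expectation of \<xi> divided by \<open>l * T\<close>.\<close>
  define err where "err T = (C\<phi> * (1 + sqrt T + C2 / l) + \<bar>\<phi> x\<bar>) / T" for T
  have C\<phi>: "0 \<le> C\<phi>" using \<phi>(2)[of 0] by simp
  have K: "0 \<le> K"
  proof -
    obtain \<omega> where "\<omega> \<in> space M" using not_empty by blast
    then have "(0, \<omega>) \<in> space pred" by simp
    from order_trans[OF norm_ge_zero growth[OF this, of 0 undefined]] show ?thesis by simp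
  qed
  have key: "integrable (Lam T) g \<and> integrable (Lam T) (\<lambda>p. \<xi> (L p)) \<and> (\<integral>p. \<xi> (L p) \<partial>Lam T) \<le> C2 * T / C1
    \<and> measure (Lam T) ({0..T} \<times> space M) = T
    \<and> \<bar>avg T - 1 / T * (\<integral>p. g p \<partial>Lam T)\<bar> \<le> err T" if T: "1 \<le> T" for T
  proof -
    have t: "0 \<le> T" using T by simp
    interpret Lam: finite_measure "Lam T" by (rule finite_Lam)
    interpret LamE: finite_measure "LamE T" by (rule finite_LamE)
    note lyap = lyapunov[OF \<xi> int drift C t]
    have \<xi>L: "(\<lambda>p. \<xi> (L p)) \<in> borel_measurable (Lam T)"
      by (rule measurable_pred_Lam[OF measurable_compose[OF L_measurable \<xi>(1)]])
    have i\<xi>: "integrable (Lam T) (\<lambda>p. \<xi> (L p))"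
      using \<xi>L \<xi>(2) le_less_trans[OF lyap(1)] by (intro integrableI_nonneg) auto
    have I\<xi>: "(\<integral>p. \<xi> (L p) \<partial>Lam T) \<le> C2 * T / C1"
    proof -
      have "ennreal (\<integral>p. \<xi> (L p) \<partial>Lam T) \<le> ennreal (C2 * T / C1)"
        using lyap(1) i\<xi> \<xi>(2) by (subst nn_integral_eq_integral[symmetric]) auto
      then show ?thesis using C t by (subst (asm) ennreal_le_iff) auto
    qed
    have \<xi>X: "(\<lambda>\<omega>. \<xi> (X T \<omega>)) \<in> borel_measurable M"
      by (rule measurable_compose[OF X_measurable[OF t] \<xi>(1)])
    have iX: "integrable M (\<lambda>\<omega>. \<xi> (X T \<omega>))"
      using \<xi>X \<xi>(2) le_less_trans[OF lyap(2)] by (intro integrableI_nonneg) auto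
    have IX: "(\<integral>\<omega>. \<xi> (X T \<omega>) \<partial>M) \<le> C2 * T"
    proof -
      have "ennreal (\<integral>\<omega>. \<xi> (X T \<omega>) \<partial>M) \<le> ennreal (C2 * T)"
        using lyap(2) iX \<xi>(2) by (subst nn_integral_eq_integral[symmetric]) auto
      then show ?thesis using C t by (subst (asm) ennreal_le_iff) auto
    qed
    have i\<xi>\<nu>: "integrable (LamE T) (\<lambda>q. \<xi> (L (fst q)))"
    proof (rule integrableI_nonneg)
      show m: "(\<lambda>q. \<xi> (L (fst q))) \<in> borel_measurable (LamE T)"
        by (rule measurable_compose[OF measurable_fst \<xi>L])
      have "(\<integral>\<^sup>+q. ennreal (\<xi> (L (fst q))) \<partial>(LamE T)) = (\<integral>\<^sup>+p. \<integral>\<^sup>+e. ennreal (\<xi> (L p)) \<partial>\<nu> \<partial>Lam T)"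
        using m by (subst \<nu>.nn_integral_fst[symmetric]) auto
      also have "\<dots> = (\<integral>\<^sup>+p. ennreal (\<xi> (L p)) \<partial>Lam T)" by (simp add: \<nu>.emeasure_space_1[simplified])
      also have "\<dots> < \<infinity>" using le_less_trans[OF lyap(1)] by simp
      finally show "(\<integral>\<^sup>+q. ennreal (\<xi> (L (fst q))) \<partial>(LamE T)) < \<infinity>" .
    qed (simp add: \<xi>(2))
    \<comment> \<open>A crude linear bound by \<xi>; it serves the integrability of the increments
      of \<phi>.\<close>
    have norm_le: "norm y \<le> 7 + 4 * (\<xi> y / l)" for y
    proof -
      have "1 + norm y \<le> (1 + norm y) ^ 3" by (rule self_le_power) auto
      also have "\<dots> \<le> 8 + 4 * norm y powr q" by (rule growth_bound) (use l in auto)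
      also have "norm y powr q \<le> \<xi> y / l" using l(2)[of y] l(1) by (simp add: pos_le_divide_eq mult.commute)
      finally show ?thesis by simp
    qed
    let ?H = "jump_incr \<phi>"
    have Hb: "norm (?H q) \<le> C\<phi> * (2 + K) * (8 + 4 * (\<xi> (L (fst q)) / l))" if "q \<in> space (LamE T)" for q
    proof -
      obtain p e where q: "q = (p, e)" by (cases q)
      with that have p: "p \<in> space pred" by (auto simp: space_pair_measure)
      have "\<bar>?H q\<bar> \<le> \<bar>\<phi> (L p + \<beta> p (L p) e)\<bar> + \<bar>\<phi> (L p)\<bar>"
        unfolding q jump_incr_def prod.case by (rule abs_triangle_ineq4)
      also have "\<dots> \<le> C\<phi> * (1 + norm (L p + \<beta> p (L p) e)) + C\<phi> * (1 + norm (L p))"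
        by (intro add_mono \<phi>(2))
      also have "\<dots> \<le> C\<phi> * (1 + (norm (L p) + K * (1 + norm (L p)))) + C\<phi> * (1 + norm (L p))"
        using C\<phi> growth[OF p, of "L p" e] norm_triangle_ineq[of "L p" "\<beta> p (L p) e"]
        by (intro add_right_mono mult_left_mono) linarith+
      also have "\<dots> = C\<phi> * (2 + K) * (1 + norm (L p))" by (simp add: algebra_simps)
      also have "\<dots> \<le> C\<phi> * (2 + K) * (8 + 4 * (\<xi> (L p) / l))"
        using C\<phi> K norm_le[of "L p"] by (intro mult_left_mono) auto
      finally show ?thesis by (simp add: q)
    qed
    have iH: "integrable (LamE T) ?H"
    proof (rule Bochner_Integration.integrable_bound)
      show "integrable (LamE T) (\<lambda>q. C\<phi> * (2 + K) * (8 + 4 * (\<xi> (L (fst q)) / l)))"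
        using i\<xi>\<nu> by simp
      show "?H \<in> borel_measurable (LamE T)"
        by (rule measurable_pred_LamE[OF jump_incr_measurable[OF \<phi>(1)]])
      show "AE q in LamE T. norm (?H q) \<le> norm (C\<phi> * (2 + K) * (8 + 4 * (\<xi> (L (fst q)) / l)))"
        using Hb by (intro AE_I2) (force intro: order_trans)
    qed
    have rm: "(\<lambda>(p, e). rr p) \<in> borel_measurable predE"
      unfolding case_prod_beta by (rule measurable_compose[OF measurable_fst rr(1)])
    have ir: "integrable (LamE T) (\<lambda>(p, e). rr p)"
    proof (rule LamE.integrable_const_bound[where B = R])
      show "AE q in LamE T. norm (case q of (p, e) \<Rightarrow> rr p) \<le> R"
        using rr(2) by (intro AE_I2) (auto simp: space_pair_measure)
    qed (rule measurable_pred_LamE[OF rm])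
    have ir': "integrable (Lam T) rr"
      using integral_LamE(1)[OF ir] by (simp add: \<nu>.prob_space[simplified])
    \<comment> \<open>The intensity \<eta> from the compensator cancels the normalisation of the
      reward.\<close>
    have avg: "avg T = 1 / T * (\<integral>p. rr p \<partial>Lam T)"
      unfolding avg_def integral_compensator(2)[OF t rm ir] integral_LamE(2)[OF ir]
      using \<eta>_pos by (simp add: \<nu>.prob_space[simplified])
    note dyn = dynkin[OF \<phi>(1) t iH]
    have gJ: "g = (\<lambda>p. \<eta> * (\<integral>e. ?H (p, e) \<partial>\<nu>) + rr p)"
      by (simp add: g_def jump_incr_def)
    have ig: "integrable (Lam T) g"
      unfolding gJ using integral_LamE(1)[OF iH] ir' by simp
    have "(\<integral>p. g p \<partial>Lam T) = \<eta> * (\<integral>p. (\<integral>e. ?H (p, e) \<partial>\<nu>) \<partial>Lam T) + (\<integral>p. rr p \<partial>Lam T)"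
      unfolding gJ using integral_LamE(1)[OF iH] ir' by simp
    then have "(\<integral>p. rr p \<partial>Lam T) - (\<integral>p. g p \<partial>Lam T) = \<phi> x - (\<integral>\<omega>. \<phi> (X T \<omega>) \<partial>M)"
      using dyn(2) unfolding integral_LamE(2)[OF iH] by simp
    moreover have "\<bar>\<integral>\<omega>. \<phi> (X T \<omega>) \<partial>M\<bar> \<le> C\<phi> * (1 + sqrt T + C2 / l)"
    proof -
      have "\<bar>\<integral>\<omega>. \<phi> (X T \<omega>) \<partial>M\<bar> \<le> (\<integral>\<omega>. \<bar>\<phi> (X T \<omega>)\<bar> \<partial>M)" by (rule integral_abs_bound)
      also have "\<dots> \<le> (\<integral>\<omega>. C\<phi> * (1 + sqrt T + \<xi> (X T \<omega>) / (l * T)) \<partial>M)"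
      proof (rule integral_mono)
        fix \<omega>
        have "norm (X T \<omega>) \<le> sqrt T + norm (X T \<omega>) powr q / T"
          using T l by (intro norm_le_sqrt_plus) auto
        also have "norm (X T \<omega>) powr q / T \<le> \<xi> (X T \<omega>) / l / T"
          using l(2)[of "X T \<omega>"] l(1) T by (intro divide_right_mono) (auto simp: pos_le_divide_eq mult.commute)
        finally have "1 + norm (X T \<omega>) \<le> 1 + sqrt T + \<xi> (X T \<omega>) / (l * T)" by simp
        then show "\<bar>\<phi> (X T \<omega>)\<bar> \<le> C\<phi> * (1 + sqrt T + \<xi> (X T \<omega>) / (l * T))"
          using C\<phi> by (intro order_trans[OF \<phi>(2)] mult_left_mono)
      qed (use dyn(1) iX in auto)
      also have "\<dots> = C\<phi> * (1 + sqrt T + (\<integral>\<omega>. \<xi> (X T \<omega>) \<partial>M) / (l * T))"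
        using iX by (simp add: prob_space)
      also have "\<dots> \<le> C\<phi> * (1 + sqrt T + C2 / l)"
        using C\<phi> l T IX by (intro mult_left_mono add_left_mono) (auto simp: field_simps)
      finally show ?thesis .
    qed
    ultimately have "\<bar>(\<integral>p. rr p \<partial>Lam T) - (\<integral>p. g p \<partial>Lam T)\<bar> \<le> C\<phi> * (1 + sqrt T + C2 / l) + \<bar>\<phi> x\<bar>"
      by linarith
    moreover have "avg T - 1 / T * (\<integral>p. g p \<partial>Lam T) = ((\<integral>p. rr p \<partial>Lam T) - (\<integral>p. g p \<partial>Lam T)) / T"
      unfolding avg by (simp add: diff_divide_distrib)
    ultimately have "\<bar>avg T - 1 / T * (\<integral>p. g p \<partial>Lam T)\<bar> \<le> err T"
      using T unfolding err_def by (simp add: divide_right_mono)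
    with ig i\<xi> I\<xi> measure_Lam[OF t] show ?thesis by blast
  qed
  have err0: "(err \<longlongrightarrow> 0) at_top"
  proof -
    have "((\<lambda>T. (C\<phi> * (1 + C2 / l) + \<bar>\<phi> x\<bar>) * inverse T + C\<phi> * inverse (sqrt T)) \<longlongrightarrow>
      (C\<phi> * (1 + C2 / l) + \<bar>\<phi> x\<bar>) * 0 + C\<phi> * 0) at_top"
      by (intro tendsto_intros tendsto_inverse_0_at_top filterlim_ident sqrt_at_top)
    moreover have "\<forall>\<^sub>F T in at_top. (C\<phi> * (1 + C2 / l) + \<bar>\<phi> x\<bar>) * inverse T + C\<phi> * inverse (sqrt T) = err T"
      using eventually_gt_at_top[of 0]
    proof eventually_elim
      case (elim T)
      then have "inverse (sqrt T) = sqrt T * inverse T" by (simp add: field_simps)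
      then show ?case by (simp add: err_def divide_inverse algebra_simps)
    qed
    ultimately show ?thesis unfolding mult_zero_right add_0_right by (rule Lim_transform_eventually)
  qed
  have cube: "(1 + norm y) ^ 3 \<le> 8 + 4 / l * \<xi> y" for y
  proof -
    have "(1 + norm y) ^ 3 \<le> 8 + 4 * norm y powr q" by (rule growth_bound) (use l in auto)
    also have "norm y powr q \<le> \<xi> y / l" using l(2)[of y] l(1) by (simp add: pos_le_divide_eq mult.commute)
    finally show ?thesis by simp
  qed
  have bound: "1 / T * (\<integral>p. c0 + \<kappa> * (8 + 4 / l * \<xi> (L p)) \<partial>Lam T) \<le> c0 + \<kappa> * D" if T: "1 \<le> T" for T c0
  proof -
    from key[OF T] have i: "integrable (Lam T) (\<lambda>p. \<xi> (L p))" "(\<integral>p. \<xi> (L p) \<partial>Lam T) \<le> C2 * T / C1"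
      "measure (Lam T) ({0..T} \<times> space M) = T" by auto
    interpret Lam: finite_measure "Lam T" by (rule finite_Lam)
    have "(\<integral>p. c0 + \<kappa> * (8 + 4 / l * \<xi> (L p)) \<partial>Lam T) = c0 * T + \<kappa> * (8 * T + 4 / l * (\<integral>p. \<xi> (L p) \<partial>Lam T))"
      using i by simp
    also have "\<dots> \<le> c0 * T + \<kappa> * (8 * T + 4 / l * (C2 * T / C1))"
      using \<kappa> l i(2) by (intro add_left_mono mult_left_mono) auto
    also have "\<dots> = T * (c0 + \<kappa> * D)" by (simp add: D_def field_simps)
    finally show ?thesis using T by (simp add: pos_divide_le_eq mult.commute)
  qed
  \<comment> \<open>The sign \<open>s\<close> treats the upper bound and the lower bound at
    once.\<close>
  have half: "\<forall>\<^sub>F T in at_top. s * avg T \<le> s * c + \<kappa> * D + err T"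
    if s: "\<bar>s\<bar> = 1" and up: "\<And>p. p \<in> space pred \<Longrightarrow> s * g p \<le> s * c + \<kappa> * (1 + norm (L p)) ^ 3" for s :: real
    using eventually_ge_at_top[of 1]
  proof eventually_elim
    case (elim T)
    interpret Lam: finite_measure "Lam T" by (rule finite_Lam)
    from key[OF elim] have i: "integrable (Lam T) g" "integrable (Lam T) (\<lambda>p. \<xi> (L p))"
      "\<bar>avg T - 1 / T * (\<integral>p. g p \<partial>Lam T)\<bar> \<le> err T" by auto
    have "(\<integral>p. s * g p \<partial>Lam T) \<le> (\<integral>p. s * c + \<kappa> * (8 + 4 / l * \<xi> (L p)) \<partial>Lam T)"
    proof (rule integral_mono)
      fix p assume "p \<in> space (Lam T)"
      then have "s * g p \<le> s * c + \<kappa> * (1 + norm (L p)) ^ 3" by (intro up) auto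
      also have "\<dots> \<le> s * c + \<kappa> * (8 + 4 / l * \<xi> (L p))"
        using \<kappa> cube by (intro add_left_mono mult_left_mono)
      finally show "s * g p \<le> s * c + \<kappa> * (8 + 4 / l * \<xi> (L p))" .
    qed (use i in auto)
    then have "1 / T * (\<integral>p. s * g p \<partial>Lam T) \<le> 1 / T * (\<integral>p. s * c + \<kappa> * (8 + 4 / l * \<xi> (L p)) \<partial>Lam T)"
      using elim by (intro mult_left_mono) auto
    with bound[OF elim, of "s * c"] have "1 / T * (\<integral>p. s * g p \<partial>Lam T) \<le> s * c + \<kappa> * D"
      by (rule order_trans[rotated])
    moreover have "s = 1 \<or> s = - 1" using s by linarith
    ultimately show ?case using i(3) by auto
  qed
  show "Liminf at_top (\<lambda>T. ereal (avg T)) \<le> ereal (c + \<kappa> * D)"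
    if up: "\<And>p. p \<in> space pred \<Longrightarrow> g p \<le> c + \<kappa> * (1 + norm (L p)) ^ 3"
  proof -
    have "Liminf at_top (\<lambda>T. ereal (avg T)) \<le> Liminf at_top (\<lambda>T. ereal (c + \<kappa> * D + err T))"
      using half[of 1] up by (intro Liminf_mono) simp
    also have "\<dots> = ereal (c + \<kappa> * D + 0)"
      by (intro lim_imp_Liminf tendsto_ereal tendsto_add tendsto_const err0) simp
    finally show ?thesis by simp
  qed
  show "ereal (c - \<kappa> * D) \<le> Liminf at_top (\<lambda>T. ereal (avg T))"
    if low: "\<And>p. p \<in> space pred \<Longrightarrow> c - \<kappa> * (1 + norm (L p)) ^ 3 \<le> g p"
  proof -
    have "- g p \<le> - c + \<kappa> * (1 + norm (L p)) ^ 3" if "p \<in> space pred" for p using low[OF that] by linarith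
    from half[of "- 1"] this have "\<forall>\<^sub>F T in at_top. c - \<kappa> * D - err T \<le> avg T"
      by (auto elim: eventually_mono)
    then have "Liminf at_top (\<lambda>T. ereal (c - \<kappa> * D - err T)) \<le> Liminf at_top (\<lambda>T. ereal (avg T))"
      by (intro Liminf_mono) simp
    moreover have "Liminf at_top (\<lambda>T. ereal (c - \<kappa> * D - err T)) = ereal (c - \<kappa> * D - 0)"
      by (intro lim_imp_Liminf tendsto_ereal tendsto_diff tendsto_const err0) simp
    ultimately show ?thesis by simp
  qed
qed

end

section \<open>Controlled jump processes\<close>

locale controlled_jumps = marked_jumps M N T E \<nu> \<eta>
  for M :: "'w measure" and N :: "'w \<Rightarrow> ('e::euclidean_space \<times> real) measure" and T E \<nu> \<eta> +
  fixes b :: "'x \<Rightarrow> 'a::topological_space \<Rightarrow> 'e \<Rightarrow> 'x::euclidean_space"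
    and A :: "'a set" and r :: "'x \<Rightarrow> 'a \<Rightarrow> real"
  assumes b_measurable: "(\<lambda>((y, a), e). b y a e) \<in> borel_measurable ((borel \<Otimes>\<^sub>M restrict_space borel A) \<Otimes>\<^sub>M borel)"
    and r_measurable: "(\<lambda>(y, a). r y a) \<in> borel_measurable (borel \<Otimes>\<^sub>M restrict_space borel A)"
begin

abbreviation controls :: "(real \<Rightarrow> 'w \<Rightarrow> 'a) set" where
  "controls \<equiv> predictable_controls M F A"

definition coeff :: "(real \<Rightarrow> 'w \<Rightarrow> 'a) \<Rightarrow> real \<times> 'w \<Rightarrow> 'x \<Rightarrow> 'e \<Rightarrow> 'x" where
  "coeff \<alpha> p y e = b y (case p of (s, \<omega>) \<Rightarrow> \<alpha> s \<omega>) e"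

lemma coeff_Pair: "coeff \<alpha> (s, \<omega>) y e = b y (\<alpha> s \<omega>) e"
  by (simp add: coeff_def)

lemma control_measurable:
  assumes "\<alpha> \<in> controls"
  shows "(\<lambda>(s, \<omega>). \<alpha> s \<omega>) \<in> measurable pred (restrict_space borel A)"
  using assms by (intro measurable_restrict_space2) (auto simp: predictable_controls_def)

lemma control_coeff_measurable:
  assumes "\<alpha> \<in> controls"
  shows "coeff_measurable (coeff \<alpha>)"
proof -
  have "(\<lambda>q. ((snd (fst q), (\<lambda>(s, \<omega>). \<alpha> s \<omega>) (fst (fst q))), snd q))
    \<in> measurable ((pred \<Otimes>\<^sub>M borel) \<Otimes>\<^sub>M borel) (((borel :: 'x measure) \<Otimes>\<^sub>M restrict_space borel A) \<Otimes>\<^sub>M (borel :: 'e measure))"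
    by (intro measurable_Pair measurable_snd measurable_compose[OF measurable_fst measurable_snd]
        measurable_compose[OF measurable_compose[OF measurable_fst measurable_fst] control_measurable[OF assms]])
  from measurable_compose[OF this b_measurable] show ?thesis
    by (rule measurable_eqI[rotated]) (auto simp: coeff_def)
qed

lemma reward_measurable:
  assumes "\<alpha> \<in> controls" and L: "L \<in> borel_measurable pred"
  shows "(\<lambda>p. r (L p) (case p of (s, \<omega>) \<Rightarrow> \<alpha> s \<omega>)) \<in> borel_measurable pred"
  using measurable_compose[OF measurable_Pair[OF L control_measurable[OF assms(1)]] r_measurable] by simp

lemma jump_equation_coeff:
  assumes "jump_solution M N b x \<alpha> X" "\<alpha> \<in> controls"
  shows "jump_equation M N T E \<nu> \<eta> (coeff \<alpha>) X x"
  using assms control_coeff_measurable[OF assms(2)]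
  by unfold_locales (simp_all add: jump_solution_def coeff_def)

lemma jump_solution_exists:
  assumes "\<alpha> \<in> controls"
  shows "\<exists>X. jump_solution M N b x \<alpha> X"
proof
  note m = control_coeff_measurable[OF assms]
  show "jump_solution M N b x \<alpha> (solution (coeff \<alpha>) x)"
    unfolding jump_solution_def
  proof (intro conjI)
    show "AE \<omega> in M. \<forall>t\<ge>0. solution (coeff \<alpha>) x t \<omega> = x +
      (LINT z:UNIV \<times> {0..t}|N \<omega>. b (left_lim (solution (coeff \<alpha>) x) (snd z) \<omega>) (\<alpha> (snd z) \<omega>) (fst z))"
      using AE_good
    proof eventually_elim
      case (elim \<omega>)
      from solution_integral[OF m elim, of x] show ?case by (simp add: coeff_Pair)
    qed
  qed (rule solution_adapted[OF m] cadlag_solution)+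
qed

text \<open>The feedback equation has a coefficient that depends on the state alone, so it is solved
  first. The control is then read off the left limits of the solution, which are
  predictable.\<close>

lemma closed_loop_exists:
  assumes ahat: "ahat \<in> borel_measurable borel" "\<And>y. ahat y \<in> A"
  shows "\<exists>X. jump_solution M N b x (\<lambda>t \<omega>. ahat (left_lim X t \<omega>)) X \<and> (\<lambda>t \<omega>. ahat (left_lim X t \<omega>)) \<in> controls"
proof -
  let ?\<beta> = "\<lambda>(p :: real \<times> 'w) y e. b y (ahat y) e"
  have ahat': "ahat \<in> measurable borel (restrict_space borel A)"
    using ahat by (intro measurable_restrict_space2) auto
  have "(\<lambda>q. ((snd (fst q), ahat (snd (fst q))), snd q))
    \<in> measurable ((pred \<Otimes>\<^sub>M borel) \<Otimes>\<^sub>M borel) (((borel :: 'x measure) \<Otimes>\<^sub>M restrict_space borel A) \<Otimes>\<^sub>M (borel :: 'e measure))"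
    by (intro measurable_Pair measurable_snd measurable_compose[OF measurable_fst measurable_snd]
        measurable_compose[OF measurable_compose[OF measurable_fst measurable_snd] ahat'])
  from measurable_compose[OF this b_measurable]
  have m: "coeff_measurable ?\<beta>"
    by (rule measurable_eqI[rotated]) auto
  let ?X = "solution ?\<beta> x"
  note ad = solution_adapted[OF m, of x]
  have "jump_solution M N b x (\<lambda>t \<omega>. ahat (left_lim ?X t \<omega>)) ?X"
    unfolding jump_solution_def
  proof (intro conjI)
    show "AE \<omega> in M. \<forall>t\<ge>0. ?X t \<omega> = x +
      (LINT z:UNIV \<times> {0..t}|N \<omega>. b (left_lim ?X (snd z) \<omega>) (ahat (left_lim ?X (snd z) \<omega>)) (fst z))"
      using AE_good
    proof eventually_elim
      case (elim \<omega>)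
      from solution_integral[OF m elim, of x] show ?case by simp
    qed
  qed (rule ad cadlag_solution)+
  moreover have "(\<lambda>t \<omega>. ahat (left_lim ?X t \<omega>)) \<in> controls"
    using measurable_compose[OF left_lim_predictable[OF ad cadlag_solution] ahat(1)] ahat(2)
    by (simp add: predictable_controls_def case_prod_beta)
  ultimately show ?thesis by blast
qed

text \<open>The reward integrates against the time marginal of \<open>N\<close>; the change of
  variables leads back to \<open>N\<close>, hence to jump sums.\<close>

lemma integral_time_eq_jsum:
  fixes h :: "real \<times> 'w \<Rightarrow> real"
  assumes h: "h \<in> borel_measurable pred" and t: "0 \<le> t"
  shows "(\<integral>\<omega>. (LINT s:{0..t}|distr (N \<omega>) borel snd. h (s, \<omega>)) \<partial>M) = (\<integral>\<omega>. jsum t (\<lambda>(p, e). h p) \<omega> \<partial>M)"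
proof -
  have [measurable]: "(snd :: 'e \<times> real \<Rightarrow> real) \<in> borel_measurable borel"
    by (intro borel_measurable_continuous_onI continuous_intros)
  have hm: "(\<lambda>(p, e). h p) \<in> borel_measurable predE"
    unfolding case_prod_beta by (rule measurable_compose[OF measurable_fst h])
  have sp: "(LINT s:{0..t}|distr (N \<omega>) borel snd. h (s, \<omega>)) = (LINT z:UNIV \<times> {0..t}|N \<omega>. h (snd z, \<omega>))"
    if \<omega>: "\<omega> \<in> space M" for \<omega>
  proof -
    have "(\<lambda>s. (s, \<omega>)) \<in> measurable (restrict_space borel {0..t}) pred"
      using \<omega> by (intro measurable_predI measurable_Pair measurable_restrict_space1) (auto simp: space_restrict_space)
    from measurable_compose[OF this h]
    have m: "(\<lambda>s. indicator {0..t} s *\<^sub>R h (s, \<omega>)) \<in> borel_measurable borel"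
      by (subst (asm) borel_measurable_restrict_space_iff) auto
    have "snd \<in> measurable (N \<omega>) (borel :: real measure)" by (simp add: N_eq[OF \<omega>])
    then have "(LINT s:{0..t}|distr (N \<omega>) borel snd. h (s, \<omega>)) = (\<integral>z. indicator {0..t} (snd z) *\<^sub>R h (snd z, \<omega>) \<partial>N \<omega>)"
      unfolding set_lebesgue_integral_def by (rule integral_distr[OF _ m])
    also have "\<dots> = (LINT z:UNIV \<times> {0..t}|N \<omega>. h (snd z, \<omega>))"
      unfolding set_lebesgue_integral_def by (intro Bochner_Integration.integral_cong) (auto simp: indicator_def)
    finally show ?thesis .
  qed
  have "(\<integral>\<omega>. (LINT s:{0..t}|distr (N \<omega>) borel snd. h (s, \<omega>)) \<partial>M) = (\<integral>\<omega>. (LINT z:UNIV \<times> {0..t}|N \<omega>. h (snd z, \<omega>)) \<partial>M)"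
    by (intro Bochner_Integration.integral_cong sp refl)
  also have "\<dots> = (\<integral>\<omega>. jsum t (\<lambda>(p, e). h p) \<omega> \<partial>M)"
  proof (rule integral_cong_AE)
    let ?S = "space M \<times> (UNIV \<times> {0..t}) :: ('w \<times> 'e \<times> real) set"
    have S: "?S \<inter> space (M \<Otimes>\<^sub>M borel) \<in> sets (M \<Otimes>\<^sub>M borel)" by auto
    have "(\<lambda>q. (snd (snd q), fst q)) \<in> measurable (restrict_space (M \<Otimes>\<^sub>M borel) ?S) pred"
      by (intro measurable_predI measurable_Pair measurable_restrict_space1
          measurable_compose[OF measurable_snd] measurable_fst) (auto simp: space_restrict_space)
    from measurable_compose[OF this h]
    have m: "(\<lambda>q. indicator ?S q *\<^sub>R h (snd (snd q), fst q)) \<in> borel_measurable (M \<Otimes>\<^sub>M (borel :: ('e \<times> real) measure))"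
      by (subst (asm) borel_measurable_restrict_space_iff[OF S])
    have "(\<lambda>(\<omega>, z). indicator (UNIV \<times> {0..t}) z *\<^sub>R h (snd z, \<omega>)) \<in> borel_measurable (M \<Otimes>\<^sub>M (borel :: ('e \<times> real) measure))"
      by (rule measurable_cong[THEN iffD1, OF _ m]) (auto simp: space_pair_measure indicator_def)
    then show "(\<lambda>\<omega>. LINT z:UNIV \<times> {0..t}|N \<omega>. h (snd z, \<omega>)) \<in> borel_measurable M"
      unfolding set_lebesgue_integral_def by (rule borel_measurable_integral_N)
    show "jsum t (\<lambda>(p, e). h p) \<in> borel_measurable M"
      by (rule measurable_F_M[OF jsum_measurable[OF t hm]])
    show "AE \<omega> in M. (LINT z:UNIV \<times> {0..t}|N \<omega>. h (snd z, \<omega>)) = jsum t (\<lambda>(p, e). h p) \<omega>"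
      using AE_good by eventually_elim (use LINT_N_eq_jsum[OF hm] in simp)
  qed
  finally show ?thesis .
qed

text \<open>The reward is computed from any solution: two solutions agree at the jump times, which carry
  the measure \<open>dN\<close>.\<close>

lemma jump_reward_eq:
  assumes X: "jump_solution M N b x \<alpha> X" and \<alpha>: "\<alpha> \<in> controls"
  shows "jump_reward M N b r \<eta> x \<alpha> = Liminf at_top (\<lambda>t. ereal (1 / (\<eta> * t) *
    (\<integral>\<omega>. jsum t (\<lambda>(p, e). r ((\<lambda>(s, \<omega>). left_lim X s \<omega>) p) (case p of (s, \<omega>) \<Rightarrow> \<alpha> s \<omega>)) \<omega> \<partial>M)))"
  unfolding jump_reward_def
proof (rule Liminf_eq)
  let ?Y = "jump_state M N b x \<alpha>"
  have Y: "jump_solution M N b x \<alpha> ?Y"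
    unfolding jump_state_def by (rule someI_ex[OF jump_solution_exists[OF \<alpha>]])
  interpret X: jump_equation M N T E \<nu> \<eta> "coeff \<alpha>" X x by (rule jump_equation_coeff[OF X \<alpha>])
  interpret Y: jump_equation M N T E \<nu> \<eta> "coeff \<alpha>" ?Y x by (rule jump_equation_coeff[OF Y \<alpha>])
  let ?R = "\<lambda>L p. r (L p) (case p of (s, \<omega>) \<Rightarrow> \<alpha> s \<omega>)"
  have m: "(\<lambda>(p, e). ?R L p) \<in> borel_measurable predE" if "L \<in> borel_measurable pred" for L
    unfolding case_prod_beta[of "\<lambda>p e. ?R L p"] by (rule measurable_compose[OF measurable_fst reward_measurable[OF \<alpha> that]])
  show "\<forall>\<^sub>F t in at_top. ereal (1 / (\<eta> * t) * (\<integral>\<omega>. (LINT s:{0..t}|distr (N \<omega>) borel snd. r (left_lim ?Y s \<omega>) (\<alpha> s \<omega>)) \<partial>M))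
    = ereal (1 / (\<eta> * t) * (\<integral>\<omega>. jsum t (\<lambda>(p, e). ?R (\<lambda>(s, \<omega>). left_lim X s \<omega>) p) \<omega> \<partial>M))"
    using eventually_ge_at_top[of 0]
  proof eventually_elim
    case (elim t)
    have "(\<integral>\<omega>. (LINT s:{0..t}|distr (N \<omega>) borel snd. r (left_lim ?Y s \<omega>) (\<alpha> s \<omega>)) \<partial>M)
      = (\<integral>\<omega>. jsum t (\<lambda>(p, e). ?R Y.L p) \<omega> \<partial>M)"
      using integral_time_eq_jsum[OF reward_measurable[OF \<alpha> Y.L_measurable] elim] by (simp add: Y.L_def)
    also have "\<dots> = (\<integral>\<omega>. jsum t (\<lambda>(p, e). ?R X.L p) \<omega> \<partial>M)"
    proof (rule integral_cong_AE)
      show "AE \<omega> in M. jsum t (\<lambda>(p, e). ?R Y.L p) \<omega> = jsum t (\<lambda>(p, e). ?R X.L p) \<omega>"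
        using X.AE_chain Y.AE_chain
        by eventually_elim (use elim in \<open>simp add: jsum_def\<close>)
    qed (rule measurable_F_M[OF jsum_measurable[OF elim m]], rule Y.L_measurable X.L_measurable)+
    finally show ?case by (simp add: X.L_def)
  qed
qed

text \<open>The drift inequality \<open>up\<close> holds for all actions and bounds the value from
  above. Its reverse \<open>low\<close>, along \<open>ahat\<close>, bounds the feedback reward from
  below, and the value lies above that reward because the feedback control is admissible.\<close>

lemma control_bounds:
  fixes \<phi> \<xi> :: "'x \<Rightarrow> real"
  assumes \<phi>: "\<phi> \<in> borel_measurable borel" "\<And>y. \<bar>\<phi> y\<bar> \<le> C\<phi> * (1 + norm y)"
    and growth: "\<And>y a e. a \<in> A \<Longrightarrow> norm (b y a e) \<le> K * (1 + norm y)"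
    and \<xi>: "\<xi> \<in> borel_measurable borel" "\<And>y. 0 \<le> \<xi> y" "\<xi> 0 = 0"
    and int: "\<And>y a. a \<in> A \<Longrightarrow> integrable \<nu> (\<lambda>e. \<xi> (y + b y a e))"
    and drift: "\<And>y a. a \<in> A \<Longrightarrow> \<eta> * (\<integral>e. \<xi> (y + b y a e) - \<xi> y \<partial>\<nu>) \<le> - C1 * \<xi> y + C2"
    and C: "0 < C1" "0 \<le> C2" and l: "0 < l" "\<And>y. l * norm y powr q \<le> \<xi> y" "3 \<le> q"
    and r: "\<And>y a. a \<in> A \<Longrightarrow> \<bar>r y a\<bar> \<le> R"
    and \<kappa>: "0 \<le> \<kappa>"
    and up: "\<And>y a. a \<in> A \<Longrightarrow> \<eta> * (\<integral>e. \<phi> (y + b y a e) - \<phi> y \<partial>\<nu>) + r y a \<le> c + \<kappa> * (1 + norm y) ^ 3"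
    and ahat: "ahat \<in> borel_measurable borel" "\<And>y. ahat y \<in> A"
    and low: "\<And>y. c - \<kappa> * (1 + norm y) ^ 3 \<le> \<eta> * (\<integral>e. \<phi> (y + b y (ahat y) e) - \<phi> y \<partial>\<nu>) + r y (ahat y)"
  defines "D \<equiv> 8 + 4 * C2 / (C1 * l)"
  shows "\<exists>X. jump_solution M N b 0 (\<lambda>t \<omega>. ahat (left_lim X t \<omega>)) X \<and>
    ereal (c - \<kappa> * D) \<le> jump_reward M N b r \<eta> 0 (\<lambda>t \<omega>. ahat (left_lim X t \<omega>)) \<and>
    jump_reward M N b r \<eta> 0 (\<lambda>t \<omega>. ahat (left_lim X t \<omega>)) \<le> jump_value M N b r \<eta> A \<and>
    jump_value M N b r \<eta> A \<le> ereal (c + \<kappa> * D)"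
proof -
  have ctl: "(case p of (s, \<omega>) \<Rightarrow> \<alpha> s \<omega>) \<in> A" if "\<alpha> \<in> controls" "p \<in> space pred" for \<alpha> p
    using that by (auto simp: predictable_controls_def)
  have upper: "jump_reward M N b r \<eta> 0 \<alpha> \<le> ereal (c + \<kappa> * D)" if \<alpha>: "\<alpha> \<in> controls" for \<alpha>
  proof -
    obtain X where X: "jump_solution M N b 0 \<alpha> X" using jump_solution_exists[OF \<alpha>] by blast
    interpret X: jump_equation M N T E \<nu> \<eta> "coeff \<alpha>" X 0 by (rule jump_equation_coeff[OF X \<alpha>])
    show ?thesis
      unfolding jump_reward_eq[OF X \<alpha>] X.L_def[symmetric] D_def
      by (rule X.long_run_average(1)[where \<phi> = \<phi> and C\<phi> = C\<phi> and K = K and \<xi> = \<xi> and l = l and q = q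
            and rr = "\<lambda>p. r (X.L p) (case p of (s, \<omega>) \<Rightarrow> \<alpha> s \<omega>)" and R = R])
        (use \<phi> growth \<xi> int drift C l r \<kappa> up ctl[OF \<alpha>] reward_measurable[OF \<alpha> X.L_measurable] in \<open>simp_all add: coeff_def\<close>)
  qed
  obtain X where X: "jump_solution M N b 0 (\<lambda>t \<omega>. ahat (left_lim X t \<omega>)) X"
    and \<alpha>: "(\<lambda>t \<omega>. ahat (left_lim X t \<omega>)) \<in> controls"
    using closed_loop_exists[OF ahat] by blast
  let ?\<alpha> = "\<lambda>t \<omega>. ahat (left_lim X t \<omega>)"
  interpret X: jump_equation M N T E \<nu> \<eta> "coeff ?\<alpha>" X 0 by (rule jump_equation_coeff[OF X \<alpha>])
  have aL: "(case p of (s, \<omega>) \<Rightarrow> ?\<alpha> s \<omega>) = ahat (X.L p)" for p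
    by (simp add: X.L_def case_prod_beta)
  have "ereal (c - \<kappa> * D) \<le> jump_reward M N b r \<eta> 0 ?\<alpha>"
    unfolding jump_reward_eq[OF X \<alpha>] X.L_def[symmetric] D_def
    by (rule X.long_run_average(2)[where \<phi> = \<phi> and C\<phi> = C\<phi> and K = K and \<xi> = \<xi> and l = l and q = q
          and rr = "\<lambda>p. r (X.L p) (case p of (s, \<omega>) \<Rightarrow> ?\<alpha> s \<omega>)" and R = R])
      (use \<phi> growth \<xi> int drift C l r \<kappa> low ahat(2) reward_measurable[OF \<alpha> X.L_measurable] in \<open>simp_all add: coeff_def aL\<close>)
  moreover have "jump_reward M N b r \<eta> 0 ?\<alpha> \<le> jump_value M N b r \<eta> A"
    unfolding jump_value_def by (rule SUP_upper[OF \<alpha>])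
  moreover have "jump_value M N b r \<eta> A \<le> ereal (c + \<kappa> * D)"
    unfolding jump_value_def by (rule SUP_least[OF upper])
  ultimately show ?thesis using X by blast
qed

end

section \<open>The expansion of the optimal value\<close>

theorem theorem3p7:
  fixes A :: "(real ^ 'm) set"
    and \<nu> :: "(real ^ 'e) measure"
    and b1 :: "real ^ 'd \<Rightarrow> real ^ 'm \<Rightarrow> real ^ 'e \<Rightarrow> real ^ 'd"
    and b2 :: "real ^ 'd \<Rightarrow> real ^ 'e \<Rightarrow> real ^ 'd"
    and b :: "real \<Rightarrow> real ^ 'd \<Rightarrow> real ^ 'm \<Rightarrow> real ^ 'e \<Rightarrow> real ^ 'd"
    and r :: "real ^ 'd \<Rightarrow> real ^ 'm \<Rightarrow> real"
    and \<mu> :: "real ^ 'd \<Rightarrow> real ^ 'm \<Rightarrow> real ^ 'd"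
    and \<sigma> :: "real ^ 'd \<Rightarrow> real ^ 'd ^ 'd"
    and M :: "real \<Rightarrow> 'w measure"
    and N :: "real \<Rightarrow> 'w \<Rightarrow> ((real ^ 'e) \<times> real) measure"
    and P :: "'v measure"
    and W :: "real \<Rightarrow> 'v \<Rightarrow> real ^ 'd"
    and \<zeta> :: "real ^ 'd \<Rightarrow> real ^ 'd \<Rightarrow> real"
    and \<xi> :: "real ^ 'd \<Rightarrow> real"
    and L_b1b2 c_ell L_br l_\<zeta> L_\<zeta> C_\<zeta> p_\<zeta> l_\<xi> L_\<xi> C1_\<xi> C2_\<xi> p_\<xi> L_V C_X p_X :: real
    and V :: "real \<Rightarrow> real ^ 'd \<Rightarrow> real"
    and \<rho>_bar :: real
    and w :: "real ^ 'd \<Rightarrow> real"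
    and lam :: "nat \<Rightarrow> real"
    and f :: "real ^ 'd \<Rightarrow> real ^ 'm \<Rightarrow> real"
    and \<gamma> \<gamma>\<^sub>0 \<delta>\<gamma> \<delta>C :: real
    and \<delta>\<rho> :: "real \<Rightarrow> real"
    and \<delta>w :: "real \<Rightarrow> real ^ 'd \<Rightarrow> real"
  \<comment> \<open>the pure jump problem\<close>
  assumes A: "compact A" "A \<noteq> {}"
    and \<nu>: "prob_space \<nu>" "sets \<nu> = sets borel"
    and M: "\<forall>\<epsilon>\<in>{0<..<1}. prob_space (M \<epsilon>)"
    and N: "\<forall>\<epsilon>\<in>{0<..<1}. marked_point_process (M \<epsilon>) (N \<epsilon>)"
    and N_compensator: "\<forall>\<epsilon>\<in>{0<..<1}. has_compensator (M \<epsilon>) (mark_filtration (M \<epsilon>) (N \<epsilon>)) (N \<epsilon>)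
          (scale_measure (ennreal (1 / \<epsilon>)) (\<nu> \<Otimes>\<^sub>M lborel))"
  \<comment> \<open>diffusive scaling\<close>
    and b_eq: "b = scaled_coeff b1 b2"
    and b1_cont: "continuous_on (UNIV \<times> A \<times> UNIV) (\<lambda>(x, a, e). b1 x a e)"
    and b2_cont: "continuous_on UNIV (\<lambda>(x, e). b2 x e)"
    and assm_a: "L_b1b2 > 0"
      "\<forall>a\<in>A. \<forall>e. (SUP x. ereal (norm (b1 x a e) / (1 + norm x))) + (SUP x. ereal (norm (b2 x e)))
         \<le> ereal L_b1b2"
    and assm_b: "\<forall>x. (\<integral>e. b2 x e \<partial>\<nu>) = 0"
      "c_ell > 0"
      "\<forall>x. loewner_le (c_ell *\<^sub>R mat 1) (\<integral>e. outer (b2 x e) (b2 x e) \<partial>\<nu>)"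
    and \<mu>_eq: "\<mu> = (\<lambda>x a. \<integral>e. b1 x a e \<partial>\<nu>)"
    and assm_c: "\<exists>L. \<forall>a\<in>A. L-lipschitz_on UNIV (\<lambda>x. \<mu> x a)"
      "\<exists>L. L-lipschitz_on UNIV \<sigma>"
      "\<forall>x. \<sigma> x ** transpose (\<sigma> x) = (\<integral>e. outer (b2 x e) (b2 x e) \<partial>\<nu>)"
    and assm_d_coeff: "continuous_on (UNIV \<times> A) (\<lambda>(x, a). r x a)"
      "L_br > 0"
      "\<forall>\<epsilon>\<in>{0<..<1}. \<forall>a\<in>A. \<forall>e.
         (SUP x. ereal (norm (b \<epsilon> x a e) / (1 + norm x))) + (SUP x. ereal \<bar>r x a\<bar>) + lip_const (\<lambda>x. r x a)
           \<le> ereal L_br"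
    and assm_d_zeta: "continuous_on UNIV (\<lambda>(x, x'). \<zeta> x x')"
      "l_\<zeta> > 0" "L_\<zeta> > 0" "C_\<zeta> > 0" "p_\<zeta> \<ge> 1"
      "\<forall>x x'. 0 \<le> \<zeta> x x'"
      "\<forall>x x'. l_\<zeta> * norm (x - x') powr p_\<zeta> \<le> \<zeta> x x' \<and> \<zeta> x x' \<le> L_\<zeta> * norm (x - x') powr p_\<zeta>"
      "\<forall>\<epsilon>\<in>{0<..<1}. \<forall>x x'. \<forall>a\<in>A.
         1 / \<epsilon> * (\<integral>e. \<zeta> (x + b \<epsilon> x a e) (x' + b \<epsilon> x' a e) - \<zeta> x x' \<partial>\<nu>) \<le> - C_\<zeta> * \<zeta> x x'"
    and assm_d_xi: "continuous_on UNIV \<xi>"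
      "l_\<xi> > 0" "L_\<xi> > 0" "C1_\<xi> > 0" "p_\<xi> \<ge> 1"
      "\<forall>x. 0 \<le> \<xi> x"
      "\<forall>x. l_\<xi> * norm x powr p_\<xi> \<le> \<xi> x \<and> \<xi> x \<le> L_\<xi> * norm x powr p_\<xi>"
      "\<forall>\<epsilon>\<in>{0<..<1}. \<forall>x. \<forall>a\<in>A.
         1 / \<epsilon> * (\<integral>e. \<xi> (x + b \<epsilon> x a e) - \<xi> x \<partial>\<nu>) \<le> - C1_\<xi> * \<xi> x + C2_\<xi>"
  \<comment> \<open>the limit diffusion problem and its stability\<close>
    and W: "brownian_motion P W"
    and V_eq: "V = diffusion_discounted_value P W \<mu> \<sigma> r A"
    and \<rho>_bar_eq: "\<rho>_bar = real_of_ereal (diffusion_ergodic_value P W \<mu> \<sigma> r A 0)"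
    and assm_e: "L_V > 0" "\<forall>l\<in>{0<..<1}. \<forall>x x'. \<bar>V l x - V l x'\<bar> \<le> L_V * norm (x - x')"
    and assm_f: "C_X > 0" "p_X \<ge> 1"
      "\<forall>x. \<forall>\<alpha>\<in>predictable_controls P (augmented_filtration P W) A. \<forall>t\<ge>0.
         (\<integral>\<^sup>+\<omega>. ennreal (norm (diffusion_state P W \<mu> \<sigma> x \<alpha> t \<omega>) powr p_X) \<partial>P)
           \<le> ennreal (C_X * (exp (- t / C_X) * norm x powr p_X + 1))"
  \<comment> \<open>the fixed limit \<open>w\<close>\<close>
    and w_limit: "\<forall>n. lam n > 0" "lam \<longlonglongrightarrow> 0"
      "\<forall>K. compact K \<longrightarrow> uniform_limit K (\<lambda>n x. V (lam n) x - V (lam n) 0) w sequentially"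
    and w_reg: "C2_on UNIV w" "\<exists>L. L-lipschitz_on UNIV w"
      "\<forall>\<beta>\<in>{0<..<1}. \<exists>L. \<forall>x. C2_hoelder_norm \<beta> (ball x 1) w \<le> ereal (L * (1 + norm x))"
    and w_hjb: "\<forall>x. ereal \<rho>_bar = (SUP a\<in>A. ereal (generator \<mu> \<sigma> a w x + r x a))"
  \<comment> \<open>hypotheses of the theorem\<close>
    and p: "p_\<xi> \<ge> 3" "p_X \<ge> 3"
    and \<gamma>: "0 < \<gamma>" "\<gamma> < 1"
    and \<gamma>\<^sub>0: "0 < \<gamma>\<^sub>0" "\<gamma>\<^sub>0 \<le> \<gamma>"
    and \<delta>\<gamma>: "0 < \<delta>\<gamma>" "\<delta>\<gamma> < 1"
    and f_eq: "f = (\<lambda>x a. generator \<mu> \<sigma> a w x + r x a - \<rho>_bar)"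
    and \<delta>w_lin: "\<forall>\<epsilon>\<in>{0<..<1}. \<delta>w \<epsilon> \<in> C0_lin"
    and \<delta>w_bound: "\<forall>\<epsilon>\<in>{0<..<1}. \<forall>x.
         C2_hoelder_norm \<delta>\<gamma> (ball x 1) (\<delta>w \<epsilon>) \<le> ereal (\<delta>C * (1 + norm x))"
    and \<delta>w_hjb: "\<forall>\<epsilon>\<in>{0<..<1}. \<forall>x. ereal (\<delta>\<rho> \<epsilon>) =
         (SUP a\<in>A. ereal (generator \<mu> \<sigma> a (\<delta>w \<epsilon>) x
            + \<epsilon> powr (- \<gamma>\<^sub>0 / 2) * (residual \<nu> (b \<epsilon>) \<mu> \<sigma> w \<epsilon> x a + f x a)))"
  shows "Limsup (at_right 0) (\<lambda>\<epsilon>. ereal \<bar>\<delta>\<rho> \<epsilon>\<bar>) < \<infinity>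
    \<and> Limsup (at_right 0) (\<lambda>\<epsilon>. ereal (\<epsilon> powr (- (\<gamma>\<^sub>0 + \<delta>\<gamma>) / 2)) *
          \<bar>jump_value (M \<epsilon>) (N \<epsilon>) (b \<epsilon>) r (1 / \<epsilon>) A - ereal (\<rho>_bar + \<epsilon> powr (\<gamma>\<^sub>0 / 2) * \<delta>\<rho> \<epsilon>)\<bar>) < \<infinity>
    \<and> (\<exists>(ahat :: real \<Rightarrow> real ^ 'd \<Rightarrow> real ^ 'm) (X :: real \<Rightarrow> real \<Rightarrow> 'w \<Rightarrow> real ^ 'd).
          (\<forall>\<epsilon>\<in>{0<..<1}.
             ahat \<epsilon> \<in> borel_measurable borel \<and> (\<forall>x. ahat \<epsilon> x \<in> A) \<and>
             (\<forall>x. ereal (generator \<mu> \<sigma> (ahat \<epsilon> x) (\<delta>w \<epsilon>) x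
                    + \<epsilon> powr (- \<gamma>\<^sub>0 / 2) * (residual \<nu> (b \<epsilon>) \<mu> \<sigma> w \<epsilon> x (ahat \<epsilon> x) + f x (ahat \<epsilon> x))) =
                  (SUP a\<in>A. ereal (generator \<mu> \<sigma> a (\<delta>w \<epsilon>) x
                    + \<epsilon> powr (- \<gamma>\<^sub>0 / 2) * (residual \<nu> (b \<epsilon>) \<mu> \<sigma> w \<epsilon> x a + f x a)))) \<and>
             jump_solution (M \<epsilon>) (N \<epsilon>) (b \<epsilon>) 0 (\<lambda>t \<omega>. ahat \<epsilon> (left_lim (X \<epsilon>) t \<omega>)) (X \<epsilon>)) \<and>
          Limsup (at_right 0) (\<lambda>\<epsilon>. ereal (\<epsilon> powr (- (\<gamma>\<^sub>0 + \<delta>\<gamma>) / 2)) *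
             \<bar>jump_value (M \<epsilon>) (N \<epsilon>) (b \<epsilon>) r (1 / \<epsilon>) A -
              jump_reward (M \<epsilon>) (N \<epsilon>) (b \<epsilon>) r (1 / \<epsilon>) 0
                (\<lambda>t \<omega>. ahat \<epsilon> (left_lim (X \<epsilon>) t \<omega>))\<bar>) < \<infinity>)"
proof -
  let ?res = "\<lambda>u \<epsilon>. residual \<nu> (b \<epsilon>) \<mu> \<sigma> u \<epsilon>" and ?gen = "generator \<mu> \<sigma>"
  let ?m = "\<lambda>\<epsilon>. \<epsilon> powr (- \<gamma>\<^sub>0 / 2)" and ?q = "\<lambda>\<epsilon>. \<epsilon> powr (\<gamma>\<^sub>0 / 2)"
    and ?s = "\<lambda>\<epsilon>. \<epsilon> powr ((\<gamma>\<^sub>0 + \<delta>\<gamma>) / 2)" and ?t = "\<lambda>\<epsilon>. \<epsilon> powr (- (\<gamma>\<^sub>0 + \<delta>\<gamma>) / 2)"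
  let ?S = "\<lambda>\<epsilon> ah X. jump_solution (M \<epsilon>) (N \<epsilon>) (b \<epsilon>) 0 (\<lambda>t \<omega>. ah (left_lim X t \<omega>)) X"
    and ?R = "\<lambda>\<epsilon> ah X. jump_reward (M \<epsilon>) (N \<epsilon>) (b \<epsilon>) r (1 / \<epsilon>) 0 (\<lambda>t \<omega>. ah (left_lim X t \<omega>))"
    and ?J = "\<lambda>\<epsilon>. jump_value (M \<epsilon>) (N \<epsilon>) (b \<epsilon>) r (1 / \<epsilon>) A"
    and ?c = "\<lambda>\<epsilon>. \<rho>_bar + \<epsilon> powr (\<gamma>\<^sub>0 / 2) * \<delta>\<rho> \<epsilon>"
  \<comment> \<open>One constant, at least 1, for both coefficients, as the Taylor estimate
    requires.\<close>
  define K where "K = max 1 L_b1b2"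
  have K: "1 \<le> K" by (simp add: K_def)
  obtain a0 where a0: "a0 \<in> A" using A by blast
  interpret \<nu>: prob_space \<nu> by (rule \<nu>(1))
  have b12: "norm (b1 x a e) \<le> K * (1 + norm x) \<and> norm (b2 x e) \<le> K" if a: "a \<in> A" for x a e
  proof -
    let ?s = "SUP x. ereal (norm (b1 x a e) / (1 + norm x))" and ?t = "SUP x. ereal (norm (b2 x e))"
    have "0 \<le> ?s" "0 \<le> ?t" by (rule SUP_upper2[OF UNIV_I], simp)+
    note le = ereal_add_nonneg_leD[OF this assm_a(2)[rule_format, OF a]]
    have "ereal (norm (b1 x a e) / (1 + norm x)) \<le> ereal L_b1b2"
      by (rule order_trans[OF SUP_upper le(1)]) simp
    then have "norm (b1 x a e) \<le> L_b1b2 * (1 + norm x)"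
      by (simp add: pos_divide_le_eq add_pos_nonneg)
    also have "\<dots> \<le> K * (1 + norm x)" by (intro mult_right_mono) (auto simp: K_def)
    finally have 1: "norm (b1 x a e) \<le> K * (1 + norm x)" .
    have "ereal (norm (b2 x e)) \<le> ereal L_b1b2"
      by (rule order_trans[OF SUP_upper le(2)]) simp
    with 1 show ?thesis by (simp add: K_def)
  qed
  have b1_bd: "norm (b1 x a e) \<le> K * (1 + norm x)" if "a \<in> A" for x a e using b12[OF that] by blast
  have b2_bd: "norm (b2 x e) \<le> K" for x e using b12[OF a0] by blast
  have r_bd: "\<bar>r x a\<bar> \<le> L_br" if a: "a \<in> A" for x a
  proof -
    \<comment> \<open>Any \<epsilon> in the open unit interval serves to isolate the bound on
      \<open>r\<close> from the sum of three suprema.\<close>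
    let ?s = "SUP x. ereal (norm (b (1/2) x a undefined) / (1 + norm x))" and ?t = "SUP x. ereal \<bar>r x a\<bar>"
    let ?l = "lip_const (\<lambda>x. r x a)"
    have nn: "0 \<le> ?s" "0 \<le> ?t" by (rule SUP_upper2[OF UNIV_I], simp add: add_nonneg_nonneg)+
    have "(axis undefined 1, 0) \<in> {(x, y). x \<noteq> (y :: real ^ 'd)}" by (simp add: axis_eq_0_iff)
    then have "0 \<le> ?l" unfolding lip_const_def by (rule SUP_upper2) simp
    moreover have "?s + ?t + ?l \<le> ereal L_br" using assm_d_coeff(3) a by simp
    ultimately have "?t \<le> ereal L_br" using nn by (meson ereal_add_nonneg_leD add_nonneg_nonneg)
    then show ?thesis by (simp add: SUP_le_iff)
  qed
  have b: "b \<epsilon> x a e = \<epsilon> *\<^sub>R b1 x a e + sqrt \<epsilon> *\<^sub>R b2 x e" for \<epsilon> x a e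
    by (simp add: b_eq scaled_coeff_def)
  have b_bd: "norm (b \<epsilon> x a e) \<le> 2 * K * (1 + norm x)" if "0 < \<epsilon>" "\<epsilon> < 1" "a \<in> A" for \<epsilon> x a e
  proof -
    have "norm (b \<epsilon> x a e) \<le> \<epsilon> * norm (b1 x a e) + sqrt \<epsilon> * norm (b2 x e)"
      unfolding b by (rule norm_triangle_le) (use that in auto)
    also have "\<dots> \<le> 1 * (K * (1 + norm x)) + 1 * (K * (1 + norm x))"
    proof (intro add_mono mult_mono)
      have "norm (b2 x e) \<le> K * 1" using b2_bd by simp
      also have "\<dots> \<le> K * (1 + norm x)" using K by (intro mult_left_mono) auto
      finally show "norm (b2 x e) \<le> K * (1 + norm x)" .
    qed (use that b1_bd[OF that(3), of x e] in auto)
    finally show ?thesis by simp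
  qed
  have \<nu>_cong: "measurable \<nu> = (measurable borel :: (real ^ 'd) measure \<Rightarrow> _)"
    by (intro ext measurable_cong_sets \<nu>(2) refl)
  have c1: "continuous_on UNIV (b1 x a)" if "a \<in> A" for x a
    using continuous_on_compose2[OF b1_cont, of UNIV "\<lambda>e. (x, a, e)"] that by (simp add: continuous_intros image_subset_iff)
  have c2: "continuous_on UNIV (b2 x)" for x
    using continuous_on_compose2[OF b2_cont, of UNIV "\<lambda>e. (x, e)"] by (simp add: continuous_intros)
  have m1: "b1 x a \<in> borel_measurable \<nu>" if "a \<in> A" for x a
    unfolding \<nu>_cong by (rule borel_measurable_continuous_onI[OF c1[OF that]])
  have m2: "b2 x \<in> borel_measurable \<nu>" for x
    unfolding \<nu>_cong by (rule borel_measurable_continuous_onI[OF c2])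
  have mb: "b \<epsilon> x a \<in> borel_measurable \<nu>" if "a \<in> A" for \<epsilon> x a
    unfolding b[abs_def] using m1[OF that, of x] m2[of x] by measurable
  have res: "\<bar>?res u \<epsilon> x a\<bar> \<le> 26 * L * K ^ 4 * \<epsilon> powr (\<beta> / 2) * (1 + norm x) ^ 3"
    if "\<And>y. C2_hoelder_norm \<beta> (ball y 1) u \<le> ereal (L * (1 + norm y))" "0 < \<beta>" "\<beta> < 1" "0 < \<epsilon>" "\<epsilon> < 1" "a \<in> A"
    for \<beta> u L \<epsilon> x a
    unfolding b_eq using assm_b(1) assm_c(3)
    by (intro residual_bound that(1-5) K \<nu>(1) m1 m2 b1_bd b2_bd that(6)) (auto simp: \<mu>_eq)
  \<comment> \<open>The residual is exactly what the diffusion generator lacks to the rescaled jump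
    generator.\<close>
  have gen: "?gen a u x + ?res u \<epsilon> x a = 1 / \<epsilon> * (\<integral>e. u (x + b \<epsilon> x a e) - u x \<partial>\<nu>)"
    for a u x \<epsilon> by (simp add: generator_def residual_def)
  note dw = C2_hoelder_norm_leD[OF \<delta>w_bound[rule_format]]
  have \<delta>C: "0 \<le> \<delta>C" using dw(3)[of "1/2" 0] by simp
  obtain Lw where Lw: "Lw-lipschitz_on UNIV w" using w_reg(2) by blast
  have w_cont: "continuous_on UNIV w" using Lw by (rule lipschitz_on_continuous_on)
  have w_lip: "\<bar>w y - w z\<bar> \<le> Lw * norm (y - z)" for y z
    using lipschitz_onD[OF Lw, of y z] by (simp add: dist_norm)
  have Lw0: "0 \<le> Lw" using lipschitz_on_nonneg[OF Lw] .
  obtain L\<gamma> where L\<gamma>: "\<And>x. C2_hoelder_norm \<gamma> (ball x 1) w \<le> ereal (L\<gamma> * (1 + norm x))"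
    using w_reg(3) \<gamma> by force
  \<comment> \<open>By the Bellman equation of \<open>w\<close>, \<open>f\<close> is nonpositive
    with supremum 0 at every point. This keeps the factor
    \<open>\<epsilon> powr (- \<gamma>\<^sub>0 / 2)\<close> in front of it from making
    \<open>\<delta>\<rho>\<close> unbounded.\<close>
  have f_le: "f x a \<le> 0" if "a \<in> A" for x a
  proof -
    have "ereal (?gen a w x + r x a) \<le> ereal \<rho>_bar"
      unfolding w_hjb[rule_format, of x] by (rule SUP_upper[OF that])
    then show ?thesis by (simp add: f_eq)
  qed
  have f_sup: "\<exists>a\<in>A. - h < f x a" if "0 < h" for x h
  proof -
    have "ereal (\<rho>_bar - h) < (SUP a\<in>A. ereal (?gen a w x + r x a))"
      using that unfolding w_hjb[rule_format, of x, symmetric] by simp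
    then obtain a where "a \<in> A" "ereal (\<rho>_bar - h) < ereal (?gen a w x + r x a)"
      unfolding less_SUP_iff by blast
    then show ?thesis by (intro bexI[of _ a]) (auto simp: f_eq)
  qed
  define G where "G \<epsilon> x a = ?gen a (\<delta>w \<epsilon>) x + ?m \<epsilon> * (?res w \<epsilon> x a + f x a)" for \<epsilon> x a
  have hjb: "ereal (\<delta>\<rho> \<epsilon>) = (SUP a\<in>A. ereal (G \<epsilon> x a))" if "0 < \<epsilon>" "\<epsilon> < 1" for \<epsilon> x
    using \<delta>w_hjb that by (simp add: G_def)
  have G_le: "G \<epsilon> x a \<le> \<delta>\<rho> \<epsilon>" if "0 < \<epsilon>" "\<epsilon> < 1" "a \<in> A" for \<epsilon> x a
  proof -
    have "ereal (G \<epsilon> x a) \<le> ereal (\<delta>\<rho> \<epsilon>)"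
      unfolding hjb[OF that(1,2), of x] by (rule SUP_upper[OF that(3)])
    then show ?thesis by simp
  qed
  obtain Kt where Kt: "\<And>H. norm (trace (\<sigma> 0 ** transpose (\<sigma> 0) ** H)) \<le> norm H * Kt" "0 \<le> Kt"
    using bounded_linear.nonneg_bounded[OF bounded_linear_mult_trace[of "\<sigma> 0 ** transpose (\<sigma> 0)"]] by blast
  \<comment> \<open>Gradient and trace parts of the generator of \<open>\<delta>w \<epsilon>\<close>
    at 0, the scaled residual of \<open>w\<close> at 0, and 1 for an action at which
    \<open>f\<close> is nearly 0.\<close>
  define B\<rho> where "B\<rho> = \<delta>C * K + \<delta>C * Kt + 26 * L\<gamma> * K ^ 4 + 1"
  have \<mu>_bd: "norm (\<mu> x a) \<le> K * (1 + norm x)" if a: "a \<in> A" for x a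
  proof -
    have i: "integrable \<nu> (b1 x a)"
      using b1_bd[OF a] m1[OF a] by (intro \<nu>.integrable_const_bound) auto
    have "norm (\<mu> x a) \<le> (\<integral>e. norm (b1 x a e) \<partial>\<nu>)" unfolding \<mu>_eq by (rule integral_norm_bound)
    also have "\<dots> \<le> (\<integral>e. K * (1 + norm x) \<partial>\<nu>)"
      using i b1_bd[OF a] by (intro integral_mono) auto
    finally show ?thesis by (simp add: \<nu>.prob_space)
  qed
  have B\<rho>: "\<bar>\<delta>\<rho> \<epsilon>\<bar> \<le> B\<rho>" if \<epsilon>: "0 < \<epsilon>" "\<epsilon> < 1" for \<epsilon>
  proof -
    have g1: "\<bar>?gen a (\<delta>w \<epsilon>) 0\<bar> \<le> \<delta>C * K + \<delta>C * Kt" if a: "a \<in> A" for a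
    proof -
      have "norm (grad (\<delta>w \<epsilon>) 0) \<le> \<delta>C" "norm (hess (\<delta>w \<epsilon>) 0) \<le> \<delta>C"
        using dw(4,5)[of \<epsilon> 0] \<epsilon> by auto
      then have "\<bar>grad (\<delta>w \<epsilon>) 0 \<bullet> \<mu> 0 a\<bar> \<le> \<delta>C * K" "norm (hess (\<delta>w \<epsilon>) 0) * Kt \<le> \<delta>C * Kt"
        using \<mu>_bd[OF a, of 0] \<delta>C Kt(2)
        by (auto intro!: order_trans[OF Cauchy_Schwarz_ineq2] mult_mono mult_right_mono)
      with Kt(1)[of "hess (\<delta>w \<epsilon>) 0"] show ?thesis unfolding generator_def real_norm_def by linarith
    qed
    have p: "0 < ?m \<epsilon>" using \<epsilon> by simp
    have g2: "\<bar>?m \<epsilon> * ?res w \<epsilon> 0 a\<bar> \<le> 26 * L\<gamma> * K ^ 4" if a: "a \<in> A" for a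
    proof -
      have "0 \<le> L\<gamma>" using C2_hoelder_norm_leD(3)[OF L\<gamma>, of 0] by auto
      have "\<bar>?m \<epsilon> * ?res w \<epsilon> 0 a\<bar> \<le> ?m \<epsilon> * (26 * L\<gamma> * K ^ 4 * \<epsilon> powr (\<gamma> / 2))"
        using res[OF L\<gamma> \<gamma> \<epsilon> a, of 0] p by (simp add: abs_mult)
      \<comment> \<open>The residual of \<open>w\<close> is of order
        \<open>\<epsilon> powr (\<gamma> / 2)\<close>; as
        \<open>\<gamma>\<^sub>0 \<le> \<gamma>\<close>, this absorbs the negative power.\<close>
      also have "\<dots> = 26 * L\<gamma> * K ^ 4 * \<epsilon> powr ((\<gamma> - \<gamma>\<^sub>0) / 2)"
        by (simp add: powr_add[symmetric] diff_divide_distrib)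
      also have "\<dots> \<le> 26 * L\<gamma> * K ^ 4 * 1"
        using \<open>0 \<le> L\<gamma>\<close> K \<epsilon> \<gamma>\<^sub>0 by (intro mult_left_mono powr_le1) auto
      finally show ?thesis by simp
    qed
    have G_eq: "G \<epsilon> 0 a = ?gen a (\<delta>w \<epsilon>) 0 + ?m \<epsilon> * ?res w \<epsilon> 0 a + ?m \<epsilon> * f 0 a" for a
      by (simp add: G_def distrib_left)
    have "ereal (\<delta>\<rho> \<epsilon>) \<le> ereal B\<rho>"
      unfolding hjb[OF \<epsilon>, of 0]
    proof (rule SUP_least)
      fix a assume a: "a \<in> A"
      have "?m \<epsilon> * f 0 a \<le> 0" using f_le[OF a, of 0] p by (simp add: mult_le_0_iff)
      with g1[OF a] g2[OF a] show "ereal (G \<epsilon> 0 a) \<le> ereal B\<rho>" unfolding G_eq B\<rho>_def by simp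
    qed
    moreover have "- B\<rho> \<le> \<delta>\<rho> \<epsilon>"
    proof -
      \<comment> \<open>The tolerance is the inverse of the large factor, so the term with
        \<open>f\<close> costs at most 1.\<close>
      obtain a where a: "a \<in> A" "- (1 / ?m \<epsilon>) < f 0 a" using f_sup[of "1 / ?m \<epsilon>" 0] p by auto
      have "- 1 = ?m \<epsilon> * (- (1 / ?m \<epsilon>))" using p by simp
      also have "\<dots> \<le> ?m \<epsilon> * f 0 a" using a(2) p by (intro mult_left_mono) auto
      finally have "- B\<rho> \<le> G \<epsilon> 0 a" using g1[OF a(1)] g2[OF a(1)] unfolding G_eq B\<rho>_def by linarith
      with G_le[OF \<epsilon> a(1), of 0] show ?thesis by linarith
    qed
    ultimately show ?thesis by simp
  qed
  \<comment> \<open>The constant of \<open>control_bounds\<close>. As \<open>C2_\<xi>\<close> may be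
    negative, the drift condition is weakened to its positive part.\<close>
  define D where "D = 8 + 4 * max 0 C2_\<xi> / (C1_\<xi> * l_\<xi>)"
  define C where "C = 26 * \<delta>C * K ^ 4"
  have CD: "0 \<le> C" "0 \<le> D" using \<delta>C K assm_d_xi by (auto simp: C_def D_def)
  have cont3: "continuous_on (UNIV \<times> A \<times> UNIV) (\<lambda>(x, a, e). b \<epsilon> x a e)" for \<epsilon>
  proof -
    have "continuous_on (UNIV \<times> A \<times> UNIV) (\<lambda>z. (\<lambda>(x, e). b2 x e) (fst z, snd (snd z)))"
      by (rule continuous_on_compose2[OF b2_cont]) (auto intro!: continuous_intros)
    with b1_cont show ?thesis unfolding b case_prod_beta by (auto intro!: continuous_intros)
  qed
  have cont_e: "continuous_on (UNIV \<times> A) (\<lambda>p. h (fst p) (snd p) e)"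
    if "continuous_on (UNIV \<times> A \<times> UNIV) (\<lambda>(x, a, e). h x a e)" for h :: "real ^ 'd \<Rightarrow> real ^ 'm \<Rightarrow> real ^ 'e \<Rightarrow> real ^ 'd" and e
  proof -
    have "continuous_on (UNIV \<times> A) (\<lambda>p. (\<lambda>(x, a, e). h x a e) (fst p, snd p, e))"
      by (rule continuous_on_compose2[OF that]) (auto intro!: continuous_intros)
    then show ?thesis by simp
  qed
  have \<mu>_cont: "continuous_on (UNIV \<times> A) (\<lambda>p. \<mu> (fst p) (snd p))"
    unfolding \<mu>_eq using m1 b1_bd
    by (intro continuous_on_integral_bounded[where B = "\<lambda>p. K * (1 + norm (fst p))"] \<nu>(1) cont_e b1_cont)
      (auto intro!: continuous_intros)
  obtain L\<sigma> where "L\<sigma>-lipschitz_on UNIV \<sigma>" using assm_c(2) by blast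
  then have \<sigma>_cont: "continuous_on UNIV \<sigma>" by (rule lipschitz_on_continuous_on)
  \<comment> \<open>All that is required of one feedback map and one solution at a given \<epsilon>,
    so that a single choice over \<epsilon> produces both families.\<close>
  define optimal where "optimal \<epsilon> ah X \<longleftrightarrow> ah \<in> borel_measurable borel \<and> (\<forall>x. ah x \<in> A) \<and> (\<forall>x. G \<epsilon> x (ah x) = \<delta>\<rho> \<epsilon>) \<and>
      ?S \<epsilon> ah X \<and>
      ereal (?c \<epsilon> - ?s \<epsilon> * C * D)
        \<le> ?R \<epsilon> ah X \<and>
      ?R \<epsilon> ah X \<le> ?J \<epsilon> \<and>
      ?J \<epsilon>
        \<le> ereal (?c \<epsilon> + ?s \<epsilon> * C * D)" for \<epsilon> ah X
  have key: "\<exists>ah X. optimal \<epsilon> ah X"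
    if \<epsilon>: "0 < \<epsilon>" "\<epsilon> < 1" for \<epsilon>
  proof -
    have \<epsilon>': "\<epsilon> \<in> {0<..<1}" using \<epsilon> by simp
    have C2w: "\<And>x. \<delta>w \<epsilon> differentiable (at x)" "\<And>x. grad (\<delta>w \<epsilon>) differentiable (at x)"
      using dw(1,2)[OF \<epsilon>'] by blast+
    have dw_cont: "continuous_on UNIV (\<delta>w \<epsilon>)" "continuous_on UNIV (grad (\<delta>w \<epsilon>))"
      using C2w by (meson differentiable_imp_continuous_within continuous_at_imp_continuous_on)+
    have hess_cont: "continuous_on UNIV (hess (\<delta>w \<epsilon>))"
    proof (rule continuous_at_imp_continuous_on, rule ballI)
      fix x :: "real ^ 'd"
      have "C2_on (ball x 1) (\<delta>w \<epsilon>)"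
        using \<delta>w_bound[rule_format, OF \<epsilon>', of x] by (auto simp: C2_hoelder_norm_def split: if_splits)
      then have "continuous_on (ball x 1) (hess (\<delta>w \<epsilon>))" by (simp add: C2_on_def)
      then show "isCont (hess (\<delta>w \<epsilon>)) x" by (simp add: continuous_on_eq_continuous_at)
    qed
    \<comment> \<open>Generator and residual of \<open>w\<close> merge into a jump integral, whose
      continuity in state and action follows by dominated convergence; derivatives appear for
      \<open>\<delta>w \<epsilon>\<close> alone.\<close>
    have G_eq: "G \<epsilon> x a = grad (\<delta>w \<epsilon>) x \<bullet> \<mu> x a + 1 / 2 * trace (\<sigma> x ** transpose (\<sigma> x) ** hess (\<delta>w \<epsilon>) x)
      + ?m \<epsilon> * (1 / \<epsilon> * (\<integral>e. w (x + b \<epsilon> x a e) - w x \<partial>\<nu>) + r x a - \<rho>_bar)" for x a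
      unfolding G_def generator_def[of \<mu> \<sigma> a "\<delta>w \<epsilon>"] f_eq gen[symmetric] by (simp add: algebra_simps)
    have I_cont: "continuous_on (UNIV \<times> A) (\<lambda>p. \<integral>e. w (fst p + b \<epsilon> (fst p) (snd p) e) - w (fst p) \<partial>\<nu>)"
    proof (rule continuous_on_integral_bounded[where B = "\<lambda>p. Lw * (2 * K * (1 + norm (fst p)))"])
      show "continuous_on (UNIV \<times> A) (\<lambda>p. w (fst p + b \<epsilon> (fst p) (snd p) e) - w (fst p))" for e
        by (intro continuous_intros continuous_on_compose2[OF w_cont] cont_e cont3) auto
      fix p assume "p \<in> (UNIV :: (real ^ 'd) set) \<times> A"
      then have a: "snd p \<in> A" by auto
      have "w \<in> borel_measurable borel" by (rule borel_measurable_continuous_onI[OF w_cont])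
      then show "(\<lambda>e. w (fst p + b \<epsilon> (fst p) (snd p) e) - w (fst p)) \<in> borel_measurable \<nu>"
        using mb[OF a, of \<epsilon> "fst p"] by measurable
      show "norm (w (fst p + b \<epsilon> (fst p) (snd p) e) - w (fst p)) \<le> Lw * (2 * K * (1 + norm (fst p)))" for e
        using w_lip[of "fst p + b \<epsilon> (fst p) (snd p) e" "fst p"] b_bd[OF \<epsilon> a, of "fst p" e] Lw0
        by (simp add: order_trans[OF _ mult_left_mono])
    qed (auto intro!: continuous_intros \<nu>(1))
    have G_cont: "continuous_on (UNIV \<times> A) (\<lambda>(x, a). G \<epsilon> x a)"
      unfolding case_prod_beta G_eq
      by (intro continuous_intros I_cont \<mu>_cont continuous_on_trace_mult
          continuous_on_compose2[OF dw_cont(2)] continuous_on_compose2[OF \<sigma>_cont] continuous_on_compose2[OF hess_cont]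
          assm_d_coeff(1)[unfolded case_prod_beta]) auto
    from measurable_argmax[OF A G_cont hjb[OF \<epsilon>]] obtain ah
      where ah: "ah \<in> borel_measurable borel" "\<And>x. ah x \<in> A" "\<And>x. G \<epsilon> x (ah x) = \<delta>\<rho> \<epsilon>" by blast
    obtain T E where TE: "\<forall>n. T n \<in> borel_measurable (M \<epsilon>) \<and> E n \<in> borel_measurable (M \<epsilon>)"
      "\<forall>\<omega>\<in>space (M \<epsilon>). 0 < T 0 \<omega> \<and> (\<forall>n. T n \<omega> \<le> T (Suc n) \<omega> \<and> (T n \<omega> < \<infinity> \<longrightarrow> T n \<omega> < T (Suc n) \<omega>))"
      "AE \<omega> in M \<epsilon>. (\<lambda>n. T n \<omega>) \<longlonglongrightarrow> \<infinity>"
      "\<forall>\<omega>\<in>space (M \<epsilon>). N \<epsilon> \<omega> = distr (count_space {n. T n \<omega> < \<infinity>}) borel (\<lambda>n. (E n \<omega>, real_of_ereal (T n \<omega>)))"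
      using N[rule_format, OF \<epsilon>'] unfolding marked_point_process_def by (elim exE conjE)
    interpret J: controlled_jumps "M \<epsilon>" "N \<epsilon>" T E \<nu> "1 / \<epsilon>" "b \<epsilon>" A r
    proof (intro controlled_jumps.intro marked_jumps.intro controlled_jumps_axioms.intro)
      show "(\<lambda>((y, a), e). b \<epsilon> y a e) \<in> borel_measurable ((borel \<Otimes>\<^sub>M restrict_space borel A) \<Otimes>\<^sub>M borel)"
        using borel_measurable_continuous_on_Times[OF cont3] by simp
      show "(\<lambda>(y, a). r y a) \<in> borel_measurable (borel \<Otimes>\<^sub>M restrict_space borel A)"
        by (rule borel_measurable_continuous_on_Times2[OF assm_d_coeff(1)])
    qed (use TE M N_compensator \<nu> \<epsilon> \<epsilon>' in auto)
    define \<phi> where "\<phi> y = w y + ?q \<epsilon> * \<delta>w \<epsilon> y" for y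
    define \<kappa> where "\<kappa> = ?s \<epsilon> * C"
    have \<phi>_cont: "continuous_on UNIV \<phi>"
      unfolding \<phi>_def by (intro continuous_intros w_cont dw_cont)
    have iu: "integrable \<nu> (\<lambda>e. u (y + b \<epsilon> y a e))" if "continuous_on UNIV u" "a \<in> A" for u :: "real ^ 'd \<Rightarrow> real" and y a
      by (rule integrable_continuous_shift[OF \<nu>(1) that(1) mb[OF that(2)] b_bd[OF \<epsilon> that(2)]])
    have pp: "?q \<epsilon> * ?m \<epsilon> = 1"
      using \<epsilon> by (simp add: powr_add[symmetric])
    \<comment> \<open>The weight of the corrector cancels the amplification inside \<open>G\<close>,
      which restores residual and \<open>f\<close> of \<open>w\<close> at their true size; beyond
      \<open>G\<close> only the residual of \<open>\<delta>w \<epsilon>\<close> is left, and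
      \<open>G\<close> is at most \<open>\<delta>\<rho> \<epsilon>\<close>, with equality at the
      maximiser.\<close>
    have drift_eq: "1 / \<epsilon> * (\<integral>e. \<phi> (y + b \<epsilon> y a e) - \<phi> y \<partial>\<nu>) + r y a
      = \<rho>_bar + ?q \<epsilon> * (G \<epsilon> y a + ?res (\<delta>w \<epsilon>) \<epsilon> y a)" if a: "a \<in> A" for y a
    proof -
      let ?I = "\<lambda>u. \<integral>e. u (y + b \<epsilon> y a e) - u y \<partial>\<nu>"
      have "?I \<phi>
        = (\<integral>e. (w (y + b \<epsilon> y a e) - w y) + ?q \<epsilon> * (\<delta>w \<epsilon> (y + b \<epsilon> y a e) - \<delta>w \<epsilon> y) \<partial>\<nu>)"
        by (simp add: \<phi>_def algebra_simps)
      also have "\<dots> = ?I w + ?q \<epsilon> * ?I (\<delta>w \<epsilon>)"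
        using iu[OF w_cont a] iu[OF dw_cont(1) a] by simp
      finally have I: "?I \<phi>
        = ?I w + ?q \<epsilon> * ?I (\<delta>w \<epsilon>)" .
      have "1 / \<epsilon> * ?I \<phi>
        = (?gen a w y + ?res w \<epsilon> y a)
          + ?q \<epsilon> * (?gen a (\<delta>w \<epsilon>) y + ?res (\<delta>w \<epsilon>) \<epsilon> y a)"
        unfolding I gen by (simp add: distrib_left mult.left_commute)
      moreover have "?q \<epsilon> * G \<epsilon> y a = ?q \<epsilon> * ?gen a (\<delta>w \<epsilon>) y
          + (?res w \<epsilon> y a + f y a)"
        unfolding G_def distrib_left mult.assoc[symmetric] pp by simp
      ultimately show ?thesis by (simp add: f_eq distrib_left)
    qed
    have res': "\<bar>?q \<epsilon> * ?res (\<delta>w \<epsilon>) \<epsilon> y a\<bar> \<le> \<kappa> * (1 + norm y) ^ 3" if a: "a \<in> A" for y a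
    proof -
      have "\<bar>?q \<epsilon> * ?res (\<delta>w \<epsilon>) \<epsilon> y a\<bar>
        \<le> ?q \<epsilon> * (26 * \<delta>C * K ^ 4 * \<epsilon> powr (\<delta>\<gamma> / 2) * (1 + norm y) ^ 3)"
        using res[OF \<delta>w_bound[rule_format, OF \<epsilon>'] \<delta>\<gamma> \<epsilon> a, of y] \<epsilon> by (simp add: abs_mult)
      also have "\<dots> = \<kappa> * (1 + norm y) ^ 3"
        by (simp add: \<kappa>_def C_def add_divide_distrib powr_add)
      finally show ?thesis .
    qed
    have up: "1 / \<epsilon> * (\<integral>e. \<phi> (y + b \<epsilon> y a e) - \<phi> y \<partial>\<nu>) + r y a \<le> ?c \<epsilon> + \<kappa> * (1 + norm y) ^ 3" if a: "a \<in> A" for y a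
    proof -
      have "?q \<epsilon> * G \<epsilon> y a \<le> ?q \<epsilon> * \<delta>\<rho> \<epsilon>"
        using G_le[OF \<epsilon> a] by (intro mult_left_mono) auto
      then show ?thesis unfolding drift_eq[OF a] distrib_left using res'[OF a, of y] by linarith
    qed
    have low: "?c \<epsilon> - \<kappa> * (1 + norm y) ^ 3 \<le> 1 / \<epsilon> * (\<integral>e. \<phi> (y + b \<epsilon> y (ah y) e) - \<phi> y \<partial>\<nu>) + r y (ah y)" for y
      unfolding drift_eq[OF ah(2)] distrib_left ah(3) using res'[OF ah(2), of y y] by linarith
    have \<phi>_bd: "\<bar>\<phi> y\<bar> \<le> (\<bar>w 0\<bar> + Lw + ?q \<epsilon> * \<delta>C) * (1 + norm y)" for y
    proof -
      have "\<bar>w y\<bar> \<le> \<bar>w 0\<bar> + Lw * norm y" using w_lip[of y 0] by simp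
      moreover have "\<bar>w 0\<bar> + Lw * norm y \<le> (\<bar>w 0\<bar> + Lw) * (1 + norm y)"
        using Lw0 by (simp add: algebra_simps)
      moreover have "\<bar>?q \<epsilon> * \<delta>w \<epsilon> y\<bar> \<le> ?q \<epsilon> * \<delta>C * (1 + norm y)"
        using dw(3)[OF \<epsilon>', of y] by (simp add: abs_mult mult.assoc mult_left_mono)
      ultimately show ?thesis unfolding \<phi>_def distrib_right by linarith
    qed
    \<comment> \<open>The two-sided growth bound pins \<xi> at the initial state, since
      \<open>0 powr p_\<xi> = 0\<close>.\<close>
    have \<xi>0: "\<xi> 0 = 0" using assm_d_xi(6,7) by (metis norm_zero powr_zero_eq_one powr_0 mult_zero_right antisym)
    have "\<exists>X. ?S \<epsilon> ah X \<and>
      ereal (?c \<epsilon> - \<kappa> * (8 + 4 * max 0 C2_\<xi> / (C1_\<xi> * l_\<xi>)))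
        \<le> ?R \<epsilon> ah X \<and>
      ?R \<epsilon> ah X \<le> ?J \<epsilon> \<and>
      ?J \<epsilon> \<le> ereal (?c \<epsilon> + \<kappa> * (8 + 4 * max 0 C2_\<xi> / (C1_\<xi> * l_\<xi>)))"
    proof (rule J.control_bounds[where \<phi> = \<phi> and \<xi> = \<xi> and q = p_\<xi> and R = L_br and K = "2 * K", OF _ \<phi>_bd])
      show "\<phi> \<in> borel_measurable borel" by (rule borel_measurable_continuous_onI[OF \<phi>_cont])
      show "\<xi> \<in> borel_measurable borel" by (rule borel_measurable_continuous_onI[OF assm_d_xi(1)])
      show "1 / \<epsilon> * (\<integral>e. \<xi> (y + b \<epsilon> y a e) - \<xi> y \<partial>\<nu>) \<le> - C1_\<xi> * \<xi> y + max 0 C2_\<xi>" if "a \<in> A" for y a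
        using assm_d_xi(8)[rule_format, OF \<epsilon>' that, of y] by simp
      show "0 \<le> \<kappa>" using CD by (simp add: \<kappa>_def)
    qed (use assm_d_xi \<xi>0 p b_bd[OF \<epsilon>] r_bd up low ah iu[OF assm_d_xi(1)] in auto)
    with ah show ?thesis unfolding optimal_def D_def[symmetric] \<kappa>_def by blast
  qed
  have "\<forall>\<epsilon>. \<exists>ah X. \<epsilon> \<in> {0<..<1} \<longrightarrow> optimal \<epsilon> ah X"
    using key by (metis greaterThanLessThan_iff)
  then obtain ahat X where opt: "\<And>\<epsilon>. \<epsilon> \<in> {0<..<1} \<Longrightarrow> optimal \<epsilon> (ahat \<epsilon>) (X \<epsilon>)"
    by metis
  have P: "ahat \<epsilon> \<in> borel_measurable borel" "\<And>x. ahat \<epsilon> x \<in> A" "\<And>x. G \<epsilon> x (ahat \<epsilon> x) = \<delta>\<rho> \<epsilon>"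
      "?S \<epsilon> (ahat \<epsilon>) (X \<epsilon>)"
      "ereal (?c \<epsilon> - ?s \<epsilon> * C * D)
        \<le> ?R \<epsilon> (ahat \<epsilon>) (X \<epsilon>)"
      "?R \<epsilon> (ahat \<epsilon>) (X \<epsilon>) \<le> ?J \<epsilon>"
      "?J \<epsilon>
        \<le> ereal (?c \<epsilon> + ?s \<epsilon> * C * D)"
    if "\<epsilon> \<in> {0<..<1}" for \<epsilon>
    using opt[OF that] unfolding optimal_def by blast+
  have ev: "\<forall>\<^sub>F \<epsilon>::real in at_right 0. \<epsilon> \<in> {0<..<1}" by (rule eventually_at_right_real) simp
  \<comment> \<open>Both quantities lie in the same interval around \<open>c\<close>, in particular
    they are finite; \<open>?t \<epsilon>\<close> is the reciprocal of the power of \<epsilon> in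
    its length.\<close>
  have scale: "ereal (?t \<epsilon>) * \<bar>u - v\<bar> \<le> ereal (2 * C * D)"
    if \<epsilon>: "0 < \<epsilon>" and uv: "ereal (c - ?s \<epsilon> * C * D) \<le> u" "u \<le> ereal (c + ?s \<epsilon> * C * D)"
      "ereal (c - ?s \<epsilon> * C * D) \<le> v" "v \<le> ereal (c + ?s \<epsilon> * C * D)"
    for \<epsilon> c u v
  proof -
    obtain u' where u': "u = ereal u'" using uv(1,2) by (cases u) auto
    obtain v' where v': "v = ereal v'" using uv(3,4) by (cases v) auto
    have pp: "?t \<epsilon> * ?s \<epsilon> = 1"
    proof -
      have z: "- a / 2 + a / 2 = 0" for a :: real by simp
      show ?thesis unfolding powr_add[symmetric] z using \<epsilon> by simp
    qed
    have "\<bar>u' - v'\<bar> \<le> ?s \<epsilon> * (2 * C * D)"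
      using uv unfolding u' v' ereal_less_eq by argo
    then have "?t \<epsilon> * \<bar>u' - v'\<bar> \<le> ?t \<epsilon> * (?s \<epsilon> * (2 * C * D))"
      by (intro mult_left_mono) auto
    also have "\<dots> = 2 * C * D" unfolding mult.assoc[symmetric] pp by simp
    finally show ?thesis by (simp add: u' v')
  qed
  have lim: "Limsup (at_right 0) g < \<infinity>" if "\<And>\<epsilon>. \<epsilon> \<in> {0<..<1} \<Longrightarrow> g \<epsilon> \<le> ereal B" for g :: "real \<Rightarrow> ereal" and B
  proof -
    have "Limsup (at_right 0) g \<le> ereal B"
      by (intro Limsup_bounded eventually_mono[OF ev] that)
    then show ?thesis by (rule le_less_trans) simp
  qed
  \<comment> \<open>The centre lies in the interval as well, so comparison with the expansion is
    another instance of \<open>scale\<close>.\<close>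
  have mid: "ereal (c - \<epsilon> powr s * C * D) \<le> ereal c" "ereal c \<le> ereal (c + \<epsilon> powr s * C * D)" for c \<epsilon> s
    using CD by simp_all
  show ?thesis
  proof (intro conjI exI[of _ ahat] exI[of _ X] ballI)
    show "Limsup (at_right 0) (\<lambda>\<epsilon>. ereal \<bar>\<delta>\<rho> \<epsilon>\<bar>) < \<infinity>"
      by (rule lim[of _ B\<rho>]) (use B\<rho> in auto)
    show "Limsup (at_right 0) (\<lambda>\<epsilon>. ereal (?t \<epsilon>) *
          \<bar>?J \<epsilon> - ereal (?c \<epsilon>)\<bar>) < \<infinity>"
    proof (rule lim)
      fix \<epsilon> :: real assume \<epsilon>: "\<epsilon> \<in> {0<..<1}"
      show "ereal (?t \<epsilon>) *
          \<bar>?J \<epsilon> - ereal (?c \<epsilon>)\<bar> \<le> ereal (2 * C * D)"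
        by (rule scale[OF _ order_trans[OF P(5)[OF \<epsilon>] P(6)[OF \<epsilon>]] P(7)[OF \<epsilon>] mid]) (use \<epsilon> in simp)
    qed
    show "Limsup (at_right 0) (\<lambda>\<epsilon>. ereal (?t \<epsilon>) *
             \<bar>?J \<epsilon> -
              ?R \<epsilon> (ahat \<epsilon>) (X \<epsilon>)\<bar>) < \<infinity>"
    proof (rule lim)
      fix \<epsilon> :: real assume \<epsilon>: "\<epsilon> \<in> {0<..<1}"
      show "ereal (?t \<epsilon>) *
             \<bar>?J \<epsilon> -
              ?R \<epsilon> (ahat \<epsilon>) (X \<epsilon>)\<bar> \<le> ereal (2 * C * D)"
        by (rule scale[OF _ order_trans[OF P(5)[OF \<epsilon>] P(6)[OF \<epsilon>]] P(7)[OF \<epsilon>] P(5)[OF \<epsilon>] order_trans[OF P(6)[OF \<epsilon>] P(7)[OF \<epsilon>]]])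
          (use \<epsilon> in simp)
    qed
  next
    fix \<epsilon> :: real assume \<epsilon>: "\<epsilon> \<in> {0<..<1}"
    show "ahat \<epsilon> \<in> borel_measurable borel" by (rule P(1)[OF \<epsilon>])
    show "\<forall>x. ahat \<epsilon> x \<in> A" using P(2)[OF \<epsilon>] by blast
    show "?S \<epsilon> (ahat \<epsilon>) (X \<epsilon>)" by (rule P(4)[OF \<epsilon>])
    show "\<forall>x. ereal (?gen (ahat \<epsilon> x) (\<delta>w \<epsilon>) x
                    + ?m \<epsilon> * (residual \<nu> (b \<epsilon>) \<mu> \<sigma> w \<epsilon> x (ahat \<epsilon> x) + f x (ahat \<epsilon> x))) =
                  (SUP a\<in>A. ereal (?gen a (\<delta>w \<epsilon>) x
                    + ?m \<epsilon> * (?res w \<epsilon> x a + f x a)))"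
      using P(3)[OF \<epsilon>] \<delta>w_hjb[rule_format, OF \<epsilon>] unfolding G_def by simp
  qed
qed

end
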